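(* Let $\mu$ be the measure on $(0,\infty)$ given by $$\mu=\sum_{m=0}^\infty H_m\delta_{A_m},\qquad H_m=2^{-m},\quad A_m=2^{m^2}.$$ Let $S=(S_t)$ be a non-decreasing, right-continuous Lévy process on $[0,\infty)$ with $S_0=0$, with Lévy measure $\mu$ and drift $0$. Let $X=(X_t)=(W(S_t))$ be a subordinated Brownian motion on $\mathbb{R}^d$ with subordinator $S$. Then $X$ does not satisfy the large-scale elliptic Harnack inequality (LargeEHI).
   Context: $\delta_x$ is the Dirac measure at $x$. A subordinator $S$ with drift $\gamma$ and Lévy measure $\mu$ satisfies $\mathbb{E}e^{-\lambda S_t}=e^{-t\phi(\lambda)}$ with $\phi(\lambda)=\gamma\lambda+\int_{(0,\infty)}(1-e^{-\lambda x})\,\mu(dx)$. $W$ is a standard Brownian motion on $\mathbb{R}^d$ independent of $S$. $X$ is right-continuous with left limits; $\mathbb{E}_x$ is the expectation for the process started at $X_0=x$. $B(x_0,r)$ is the open Euclidean ball; $\tau_U:=\inf\{t\ge0:X_t\notin U\}$. For open $D\subseteq\mathbb{R}^d$, $h:\mathbb{R}^d\to\mathbb{R}$ is harmonic on $D$ (with respect to $X$) if for every open set $E$ whose closure is compact and contained in $D$, $h(x)=\mathbb{E}_x[h(X_{\tau_E})]$ for all $x\in E$. $X$ satisfies LargeEHI if there exist $C_1,C_2>0$ and $\kappa\in(0,1)$ such that for all $x_0\in\mathbb{R}^d$ and $r\ge C_1$, every non-negative $h$ harmonic on $B(x_0,r)$ satisfies $h(x)\le C_2\,h(y)$ for all $x,y\in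 B(x_0,\kappa r)$. (The validity of LargeEHI does not depend on the specific $\kappa$.) *)

theory Defs
  imports "HOL-Probability.Probability"
begin

text \<open>
  Processes are functions \<open>X :: real \<Rightarrow> 'w \<Rightarrow> 'a\<close> on a probability space \<open>M\<close>; only the times
  \<open>t \<ge> 0\<close> matter. Path properties are required almost surely, and \<open>\<real>\<^sup>d\<close> is an arbitrary
  Euclidean space of dimension \<open>d\<close>.
\<close>

section \<open>Subordinators\<close>

definition independent_increments ::
    "'w measure \<Rightarrow> (real \<Rightarrow> 'w \<Rightarrow> 'a::euclidean_space) \<Rightarrow> bool" where
  "independent_increments M X \<longleftrightarrow>
    (\<forall>(n::nat) t::nat \<Rightarrow> real. 0 \<le> t 0 \<longrightarrow> mono t \<longrightarrow>
      prob_space.indep_vars M (\<lambda>_. borel) (\<lambda>i \<omega>. X (t (Suc i)) \<omega> - X (t i) \<omega>) {..<n})"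

definition stationary_increments ::
    "'w measure \<Rightarrow> (real \<Rightarrow> 'w \<Rightarrow> 'a::euclidean_space) \<Rightarrow> bool" where
  "stationary_increments M X \<longleftrightarrow>
    (\<forall>s\<ge>0. \<forall>t\<ge>0. distr M borel (\<lambda>\<omega>. X (s + t) \<omega> - X s \<omega>) = distr M borel (X t))"

text \<open>Measures on \<open>(0,\<infinity>)\<close> are represented as Borel measures on the real line carried by
  \<open>{0<..}\<close>.\<close>

definition subordinator_levy_measure :: "real measure \<Rightarrow> bool" where
  "subordinator_levy_measure \<mu> \<longleftrightarrow>
    sets \<mu> = sets borel \<and> emeasure \<mu> {..0} = 0 \<and>
    (\<integral>\<^sup>+x\<in>{0<..}. ennreal (min 1 x) \<partial>\<mu>) < \<infinity>"

definition laplace_exponent :: "real \<Rightarrow> real measure \<Rightarrow> real \<Rightarrow> real" where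
  "laplace_exponent \<gamma> \<mu> q = \<gamma> * q + (LINT x:{0<..}|\<mu>. (1 - exp (- q * x)))"

definition subordinator :: "'w measure \<Rightarrow> real \<Rightarrow> real measure \<Rightarrow> (real \<Rightarrow> 'w \<Rightarrow> real) \<Rightarrow> bool" where
  "subordinator M \<gamma> \<mu> S \<longleftrightarrow>
    0 \<le> \<gamma> \<and> subordinator_levy_measure \<mu> \<and>
    (\<forall>t\<ge>0. S t \<in> borel_measurable M) \<and>
    (AE \<omega> in M. S 0 \<omega> = 0 \<and> mono_on {0..} (\<lambda>t. S t \<omega>) \<and>
       (\<forall>t\<ge>0. continuous (at_right t) (\<lambda>u. S u \<omega>))) \<and>
    independent_increments M S \<and> stationary_increments M S \<and>
    (\<forall>t\<ge>0. \<forall>q\<ge>0. (\<integral>\<omega>. exp (- q * S t \<omega>) \<partial>M) = exp (- t * laplace_exponent \<gamma> \<mu> q))"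

section \<open>Brownian motion and independence of processes\<close>

text \<open>The increment over \<open>[s,t]\<close> is centred Gaussian with covariance \<open>(t - s)\<close> times the identity
  (so the generator is half the Laplacian); the second argument of \<^const>\<open>normal_density\<close>
  is the standard deviation.\<close>

definition standard_brownian_motion ::
    "'w measure \<Rightarrow> (real \<Rightarrow> 'w \<Rightarrow> 'a::euclidean_space) \<Rightarrow> bool" where
  "standard_brownian_motion M W \<longleftrightarrow>
    (\<forall>t\<ge>0. W t \<in> borel_measurable M) \<and>
    (AE \<omega> in M. W 0 \<omega> = 0 \<and> continuous_on {0..} (\<lambda>t. W t \<omega>)) \<and>
    independent_increments M W \<and>
    (\<forall>s\<ge>0. \<forall>t>s. distributed M lborel (\<lambda>\<omega>. W t \<omega> - W s \<omega>)
       (\<lambda>y. ennreal (\<Prod>b\<in>Basis. normal_density 0 (sqrt (t - s)) (y \<bullet> b))))"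

definition process_sigma ::
    "'w measure \<Rightarrow> (real \<Rightarrow> 'w \<Rightarrow> 'a::euclidean_space) \<Rightarrow> 'w measure" where
  "process_sigma M X =
    vimage_algebra (space M) (\<lambda>\<omega>. \<lambda>t\<in>{0..}. X t \<omega>) (Pi\<^sub>M {0..} (\<lambda>_. borel))"

definition independent_processes ::
    "'w measure \<Rightarrow> (real \<Rightarrow> 'w \<Rightarrow> 'a::euclidean_space) \<Rightarrow> (real \<Rightarrow> 'w \<Rightarrow> 'b::euclidean_space) \<Rightarrow> bool"
  where
  "independent_processes M X Y \<longleftrightarrow>
    prob_space.indep_set M (sets (process_sigma M X)) (sets (process_sigma M Y))"

section \<open>Harmonic functions and the large-scale elliptic Harnack inequality\<close>

definition exit_time :: "(real \<Rightarrow> 'w \<Rightarrow> 'a) \<Rightarrow> 'a set \<Rightarrow> 'w \<Rightarrow> ereal" where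
  "exit_time X U \<omega> = Inf (ereal ` {t. 0 \<le> t \<and> X t \<omega> \<notin> U})"

text \<open>The usual convention \<open>h(X\<^sub>\<infinity>) = 0\<close> is used on the event of no exit.\<close>

definition at_exit :: "(real \<Rightarrow> 'w \<Rightarrow> 'a) \<Rightarrow> 'a set \<Rightarrow> ('a \<Rightarrow> real) \<Rightarrow> 'w \<Rightarrow> real" where
  "at_exit X U h \<omega> =
    (if exit_time X U \<omega> = \<infinity> then 0 else h (X (real_of_ereal (exit_time X U \<omega>)) \<omega>))"

text \<open>
  A process with all its starting points is a family \<open>X\<close>, where \<open>X x\<close> is the process started at
  \<open>x\<close>; thus the expectation of \<open>F(X)\<close> under \<open>P\<^sub>x\<close> is the \<open>M\<close>-expectation of \<open>F(X x)\<close>.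
  Expectations are taken in the completion of \<open>M\<close>, since exit times of processes with jumps are
  in general measurable only with respect to the completed \<open>\<sigma>\<close>-algebra. Borel measurability and
  integrability make explicit that the expectation is meaningful (an undefined Bochner integral
  would be \<open>0\<close>).
\<close>

definition harmonic_on ::
    "'w measure \<Rightarrow> ('a::euclidean_space \<Rightarrow> real \<Rightarrow> 'w \<Rightarrow> 'a) \<Rightarrow> 'a set \<Rightarrow> ('a \<Rightarrow> real) \<Rightarrow> bool" where
  "harmonic_on M X D h \<longleftrightarrow>
    h \<in> borel_measurable borel \<and>
    (\<forall>E. open E \<and> compact (closure E) \<and> closure E \<subseteq> D \<longrightarrow>
      (\<forall>x\<in>E. integrable (completion M) (at_exit (X x) E h) \<and>
             h x = (\<integral>\<omega>. at_exit (X x) E h \<omega> \<partial>completion M)))"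

definition LargeEHI ::
    "'w measure \<Rightarrow> ('a::euclidean_space \<Rightarrow> real \<Rightarrow> 'w \<Rightarrow> 'a) \<Rightarrow> bool" where
  "LargeEHI M X \<longleftrightarrow>
    (\<exists>C1>0. \<exists>C2>0. \<exists>\<kappa>\<in>{0<..<1}. \<forall>x0. \<forall>r\<ge>C1. \<forall>h.
      (\<forall>x. 0 \<le> h x) \<and> harmonic_on M X (ball x0 r) h \<longrightarrow>
      (\<forall>x\<in>ball x0 (\<kappa> * r). \<forall>y\<in>ball x0 (\<kappa> * r). h x \<le> C2 * h y))"

definition subordinated ::
    "(real \<Rightarrow> 'w \<Rightarrow> 'a::euclidean_space) \<Rightarrow> (real \<Rightarrow> 'w \<Rightarrow> real) \<Rightarrow> 'a \<Rightarrow> real \<Rightarrow> 'w \<Rightarrow> 'a" where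
  "subordinated W S x t \<omega> = x + W (S t \<omega>) \<omega>"

section \<open>The lacunary jump measure\<close>

definition jump_rate :: "nat \<Rightarrow> real" where
  "jump_rate m = 1 / 2 ^ m"

definition jump_size :: "nat \<Rightarrow> real" where
  "jump_size m = 2 ^ (m\<^sup>2)"

definition lacunary_measure :: "real measure" where
  "lacunary_measure =
    measure_of UNIV (sets borel)
      (\<lambda>B. \<Sum>m. ennreal (jump_rate m) * emeasure (return borel (jump_size m)) B)"

lemma sets_lacunary_measure [simp, measurable_cong]: "sets lacunary_measure = sets borel"
  unfolding lacunary_measure_def
  by (metis sets.sets_measure_of_eq space_borel)

lemma emeasure_lacunary_measure:
  assumes "B \<in> sets borel"
  shows "emeasure lacunary_measure B =
    (\<Sum>m. ennreal (jump_rate m) * emeasure (return borel (jump_size m)) B)"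
proof (rule emeasure_measure_of[OF lacunary_measure_def])
  let ?\<mu> = "\<lambda>B. \<Sum>m. ennreal (jump_rate m) * emeasure (return borel (jump_size m)) B"
  show "positive (sets lacunary_measure) ?\<mu>"
    by (simp add: positive_def)
  show "countably_additive (sets lacunary_measure) ?\<mu>"
  proof (rule countably_additiveI)
    fix F :: "nat \<Rightarrow> real set"
    assume F: "range F \<subseteq> sets lacunary_measure" "disjoint_family F"
    have "(\<Sum>i. ?\<mu> (F i)) =
        (\<integral>\<^sup>+m. (\<Sum>i. ennreal (jump_rate m) * emeasure (return borel (jump_size m)) (F i))
          \<partial>count_space UNIV)"
      by (subst nn_integral_suminf) (simp_all only: nn_integral_count_space_nat measurable_count_space_eq1 space_borel UNIV_I Pi_UNIV)
    also have "\<dots> = (\<Sum>m. ennreal (jump_rate m) * (\<Sum>i. emeasure (return borel (jump_size m)) (F i)))"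
      by (simp only: nn_integral_count_space_nat ennreal_suminf_cmult)
    also have "\<dots> = ?\<mu> (\<Union>i. F i)"
      using F by (subst suminf_emeasure) auto
    finally show "(\<Sum>i. ?\<mu> (F i)) = ?\<mu> (\<Union>i. F i)" .
  qed
qed (use assms in auto)

end

theory Submission
  imports Defs "HOL-Real_Asymp.Real_Asymp"
begin

text \<open>All jumps of the subordinator have the form \<open>A\<^sub>m = 2^(m^2)\<close>, and the total jump rate is
  \<open>2\<close>. Hence \<open>S\<close> is a compound Poisson process with integer values, and \<open>X\<close> is a random walk in
  continuous time whose steps are Gaussian with standard deviation \<open>a\<^sub>m = sqrt A\<^sub>m\<close>, chosen with
  probability \<open>2^(-m-1)\<close>. The Harnack inequality is contradicted by a single function, the Green
  function \<open>G\<close> of the unit ball: \<open>G(x)\<close> is the expected time that the process started at \<open>x\<close>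
  spends in the unit ball. It is harmonic off that ball.

  The contradiction. Take points \<open>y\<^sub>0, y\<^sub>1, \<dots>\<close> on a ray with \<open>norm y\<^sub>i = \<rho>^i a\<^sub>m\<close>. If
  \<open>\<rho> > 1\<close> is close enough to \<open>1\<close>, then \<open>y\<^sub>i\<close> and \<open>y\<^sub>i\<^sub>+\<^sub>1\<close> both lie in the inner
  part of a ball around \<open>y\<^sub>i\<close> that avoids the unit ball, so a Harnack constant \<open>C\<close> gives
  \<open>G(y\<^sub>0) \<le> C^i G(y\<^sub>i)\<close>: from \<open>a\<^sub>m\<close> outwards, \<open>G\<close> can only decay like a power of
  \<open>norm x / a\<^sub>m\<close>, with an exponent independent of \<open>m\<close>. But \<open>a\<^sub>m\<^sub>+\<^sub>1 / a\<^sub>m\<close> is at least \<open>2^m\<close>, and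
  until its first jump larger than \<open>A\<^sub>m\<close> the subordinator makes only a geometric number of jumps
  \<open>A\<^sub>m\<close>, all smaller ones being negligible. Up to that jump the walk can reach distance
  \<open>L a\<^sub>m\<close> only with a probability exponentially small in \<open>L\<close>, and after that jump it is spread over
  so large a volume that it contributes a fraction \<open>2^(-m)\<close>. Thus \<open>G\<close> is of order
  \<open>2^m a\<^sub>m^(-d)\<close> at distance \<open>a\<^sub>m\<close> (\<open>green_lower\<close>), and at distance \<open>L a\<^sub>m\<close> it is smaller by a
  factor of order \<open>exp (- L / 8) + 2^(-m)\<close> (\<open>green_upper\<close>). Letting first \<open>m\<close> and then \<open>i\<close> tend
  to infinity contradicts \<open>G(y\<^sub>0) \<le> C^i G(y\<^sub>i)\<close>.

  The estimates. Conditioning on \<open>S\<close> gives \<open>G(x) = \<Sum>n. u(n) P(x + W\<^sub>n \<in> B)\<close>, where \<open>B\<close> is the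
  unit ball and \<open>u(n)\<close> is the expected time that \<open>S\<close> spends at \<open>n\<close>. The sequence \<open>u\<close>
  solves a renewal equation, and all that is needed about it follows from summing this equation
  with weights \<open>1\<close> or \<open>exp (n / (16 A\<^sub>m))\<close> over \<open>n < A\<^sub>m\<^sub>+\<^sub>1\<close>
  (\<open>sum_renewal_le\<close>, \<open>exp_renewal_le\<close>, \<open>renewal_window\<close>).

  Harmonicity. The Laplace exponent determines the law of \<open>S\<^sub>t\<close>, so \<open>S\<^sub>t\<close> is almost surely an
  integer. A right-continuous monotone path that takes integer values at all dyadic times is locally
  constant to the right, so the process observed at the times \<open>k / 2^n\<close> leaves an open set \<open>E\<close> at
  the same place as \<open>X\<close> itself as soon as \<open>n\<close> is large (\<open>skel_exit_at_exit\<close>). For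
  the process observed on a grid, the mean value property of its own Green function is a rearrangement
  of sums based on the Markov property (\<open>dgreen_exit\<close>), and this discrete Green function agrees with
  \<open>G\<close> up to a factor that tends to \<open>1\<close> (\<open>dgreen_green\<close>). In the limit
  \<open>G(x)\<close> is the mean of \<open>G\<close> at the exit place (\<open>green_mean_value\<close>).\<close>

section \<open>The renewal sequence of the jump sizes\<close>

definition jump :: "nat \<Rightarrow> nat" where "jump m = 2 ^ (m\<^sup>2)"

definition step_pmf :: "nat pmf" where
  "step_pmf = map_pmf jump (geometric_pmf (1/2))"

primrec walk :: "nat \<Rightarrow> nat pmf" where
  "walk 0 = return_pmf 0"
| "walk (Suc N) = bind_pmf step_pmf (\<lambda>a. map_pmf ((+) a) (walk N))"

text \<open>The expected time that \<open>S\<close> spends at \<open>n\<close>: each of the states \<open>walk 0, walk 1, \<dots>\<close> visited by \<open>S\<close>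
  is held for a mean time \<open>1/2\<close>, and a walk with steps at least \<open>1\<close> is beyond \<open>n\<close> after more
  than \<open>n\<close> steps.\<close>

definition renewal :: "nat \<Rightarrow> real" where
  "renewal n = (\<Sum>N\<le>n. pmf (walk N) n) / 2"

lemma jump_pos [simp]: "jump m > 0" "jump m \<ge> 1" "jump m \<noteq> 0"
  by (auto simp: jump_def)

lemma jump_Suc: "jump (Suc m) = 2 ^ (2 * m + 1) * jump m"
  by (simp add: jump_def power2_eq_square power_add[symmetric] algebra_simps)

lemma strict_mono_jump: "strict_mono jump"
  by (rule strict_monoI) (simp add: jump_def power_strict_mono)

lemma jump_mono: "m \<le> k \<Longrightarrow> jump m \<le> jump k"
  using strict_mono_jump by (simp add: strict_mono_less_eq)

lemma jump_gt: "m < jump m"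
proof -
  have "m < 2 ^ m" by simp
  also have "\<dots> \<le> 2 ^ (m\<^sup>2)" by (intro power_increasing) (auto simp: power2_eq_square)
  finally show ?thesis by (simp add: jump_def)
qed

lemma set_walk: "n \<in> set_pmf (walk N) \<Longrightarrow> N \<le> n"
proof (induction N arbitrary: n)
  case (Suc N)
  then obtain m k where "n = jump m + k" "k \<in> set_pmf (walk N)"
    by (auto simp: step_pmf_def)
  with Suc.IH[of k] jump_pos(2)[of m] show ?case by linarith
qed simp

lemma pmf_walk_Suc:
  assumes "n < jump K"
  shows "pmf (walk (Suc N)) n =
    (\<Sum>m<K. (1/2) ^ Suc m * (if jump m \<le> n then pmf (walk N) (n - jump m) else 0))"
proof -
  have 1: "pmf (map_pmf ((+) a) (walk N)) n = (if a \<le> n then pmf (walk N) (n - a) else 0)" for a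
  proof (cases "a \<le> n")
    case True
    then have "pmf (map_pmf ((+) a) (walk N)) (a + (n - a)) = pmf (walk N) (n - a)"
      by (intro pmf_map_inj') (auto simp: inj_def)
    with True show ?thesis by simp
  next
    case False
    then show ?thesis by (auto simp: pmf_eq_0_set_pmf)
  qed
  have "pmf (walk (Suc N)) n =
      measure_pmf.expectation (geometric_pmf (1/2)) (\<lambda>m. if jump m \<le> n then pmf (walk N) (n - jump m) else 0)"
    by (simp add: pmf_bind 1 step_pmf_def)
  also have "\<dots> = (\<Sum>m<K. (if jump m \<le> n then pmf (walk N) (n - jump m) else 0) * pmf (geometric_pmf (1/2)) m)"
  proof (rule integral_measure_pmf_real)
    fix m assume "(if jump m \<le> n then pmf (walk N) (n - jump m) else 0) \<noteq> 0"
    then have "jump m < jump K" using assms by (auto split: if_splits)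
    then show "m \<in> {..<K}" using strict_mono_jump by (simp add: strict_mono_less)
  qed simp
  finally show ?thesis by (simp add: mult_ac)
qed

lemma renewal_nonneg [simp]: "0 \<le> renewal n"
  by (simp add: renewal_def sum_nonneg)

lemma renewal_eq:
  assumes "n \<le> L"
  shows "renewal n = (\<Sum>N\<le>L. pmf (walk N) n) / 2"
proof -
  have "(\<Sum>N\<le>L. pmf (walk N) n) = (\<Sum>N\<le>n. pmf (walk N) n)"
    using assms set_walk by (intro sum.mono_neutral_right) (force simp: pmf_eq_0_set_pmf)+
  then show ?thesis by (simp add: renewal_def)
qed

text \<open>Decomposition according to the first jump. For \<open>n < A\<^sub>K\<close> only the finitely many jump sizes
  below \<open>A\<^sub>K\<close> can occur, which keeps all sums finite.\<close>

lemma renewal_equation: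
  assumes "n < jump K"
  shows "2 * renewal n = (if n = 0 then 1 else 0) +
    (\<Sum>m<K. (1/2) ^ m * (if jump m \<le> n then renewal (n - jump m) else 0))"
proof -
  have "2 * renewal n = (\<Sum>N\<le>Suc n. pmf (walk N) n)"
    using renewal_eq[of n "Suc n"] by simp
  also have "\<dots> = pmf (walk 0) n + (\<Sum>N\<le>n. pmf (walk (Suc N)) n)"
    by (rule sum.atMost_Suc_shift)
  also have "(\<Sum>N\<le>n. pmf (walk (Suc N)) n) =
    (\<Sum>m<K. \<Sum>N\<le>n. (1/2) ^ Suc m * (if jump m \<le> n then pmf (walk N) (n - jump m) else 0))"
    using assms by (subst sum.swap) (simp only: pmf_walk_Suc)
  also have "\<dots> = (\<Sum>m<K. (1/2) ^ m * (if jump m \<le> n then renewal (n - jump m) else 0))"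
    by (intro sum.cong refl) (auto simp: renewal_eq[of _ n] sum_divide_distrib sum_distrib_left)
  finally show ?thesis by (simp add: indicator_def)
qed

text \<open>A power weight is multiplicative along a jump, so the weighted partial sums satisfy a closed
  relation. Every estimate on the renewal sequence is obtained from this identity.\<close>

lemma weighted_renewal_equation:
  fixes \<rho> :: real
  assumes "0 < B" "B \<le> jump K"
  shows "2 * (\<Sum>n<B. \<rho> ^ n * renewal n) =
    1 + (\<Sum>m<K. (1/2) ^ m * \<rho> ^ jump m * (\<Sum>n<B - jump m. \<rho> ^ n * renewal n))"
proof -
  have shift: "(\<Sum>n<B. if g \<le> n then \<rho> ^ n * renewal (n - g) else 0) =
      \<rho> ^ g * (\<Sum>n<B - g. \<rho> ^ n * renewal n)" for g
  proof -
    have "(\<Sum>n<B. if g \<le> n then \<rho> ^ n * renewal (n - g) else 0) =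
        (\<Sum>n\<in>{g..<B}. \<rho> ^ n * renewal (n - g))"
      by (intro sum.mono_neutral_cong_right) auto
    also have "\<dots> = (\<Sum>n<B - g. \<rho> ^ (n + g) * renewal n)"
      by (intro sum.reindex_bij_witness[of _ "\<lambda>n. n + g" "\<lambda>n. n - g"]) auto
    finally show ?thesis by (simp add: sum_distrib_left power_add mult_ac)
  qed
  have "2 * (\<Sum>n<B. \<rho> ^ n * renewal n) = (\<Sum>n<B. \<rho> ^ n * (2 * renewal n))"
    by (simp add: sum_distrib_left mult_ac)
  also have "\<dots> = (\<Sum>n<B. (if n = 0 then 1 else 0) +
      (\<Sum>m<K. (1/2) ^ m * (if jump m \<le> n then \<rho> ^ n * renewal (n - jump m) else 0)))"
  proof (intro sum.cong refl)
    fix n assume "n \<in> {..<B}"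
    then have "n < jump K" using assms by simp
    show "\<rho> ^ n * (2 * renewal n) = (if n = 0 then 1 else 0) +
      (\<Sum>m<K. (1/2) ^ m * (if jump m \<le> n then \<rho> ^ n * renewal (n - jump m) else 0))"
      unfolding renewal_equation[OF \<open>n < jump K\<close>]
      by (auto simp: sum_distrib_left distrib_left intro!: sum.cong)
  qed
  also have "\<dots> = 1 + (\<Sum>m<K. (1/2) ^ m * (\<Sum>n<B. if jump m \<le> n then \<rho> ^ n * renewal (n - jump m) else 0))"
    using assms(1) by (simp add: sum.distrib sum_distrib_left) (subst sum.swap, simp)
  finally show ?thesis by (simp add: shift mult_ac)
qed

lemma sum_half_powers: "(\<Sum>m<K. (1/2::real) ^ m) = 2 - 2 * (1/2) ^ K"
  by (induction K) auto

text \<open>Below \<open>A\<^sub>m\<^sub>+\<^sub>1\<close> the subordinator is killed by the jumps larger than \<open>A\<^sub>m\<close>, whose total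
  rate is \<open>2^(-m)\<close>; so it spends at most the time \<open>2^m\<close> there.\<close>

lemma sum_renewal_le:
  "(\<Sum>n<jump (Suc m). renewal n) \<le> 2 ^ m"
proof -
  define P where "P = (\<Sum>n<jump (Suc m). renewal n)"
  have "2 * P = 1 + (\<Sum>k<Suc m. (1/2) ^ k * (\<Sum>n<jump (Suc m) - jump k. renewal n))"
    using weighted_renewal_equation[of "jump (Suc m)" "Suc m" 1] by (simp add: P_def del: sum.lessThan_Suc)
  also have "\<dots> \<le> 1 + (\<Sum>k<Suc m. (1/2) ^ k * P)"
    unfolding P_def by (intro add_left_mono sum_mono mult_left_mono sum_mono2) auto
  also have "\<dots> = 1 + (2 - (1/2) ^ m) * P"
    by (simp add: sum_distrib_right[symmetric] sum_half_powers del: sum.lessThan_Suc)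
  finally have "(1/2) ^ m * P \<le> 1" by (simp add: algebra_simps)
  then show ?thesis by (simp add: P_def power_one_over field_simps)
qed

text \<open>The squares in the exponent of \<open>A\<^sub>k\<close> make the last term dominate: the drift produced by all
  jumps smaller than \<open>A\<^sub>m\<close> is comparable to that of the jumps \<open>A\<^sub>m\<close> alone.\<close>

lemma mean_small_jumps: "(\<Sum>k\<le>m. (1/2) ^ k * real (jump k)) \<le> 2 * (1/2) ^ m * real (jump m)"
proof (induction m)
  case (Suc m)
  show ?case
  proof (cases m)
    case 0
    then show ?thesis by (simp add: jump_def)
  next
    case (Suc j)
    have "4 \<le> (4::real) ^ m" using Suc by simp
    then have "2 * (1/2) ^ m * real (jump m) \<le> (1/2) ^ Suc m * (4 ^ m * 2 * real (jump m))"
      by (simp add: field_simps mult_right_mono)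
    also have "\<dots> = (1/2) ^ Suc m * real (jump (Suc m))"
      by (simp add: jump_Suc power_mult power_one_over field_simps) (simp add: power2_eq_square power_mult_distrib[symmetric])
    finally show ?thesis using Suc.IH by (simp only: sum.atMost_Suc)
  qed
qed (simp add: jump_def)

text \<open>The killing rate \<open>2^(-m)\<close> still dominates after an exponential tilt at scale \<open>A\<^sub>m\<close>, provided
  that the tilt is small: by \<open>mean_small_jumps\<close> the tilt \<open>1 / (16 A\<^sub>m)\<close> costs at most a quarter of
  the killing rate. Hence before a jump larger than \<open>A\<^sub>m\<close> the time spent beyond \<open>c A\<^sub>m\<close> is
  exponentially small in \<open>c\<close>.\<close>

lemma exp_renewal_le:
  "(\<Sum>n<jump (Suc m). exp (real n / (16 * jump m)) * renewal n) \<le> 2 ^ (Suc m)"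
proof -
  define t where "t = 1 / (16 * real (jump m))"
  define \<rho> where "\<rho> = exp t"
  have \<rho>: "\<rho> ^ n = exp (real n / (16 * jump m))" for n
    by (simp add: \<rho>_def t_def exp_of_nat_mult[symmetric])
  define Z where "Z = (\<Sum>n<jump (Suc m). \<rho> ^ n * renewal n)"
  have Z0: "Z \<ge> 0" unfolding Z_def \<rho> by (intro sum_nonneg) auto
  have "2 * Z = 1 + (\<Sum>k<Suc m. (1/2) ^ k * \<rho> ^ jump k * (\<Sum>n<jump (Suc m) - jump k. \<rho> ^ n * renewal n))"
    using weighted_renewal_equation[of "jump (Suc m)" "Suc m" \<rho>] by (simp add: Z_def del: sum.lessThan_Suc)
  also have "\<dots> \<le> 1 + (\<Sum>k<Suc m. (1/2) ^ k * (1 + 2 * (t * real (jump k))) * Z)"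
  proof (intro add_left_mono sum_mono mult_mono order_refl)
    fix k assume "k \<in> {..<Suc m}"
    then have "jump k \<le> jump m" by (intro jump_mono) auto
    then have "t * real (jump k) \<le> 1 / 2" by (simp add: t_def field_simps)
    moreover have "\<rho> ^ jump k = exp (t * real (jump k))"
      by (simp add: \<rho>_def exp_of_nat2_mult)
    ultimately show "\<rho> ^ jump k \<le> 1 + 2 * (t * real (jump k))"
      using real_exp_bound_lemma[of "t * real (jump k)"] by (simp add: t_def)
    show "(\<Sum>n<jump (Suc m) - jump k. \<rho> ^ n * renewal n) \<le> Z"
      unfolding Z_def by (intro sum_mono2) (auto simp: \<rho>_def)
  qed (auto intro!: sum_nonneg simp: \<rho>_def t_def)
  also have "\<dots> = 1 + ((\<Sum>k<Suc m. (1/2) ^ k) + 2 * t * (\<Sum>k\<le>m. (1/2) ^ k * real (jump k))) * Z"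
    unfolding lessThan_Suc_atMost
    by (simp add: sum_distrib_left sum_distrib_right sum.distrib[symmetric] algebra_simps)
  also have "\<dots> \<le> 1 + ((\<Sum>k<Suc m. (1/2) ^ k) + 2 * t * (2 * (1/2) ^ m * real (jump m))) * Z"
    using Z0 by (intro add_left_mono mult_right_mono mult_left_mono mean_small_jumps) (auto simp: t_def)
  also have "\<dots> = 1 + (2 - 3/4 * (1/2) ^ m) * Z"
    unfolding sum_half_powers by (simp add: t_def)
  finally have "3/4 * (1/2) ^ m * Z \<le> 1" by (simp add: algebra_simps)
  then have "3 * Z \<le> 4 * 2 ^ m" by (simp add: power_one_over field_simps)
  moreover have "(0::real) \<le> 2 ^ m" by simp
  ultimately have "Z \<le> 2 ^ Suc m" unfolding power_Suc by linarith
  then show ?thesis by (simp add: Z_def \<rho>)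
qed

lemma renewal_tail_le:
  fixes c :: real
  assumes "J \<subseteq> {..<jump (Suc m)}" "\<And>n. n \<in> J \<Longrightarrow> c * jump m \<le> real n"
  shows "sum renewal J \<le> 2 ^ Suc m * exp (- (c / 16))"
proof -
  have fin: "finite J" using assms(1) finite_subset by blast
  have "exp (c / 16) * sum renewal J = (\<Sum>n\<in>J. exp (c / 16) * renewal n)"
    by (simp add: sum_distrib_left)
  also have "\<dots> \<le> (\<Sum>n\<in>J. exp (real n / (16 * jump m)) * renewal n)"
    using assms(2) by (intro sum_mono mult_right_mono) (auto simp: field_simps)
  also have "\<dots> \<le> (\<Sum>n<jump (Suc m). exp (real n / (16 * jump m)) * renewal n)"
    using assms(1) by (intro sum_mono2) auto
  also have "\<dots> \<le> 2 ^ Suc m" by (rule exp_renewal_le)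
  finally show ?thesis by (simp add: exp_minus field_simps)
qed

text \<open>The bound of \<open>sum_renewal_le\<close> is nearly attained. In the renewal equation a truncated
  sum over \<open>n < A\<^sub>m\<^sub>+\<^sub>1 - A\<^sub>k\<close> differs from the full one only by mass located near
  \<open>A\<^sub>m\<^sub>+\<^sub>1\<close>, many multiples of \<open>A\<^sub>m\<close> away from the origin, where the exponential tail
  bound applies.\<close>

lemma sum_renewal_ge:
  assumes small: "2 ^ (m + 2) * exp (- ((2 ^ (2 * m + 1) - 1) / 16)) \<le> (1/4::real)"
  shows "(\<Sum>n<jump (Suc m). renewal n) \<ge> 3/4 * 2 ^ m"
proof -
  define P where "P = (\<Sum>n<jump (Suc m). renewal n)"
  define R where "R = (\<Sum>n\<in>{jump (Suc m) - jump m..<jump (Suc m)}. renewal n)"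
  have P0: "P \<ge> 0" and R0: "R \<ge> 0" by (auto simp: P_def R_def intro!: sum_nonneg)
  have gle: "jump m \<le> jump (Suc m)" by (intro jump_mono) auto
  have "real (jump (Suc m) - jump m) = (2 ^ (2 * m + 1) - 1) * real (jump m)"
    using gle by (simp add: of_nat_diff jump_Suc algebra_simps)
  then have R: "R \<le> 2 ^ Suc m * exp (- ((2 ^ (2 * m + 1) - 1) / 16))"
    unfolding R_def
    by (intro renewal_tail_le) (auto simp: subset_eq dest!: of_nat_mono[where 'a=real])
  with small have R: "2 * R \<le> 1/4" by simp
  have "2 * P = 1 + (\<Sum>k<Suc m. (1/2) ^ k * (\<Sum>n<jump (Suc m) - jump k. renewal n))"
    using weighted_renewal_equation[of "jump (Suc m)" "Suc m" 1] by (simp add: P_def del: sum.lessThan_Suc)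
  moreover have "\<dots> \<ge> 1 + (\<Sum>k<Suc m. (1/2) ^ k * (P - R))"
  proof (intro add_left_mono sum_mono mult_left_mono)
    fix k assume "k \<in> {..<Suc m}"
    then have "jump k \<le> jump m" by (intro jump_mono) auto
    have "P = (\<Sum>n<jump (Suc m) - jump m. renewal n) + R"
      unfolding P_def R_def
      by (subst sum.union_disjoint[symmetric]) (auto intro!: sum.cong)
    also have "(\<Sum>n<jump (Suc m) - jump m. renewal n) \<le> (\<Sum>n<jump (Suc m) - jump k. renewal n)"
      using \<open>jump k \<le> jump m\<close> by (intro sum_mono2) auto
    finally show "P - R \<le> (\<Sum>n<jump (Suc m) - jump k. renewal n)" by simp
  qed auto
  moreover have "(\<Sum>k<Suc m. (1/2) ^ k * (P - R)) = (2 - (1/2) ^ m) * (P - R)"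
    by (simp add: sum_distrib_right[symmetric] sum_half_powers del: sum.lessThan_Suc)
  ultimately have "2 * P \<ge> 1 + (2 - (1/2) ^ m) * (P - R)" by linarith
  then have "(1/2) ^ m * P \<ge> 1 - 2 * R + (1/2)^m * R" by (simp add: algebra_simps)
  moreover have "(1/2) ^ m * R \<ge> 0" using R0 by simp
  ultimately have "(1/2) ^ m * P \<ge> 3/4" using R by linarith
  then show ?thesis by (simp add: P_def power_one_over field_simps)
qed

text \<open>A fixed proportion of the time \<open>2^m\<close> is spent at values of order \<open>A\<^sub>m\<close>: below \<open>A\<^sub>m\<close> there is
  at most half of it, and the time beyond \<open>48 A\<^sub>m\<close> is controlled by the tail bound.\<close>

lemma renewal_window:
  assumes m: "m \<ge> 1" and small: "2 ^ (m + 2) * exp (- ((2 ^ (2 * m + 1) - 1) / 16)) \<le> (1/4::real)"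
  shows "sum renewal {n. jump m \<le> n \<and> n < jump (Suc m) \<and> n < 48 * jump m} \<ge> 2 ^ m / 16"
proof -
  let ?J = "{n. jump m \<le> n \<and> n < jump (Suc m) \<and> n < 48 * jump m}"
  let ?K = "{n. n < jump (Suc m) \<and> 48 * jump m \<le> n}"
  obtain j where j: "m = Suc j" using m by (cases m) auto
  have fin: "finite ?J" "finite ?K" by (auto intro: finite_subset[of _ "{..<jump (Suc m)}"])
  have "3/4 * 2 ^ m \<le> (\<Sum>n<jump (Suc m). renewal n)"
    by (rule sum_renewal_ge[OF small])
  also have "{..<jump (Suc m)} \<subseteq> {..<jump m} \<union> ?J \<union> ?K" by auto
  then have "(\<Sum>n<jump (Suc m). renewal n) \<le> sum renewal ({..<jump m} \<union> ?J \<union> ?K)"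
    using fin by (intro sum_mono2) auto
  also have "\<dots> = sum renewal {..<jump m} + sum renewal ?J + sum renewal ?K"
    using fin jump_pos(1)[of m] by (subst sum.union_disjoint sum.union_disjoint; auto)+
  also have "sum renewal {..<jump m} \<le> 2 ^ m / 2"
    using sum_renewal_le[of j] by (simp add: j)
  also have "sum renewal ?K \<le> 2 ^ Suc m * exp (- (48 / 16))"
    by (rule renewal_tail_le) (auto dest!: of_nat_mono[where 'a=real])
  \<comment> \<open>the constant 48 is chosen such that the tail is at most \<open>2^m / 8\<close>\<close>
  also have "exp (- (48 / 16) :: real) \<le> 1/16"
  proof -
    have "1 + 1/2 + (1/2)\<^sup>2 / 2 \<le> exp (1/2 :: real)"
      by (rule exp_lower_Taylor_quadratic) simp
    then have "(13/8) ^ 6 \<le> exp (1/2 :: real) ^ 6"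
      by (intro power_mono) (auto simp: power2_eq_square)
    also have "\<dots> = exp 3" by (simp add: exp_of_nat_mult[symmetric])
    finally have "(13/8) ^ 6 \<le> exp (3::real)" .
    moreover have "16 \<le> (13/8 :: real) ^ 6" by (simp add: power_divide)
    ultimately have "16 \<le> exp (3::real)" by linarith
    then show ?thesis by (simp add: exp_minus field_simps)
  qed
  finally have "2 ^ m / 8 \<le> sum renewal ?J" by simp
  moreover have "(0::real) \<le> 2 ^ m" by simp
  ultimately show ?thesis by linarith
qed

lemma eventually_window_small:
  "eventually (\<lambda>m. 2 ^ (m + 2) * exp (- ((2 ^ (2 * m + 1) - 1) / 16)) \<le> (1/4::real)) sequentially"
  by real_asymp

section \<open>Gaussian kernels and the Green function of the unit ball\<close>

text \<open>The law of the increment of a Brownian motion over a time interval of length \<open>n\<close>. Only integer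
  lengths are needed because the subordinator takes integer values.\<close>

definition gauss :: "nat \<Rightarrow> 'a::euclidean_space measure" where
  "gauss n = (if n = 0 then return borel 0
     else density lborel (\<lambda>y. ennreal (\<Prod>b\<in>Basis. normal_density 0 (sqrt n) (y \<bullet> b))))"

lemma sets_gauss [simp, measurable_cong]: "sets (gauss n) = sets borel"
  by (simp add: gauss_def)

lemma space_gauss [simp]: "space (gauss n) = UNIV"
  by (simp add: gauss_def)

text \<open>The probability that \<open>x + W\<^sub>n\<close> lies in the unit ball.\<close>

definition heat :: "nat \<Rightarrow> 'a::euclidean_space \<Rightarrow> ennreal" where
  "heat n x = emeasure (gauss n) (ball (- x) 1)"

text \<open>The expected occupation time of the unit ball for the process started at \<open>x\<close>.\<close>

definition green :: "'a::euclidean_space \<Rightarrow> ennreal" where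
  "green x = (\<Sum>n. ennreal (renewal n) * heat n x)"

lemma prod_normal_density:
  fixes y :: "'a::euclidean_space"
  assumes "n > 0"
  shows "(\<Prod>b\<in>Basis. normal_density 0 (sqrt (real n)) (y \<bullet> b)) =
    (1 / sqrt (2 * pi * n)) ^ DIM('a) * exp (- (norm y)\<^sup>2 / (2 * n))"
proof -
  have "(\<Prod>b\<in>Basis. normal_density 0 (sqrt (real n)) (y \<bullet> b)) =
      (\<Prod>b\<in>(Basis::'a set). 1 / sqrt (2 * pi * n)) * (\<Prod>b\<in>Basis. exp (- ((y \<bullet> b)\<^sup>2 / (2 * n))))"
    using assms by (simp only: prod.distrib[symmetric]) (simp add: normal_density_def)
  also have "(\<Prod>b\<in>Basis. exp (- ((y \<bullet> b)\<^sup>2 / (2 * n)))) = exp (- (\<Sum>b\<in>Basis. (y \<bullet> b)\<^sup>2) / (2 * n))"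
    by (simp add: exp_sum[symmetric] sum_negf sum_divide_distrib)
  also have "(\<Sum>b\<in>Basis. (y \<bullet> b)\<^sup>2) = (norm y)\<^sup>2"
    unfolding power2_norm_eq_inner by (subst euclidean_inner) (simp add: power2_eq_square)
  finally show ?thesis by simp
qed

lemma heat_0: "heat 0 (x::'a::euclidean_space) = indicator (ball 0 1) x"
  by (auto simp: heat_def gauss_def indicator_def dist_norm)

lemma heat_le:
  fixes x :: "'a::euclidean_space"
  assumes "n > 0"
  shows "heat n x \<le> ennreal (unit_ball_vol DIM('a) * (1 / sqrt n) ^ DIM('a))"
    and "2 \<le> norm x \<Longrightarrow> heat n x \<le> ennreal (unit_ball_vol DIM('a) * (1 / sqrt n) ^ DIM('a) *
        exp (- ((norm x)\<^sup>2 / (8 * n))))"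
proof -
  have le: "heat n x \<le> ennreal (unit_ball_vol DIM('a) * (1 / sqrt n) ^ DIM('a) * exp (- (r\<^sup>2 / (2 * n))))"
    if r: "0 \<le> r" "\<And>y. y \<in> ball (- x) 1 \<Longrightarrow> r \<le> norm y" for r
  proof -
    have "heat n x = (\<integral>\<^sup>+y. ennreal (\<Prod>b\<in>Basis. normal_density 0 (sqrt n) (y \<bullet> b)) * indicator (ball (- x) 1) y \<partial>lborel)"
      using assms by (simp add: heat_def gauss_def emeasure_density)
    also have "\<dots> \<le> (\<integral>\<^sup>+y. ennreal ((1 / sqrt n) ^ DIM('a) * exp (- (r\<^sup>2 / (2 * n)))) * indicator (ball (- x) 1) y \<partial>lborel)"
    proof (rule nn_integral_mono)
      fix y :: 'a
      have "(1 / sqrt (2 * pi * n)) ^ DIM('a) * exp (- (norm y)\<^sup>2 / (2 * n)) \<le>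
          (1 / sqrt n) ^ DIM('a) * exp (- (r\<^sup>2 / (2 * n)))" if "y \<in> ball (- x) 1"
      proof (intro mult_mono power_mono)
        have "1 * real n \<le> (2 * pi) * real n" using pi_gt3 by (intro mult_right_mono) auto
        then have "real n \<le> 2 * pi * real n" by simp
        then show "1 / sqrt (2 * pi * n) \<le> 1 / sqrt n"
          using assms by (intro divide_left_mono) auto
        have "r\<^sup>2 \<le> (norm y)\<^sup>2" using r(2)[OF that] r(1) by (intro power_mono) auto
        then show "exp (- (norm y)\<^sup>2 / (2 * n)) \<le> exp (- (r\<^sup>2 / (2 * n)))"
          using assms by (simp add: divide_right_mono)
      qed auto
      then show "ennreal (\<Prod>b\<in>Basis. normal_density 0 (sqrt n) (y \<bullet> b)) * indicator (ball (- x) 1) y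
          \<le> ennreal ((1 / sqrt n) ^ DIM('a) * exp (- (r\<^sup>2 / (2 * n)))) * indicator (ball (- x) 1) y"
        using assms by (auto simp: prod_normal_density indicator_def intro!: ennreal_leI)
    qed
    also have "\<dots> = ennreal ((1 / sqrt n) ^ DIM('a) * exp (- (r\<^sup>2 / (2 * n)))) * emeasure lborel (ball (- x) 1)"
      by (subst nn_integral_cmult_indicator) auto
    also have "\<dots> = ennreal (unit_ball_vol DIM('a) * (1 / sqrt n) ^ DIM('a) * exp (- (r\<^sup>2 / (2 * n))))"
      by (simp add: emeasure_ball ennreal_mult[symmetric] mult_ac)
    finally show ?thesis .
  qed
  show "heat n x \<le> ennreal (unit_ball_vol DIM('a) * (1 / sqrt n) ^ DIM('a))"
    using le[of 0] by simp
  assume x: "2 \<le> norm x"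
  have "norm x / 2 \<le> norm y" if "y \<in> ball (- x) 1" for y
  proof -
    have "norm (x + y) < 1" using that by (simp add: dist_norm norm_minus_commute add.commute)
    then show ?thesis using x norm_triangle_sub[of x "- y"] by simp
  qed
  from le[of "norm x / 2", OF _ this] x
  show "heat n x \<le> ennreal (unit_ball_vol DIM('a) * (1 / sqrt n) ^ DIM('a) *
        exp (- ((norm x)\<^sup>2 / (8 * n))))"
    by (simp add: power_divide)
qed

lemma heat_ge:
  fixes x :: "'a::euclidean_space"
  assumes "n > 0" "1 \<le> norm x"
  shows "heat n x \<ge> ennreal (unit_ball_vol DIM('a) * (1 / sqrt (2 * pi * n)) ^ DIM('a) *
        exp (- (2 * (norm x)\<^sup>2 / n)))"
proof -
  have "ennreal (unit_ball_vol DIM('a) * (1 / sqrt (2 * pi * n)) ^ DIM('a) * exp (- (2 * (norm x)\<^sup>2 / n))) =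
      ennreal ((1 / sqrt (2 * pi * n)) ^ DIM('a) * exp (- (2 * (norm x)\<^sup>2 / n))) * emeasure lborel (ball (- x) 1)"
    by (simp add: emeasure_ball ennreal_mult[symmetric] mult_ac)
  also have "\<dots> = (\<integral>\<^sup>+y. ennreal ((1 / sqrt (2 * pi * n)) ^ DIM('a) * exp (- (2 * (norm x)\<^sup>2 / n))) *
      indicator (ball (- x) 1) y \<partial>lborel)"
    by (subst nn_integral_cmult_indicator) auto
  also have "\<dots> \<le> (\<integral>\<^sup>+y. ennreal (\<Prod>b\<in>Basis. normal_density 0 (sqrt n) (y \<bullet> b)) * indicator (ball (- x) 1) y \<partial>lborel)"
  proof (rule nn_integral_mono)
    fix y :: 'a
    have "(1 / sqrt (2 * pi * n)) ^ DIM('a) * exp (- (2 * (norm x)\<^sup>2 / n)) \<le>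
        (1 / sqrt (2 * pi * n)) ^ DIM('a) * exp (- (norm y)\<^sup>2 / (2 * n))" if "y \<in> ball (- x) 1"
    proof (intro mult_left_mono)
      have "norm (x + y) < 1" using that by (simp add: dist_norm norm_minus_commute add.commute)
      then have "norm y \<le> 2 * norm x"
        using assms norm_triangle_sub[of y "- x"] by (simp add: add.commute)
      then have "(norm y)\<^sup>2 \<le> (2 * norm x)\<^sup>2" by (intro power_mono) auto
      then show "exp (- (2 * (norm x)\<^sup>2 / n)) \<le> exp (- (norm y)\<^sup>2 / (2 * n))"
        using assms by (simp add: power_mult_distrib field_simps)
    qed auto
    then show "ennreal ((1 / sqrt (2 * pi * n)) ^ DIM('a) * exp (- (2 * (norm x)\<^sup>2 / n))) * indicator (ball (- x) 1) y
        \<le> ennreal (\<Prod>b\<in>Basis. normal_density 0 (sqrt n) (y \<bullet> b)) * indicator (ball (- x) 1) y"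
      using assms by (auto simp: prod_normal_density indicator_def intro!: ennreal_leI)
  qed
  also have "\<dots> = heat n x"
    using assms by (simp add: heat_def gauss_def emeasure_density)
  finally show ?thesis .
qed

lemma power_le_fact_exp:
  fixes z :: real
  assumes "z \<ge> 0"
  shows "z ^ d \<le> fact d * exp z"
proof -
  have "(\<Sum>k\<in>{d}. z ^ k / fact k) \<le> (\<Sum>k. z ^ k / fact k)"
    using assms summable_exp[of z] by (intro sum_le_suminf) (auto simp: field_simps)
  then show ?thesis using assms by (simp add: exp_def field_simps scaleR_conv_of_real)
qed

text \<open>With \<open>z^2 = A\<^sub>m / n\<close> the left-hand side is the Gaussian density with variance \<open>n\<close> at
  distance \<open>L a\<^sub>m\<close>, relative to \<open>a\<^sub>m^(-d)\<close>. One half of the Gaussian exponent absorbs the singular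
  factor \<open>z^d\<close>; the other half is traded, by the inequality of arithmetic and geometric means, for a
  decay in \<open>L\<close> and the exponential weight \<open>exp (n / (16 A\<^sub>m))\<close> of \<open>exp_renewal_le\<close>.\<close>

lemma gaussian_vs_exponential:
  fixes z :: real
  assumes "z > 0" "L \<ge> 1"
  shows "z ^ d * exp (- (L\<^sup>2 * z\<^sup>2 / 8)) \<le> fact d * exp 4 * exp (- (L / 8)) * exp (1 / (16 * z\<^sup>2))"
proof -
  have "z ^ d * exp (- (L\<^sup>2 * z\<^sup>2 / 8)) \<le> (fact d * exp z) * exp (- (L\<^sup>2 * z\<^sup>2 / 8))"
    using assms by (intro mult_right_mono power_le_fact_exp) auto
  also have "\<dots> = fact d * exp (z - L\<^sup>2 * z\<^sup>2 / 8)"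
    by (simp only: mult.assoc exp_add[symmetric]) simp
  also have "z - L\<^sup>2 * z\<^sup>2 / 8 \<le> 4 - L / 8 + 1 / (16 * z\<^sup>2)"
  proof -
    have "1\<^sup>2 \<le> L\<^sup>2" using assms by (intro power_mono) auto
    then have "1 * z\<^sup>2 \<le> L\<^sup>2 * z\<^sup>2" by (intro mult_right_mono) auto
    moreover have "0 \<le> (z / 4 - 2)\<^sup>2" by simp
    ultimately have "z - L\<^sup>2 * z\<^sup>2 / 16 \<le> 4"
      by (simp add: power2_diff power_divide)
    moreover have "0 \<le> (L * z / 4 - 1 / (4 * z))\<^sup>2" by simp
    then have "0 \<le> L\<^sup>2 * z\<^sup>2 / 16 - L / 8 + 1 / (16 * z\<^sup>2)"
      using assms by (simp add: power2_diff power_divide power_mult_distrib)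
    ultimately show ?thesis by linarith
  qed
  then have "fact d * exp (z - L\<^sup>2 * z\<^sup>2 / 8) \<le> fact d * exp (4 - L / 8 + 1 / (16 * z\<^sup>2))"
    by simp
  also have "\<dots> = fact d * exp 4 * exp (- (L / 8)) * exp (1 / (16 * z\<^sup>2))"
    by (simp only: exp_add[symmetric] mult.assoc) simp
  finally show ?thesis .
qed

lemma inverse_sqrt_jump_Suc: "1 / sqrt (jump (Suc j)) \<le> (1/2) ^ j * (1 / sqrt (jump j))"
proof -
  have "(2::real) ^ j = sqrt ((2 ^ j)\<^sup>2)" by simp
  also have "\<dots> \<le> sqrt (2 ^ (2 * j + 1))"
    by (subst real_sqrt_le_iff) (simp add: power_mult[symmetric] mult.commute)
  finally have "2 ^ j * sqrt (jump j) \<le> sqrt (jump (Suc j))"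
    by (simp add: jump_Suc real_sqrt_mult mult_right_mono del: power_Suc)
  then show ?thesis by (simp add: field_simps power_one_over)
qed

text \<open>Over the block \<open>A\<^sub>i \<le> n < A\<^sub>i\<^sub>+\<^sub>1\<close> the sum is at most \<open>2^i a\<^sub>i^(-d)\<close>. These numbers at least
  halve from \<open>i = 2\<close> on, in every dimension, so the first block dominates.\<close>

lemma renewal_heat_tail:
  assumes "2 \<le> j" "d > 0"
  shows "(\<Sum>n\<in>{jump j..<jump J}. renewal n * (1 / sqrt n) ^ d) \<le> 2 * 2 ^ j * (1 / sqrt (jump j)) ^ d"
proof -
  define b where "b i = 2 ^ i * (1 / sqrt (real (jump i))) ^ d" for i
  have b0: "b i \<ge> 0" for i by (simp add: b_def)
  have b_Suc: "2 * b (Suc i) \<le> b i" if "j \<le> i" for i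
  proof -
    have "(1 / sqrt (jump (Suc i))) ^ d \<le> ((1/2) ^ i * (1 / sqrt (jump i))) ^ d"
      by (intro power_mono inverse_sqrt_jump_Suc) auto
    also have "\<dots> = ((1/2) ^ i) ^ d * (1 / sqrt (jump i)) ^ d"
      by (rule power_mult_distrib)
    also have "((1/2::real) ^ i) ^ d \<le> (1/2) ^ 2"
      unfolding power_mult[symmetric] using that assms
      by (intro power_decreasing) (auto intro: order_trans[of _ "i * 1"])
    finally have "(1 / sqrt (jump (Suc i))) ^ d \<le> 1/4 * (1 / sqrt (jump i)) ^ d"
      by (simp add: mult_right_mono power2_eq_square)
    then have "4 * 2 ^ i * (1 / sqrt (jump (Suc i))) ^ d \<le> 2 ^ i * (1 / sqrt (jump i)) ^ d"
      by simp
    then show ?thesis by (simp add: b_def)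
  qed
  have block: "(\<Sum>n\<in>{jump i..<jump (Suc i)}. renewal n * (1 / sqrt n) ^ d) \<le> b i" for i
  proof -
    have "(\<Sum>n\<in>{jump i..<jump (Suc i)}. renewal n * (1 / sqrt n) ^ d) \<le>
        (\<Sum>n\<in>{jump i..<jump (Suc i)}. renewal n * (1 / sqrt (jump i)) ^ d)"
    proof (intro sum_mono mult_left_mono power_mono divide_left_mono)
      fix n assume "n \<in> {jump i..<jump (Suc i)}"
      moreover from this have "n > 0" using jump_pos(1)[of i] by (simp del: jump_pos)
      ultimately show "sqrt (jump i) \<le> sqrt n" "0 < sqrt n * sqrt (jump i)" by auto
    qed auto
    also have "\<dots> = (\<Sum>n\<in>{jump i..<jump (Suc i)}. renewal n) * (1 / sqrt (jump i)) ^ d"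
      by (simp add: sum_distrib_right)
    also have "\<dots> \<le> (\<Sum>n<jump (Suc i). renewal n) * (1 / sqrt (jump i)) ^ d"
      by (intro mult_right_mono sum_mono2) auto
    also have "\<dots> \<le> b i"
      unfolding b_def by (intro mult_right_mono sum_renewal_le) auto
    finally show ?thesis .
  qed
  \<comment> \<open>the subtracted term makes the claim inductive\<close>
  have "(\<Sum>n\<in>{jump j..<jump J}. renewal n * (1 / sqrt n) ^ d) \<le> 2 * b j - 2 * b J" if "j \<le> J"
    using that
  proof (induction rule: dec_induct)
    case (step i)
    have "{jump j..<jump (Suc i)} = {jump j..<jump i} \<union> {jump i..<jump (Suc i)}"
      using jump_mono[of j i] jump_mono[of i "Suc i"] step by auto
    then have "(\<Sum>n\<in>{jump j..<jump (Suc i)}. renewal n * (1 / sqrt n) ^ d) =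
        (\<Sum>n\<in>{jump j..<jump i}. renewal n * (1 / sqrt n) ^ d) +
        (\<Sum>n\<in>{jump i..<jump (Suc i)}. renewal n * (1 / sqrt n) ^ d)"
      by (simp add: sum.union_disjoint)
    then show ?case using step.IH block[of i] b_Suc[of i] step(1) by linarith
  qed simp
  moreover have "(\<Sum>n\<in>{jump j..<jump J}. renewal n * (1 / sqrt n) ^ d) = 0" if "\<not> j \<le> J"
    using that jump_mono[of J j] by simp
  ultimately have "(\<Sum>n\<in>{jump j..<jump J}. renewal n * (1 / sqrt n) ^ d) \<le> 2 * b j"
    using b0[of j] b0[of J] by fastforce
  then show ?thesis by (simp add: b_def)
qed

lemma green_le_split:
  fixes x :: "'a::euclidean_space"
  assumes j: "2 \<le> j" and head: "(\<Sum>n<jump j. ennreal (renewal n) * heat n x) \<le> ennreal H" and "H \<ge> 0"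
  shows "green x \<le> ennreal (H + unit_ball_vol DIM('a) * (2 * 2 ^ j * (1 / sqrt (jump j)) ^ DIM('a)))"
  unfolding green_def suminf_eq_SUP
proof (rule SUP_least)
  fix N :: nat
  let ?F = "\<lambda>n. ennreal (renewal n) * heat n x"
  define J where "J = N + j"
  have "N \<le> jump J" using jump_gt[of J] by (simp add: J_def)
  have jJ: "jump j \<le> jump J" by (intro jump_mono) (simp add: J_def)
  have "sum ?F {..<N} \<le> sum ?F {..<jump J}"
    using \<open>N \<le> jump J\<close> by (intro sum_mono2) auto
  also have "{..<jump J} = {..<jump j} \<union> {jump j..<jump J}" using jJ by auto
  also have "sum ?F \<dots> = sum ?F {..<jump j} + sum ?F {jump j..<jump J}"
    by (subst sum.union_disjoint) auto
  also have "sum ?F {jump j..<jump J} \<le>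
      (\<Sum>n\<in>{jump j..<jump J}. ennreal (unit_ball_vol DIM('a) * (renewal n * (1 / sqrt n) ^ DIM('a))))"
  proof (rule sum_mono)
    fix n assume "n \<in> {jump j..<jump J}"
    then have "n > 0" using jump_pos(1)[of j] by (simp del: jump_pos)
    then have "?F n \<le> ennreal (renewal n) * ennreal (unit_ball_vol DIM('a) * (1 / sqrt n) ^ DIM('a))"
      by (intro mult_left_mono heat_le) auto
    also have "\<dots> = ennreal (unit_ball_vol DIM('a) * (renewal n * (1 / sqrt n) ^ DIM('a)))"
      by (simp add: ennreal_mult[symmetric] mult_ac)
    finally show "?F n \<le> \<dots>" .
  qed
  also have "\<dots> = ennreal (unit_ball_vol DIM('a) * (\<Sum>n\<in>{jump j..<jump J}. renewal n * (1 / sqrt n) ^ DIM('a)))"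
    by (subst sum_ennreal) (auto simp: sum_distrib_left)
  also have "\<dots> \<le> ennreal (unit_ball_vol DIM('a) * (2 * 2 ^ j * (1 / sqrt (jump j)) ^ DIM('a)))"
    using j by (intro ennreal_leI mult_left_mono renewal_heat_tail) auto
  finally show "sum ?F {..<N} \<le> ennreal (H + unit_ball_vol DIM('a) * (2 * 2 ^ j * (1 / sqrt (jump j)) ^ DIM('a)))"
    using head \<open>H \<ge> 0\<close> by (subst ennreal_plus) (auto intro: order_trans add_mono)
qed

lemma green_bounded:
  obtains K where "K \<ge> 0" "\<And>x :: 'a::euclidean_space. green x \<le> ennreal K"
proof -
  let ?v = "unit_ball_vol DIM('a)"
  have heat: "heat n x \<le> ennreal (1 + ?v)" for n and x :: 'a
  proof (cases "n = 0")
    case False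
    then have "heat n x \<le> ennreal (?v * (1 / sqrt n) ^ DIM('a))" by (intro heat_le) auto
    also have "\<dots> \<le> ennreal (1 + ?v)"
    proof (intro ennreal_leI)
      have "(1 / sqrt n) ^ DIM('a) \<le> 1" using False by (intro power_le_one) auto
      then have "?v * (1 / sqrt n) ^ DIM('a) \<le> ?v * 1" by (intro mult_left_mono) auto
      then show "?v * (1 / sqrt n) ^ DIM('a) \<le> 1 + ?v" by linarith
    qed
    finally show ?thesis .
  qed (auto simp: heat_0 indicator_def ennreal_1[symmetric] simp del: ennreal_1 intro!: ennreal_leI)
  define H where "H = (\<Sum>n<jump 2. renewal n) * (1 + ?v)"
  have H0: "H \<ge> 0" by (auto simp: H_def intro!: mult_nonneg_nonneg sum_nonneg)
  show thesis
  proof (rule that)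
    fix x :: 'a
    have "(\<Sum>n<jump 2. ennreal (renewal n) * heat n x) \<le> (\<Sum>n<jump 2. ennreal (renewal n) * ennreal (1 + ?v))"
      by (intro sum_mono mult_left_mono heat) auto
    also have "\<dots> = ennreal H"
      by (simp add: H_def sum_distrib_right[symmetric] ennreal_mult sum_nonneg)
    finally show "green x \<le> ennreal (H + ?v * (2 * 2 ^ 2 * (1 / sqrt (jump 2)) ^ DIM('a)))"
      using H0 by (intro green_le_split) auto
  qed (use H0 in auto)
qed

text \<open>Values \<open>n < A\<^sub>m\<^sub>+\<^sub>1\<close> contribute the exponentially small term, by \<open>gaussian_vs_exponential\<close>
  and \<open>exp_renewal_le\<close>; larger values contribute the constant \<open>4\<close>, since
  \<open>a\<^sub>m\<^sub>+\<^sub>1^(-d) \<le> 2^(-m) a\<^sub>m^(-d)\<close>.\<close>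

lemma green_upper:
  fixes x :: "'a::euclidean_space"
  assumes m: "1 \<le> m" and L: "1 \<le> L" and x: "norm x = L * sqrt (jump m)" "2 \<le> norm x"
  shows "green x \<le> ennreal (unit_ball_vol DIM('a) * (1 / sqrt (jump m)) ^ DIM('a) *
    (fact DIM('a) * exp 4 * exp (- (L / 8)) * 2 ^ Suc m + 4))"
proof -
  let ?v = "unit_ball_vol DIM('a)" and ?a = "(1 / sqrt (jump m)) ^ DIM('a)"
  define C where "C = fact DIM('a) * exp 4 * exp (- (L / 8))"
  define H where "H = ?v * ?a * (C * 2 ^ Suc m)"
  have term_le: "ennreal (renewal n) * heat n x \<le>
      ennreal (?v * ?a * C * (exp (real n / (16 * jump m)) * renewal n))" for n
  proof (cases "n = 0")
    case True
    then show ?thesis using x by (simp add: heat_0 indicator_def)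
  next
    case False
    define z where "z = sqrt (jump m / n)"
    have z: "z > 0" "z\<^sup>2 = jump m / n" using False by (auto simp: z_def)
    have "(1 / sqrt n) ^ DIM('a) = ?a * z ^ DIM('a)"
      using False by (simp add: z_def power_mult_distrib[symmetric] real_sqrt_divide)
    moreover have "(norm x)\<^sup>2 / (8 * n) = L\<^sup>2 * z\<^sup>2 / 8"
      unfolding z by (simp add: x power_mult_distrib)
    ultimately have "(1 / sqrt n) ^ DIM('a) * exp (- ((norm x)\<^sup>2 / (8 * n))) =
        ?a * (z ^ DIM('a) * exp (- (L\<^sup>2 * z\<^sup>2 / 8)))"
      by simp
    also have "\<dots> \<le> ?a * (C * exp (1 / (16 * z\<^sup>2)))"
      unfolding C_def using z L by (intro mult_left_mono gaussian_vs_exponential) auto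
    also have "1 / (16 * z\<^sup>2) = real n / (16 * jump m)"
      unfolding z using False by simp
    finally have *: "(1 / sqrt n) ^ DIM('a) * exp (- ((norm x)\<^sup>2 / (8 * n))) \<le>
        ?a * (C * exp (real n / (16 * jump m)))" .
    have "ennreal (renewal n) * heat n x \<le> ennreal (renewal n) *
        ennreal (?v * (1 / sqrt n) ^ DIM('a) * exp (- ((norm x)\<^sup>2 / (8 * n))))"
      using False x by (intro mult_left_mono heat_le) auto
    also have "\<dots> = ennreal (renewal n * ?v * ((1 / sqrt n) ^ DIM('a) * exp (- ((norm x)\<^sup>2 / (8 * n)))))"
      by (simp add: ennreal_mult[symmetric] mult_ac)
    also have "\<dots> \<le> ennreal (renewal n * ?v * (?a * (C * exp (real n / (16 * jump m)))))"
      using * by (intro ennreal_leI mult_left_mono) auto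
    finally show ?thesis by (simp add: mult_ac)
  qed
  have C0: "C \<ge> 0" by (simp add: C_def)
  have "(\<Sum>n<jump (Suc m). ennreal (renewal n) * heat n x) \<le>
      (\<Sum>n<jump (Suc m). ennreal (?v * ?a * C * (exp (real n / (16 * jump m)) * renewal n)))"
    by (intro sum_mono term_le)
  also have "\<dots> = ennreal (?v * ?a * C * (\<Sum>n<jump (Suc m). exp (real n / (16 * jump m)) * renewal n))"
    using C0 by (subst sum_ennreal) (auto simp: sum_distrib_left)
  also have "\<dots> \<le> ennreal (?v * ?a * C * 2 ^ Suc m)"
    using C0 by (intro ennreal_leI mult_left_mono exp_renewal_le) auto
  finally have "(\<Sum>n<jump (Suc m). ennreal (renewal n) * heat n x) \<le> ennreal H"
    by (simp add: H_def mult_ac)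
  then have "green x \<le> ennreal (H + ?v * (2 * 2 ^ Suc m * (1 / sqrt (jump (Suc m))) ^ DIM('a)))"
    using m C0 by (intro green_le_split) (auto simp: H_def)
  also have "\<dots> \<le> ennreal (H + ?v * (2 * 2 ^ Suc m * ((1/2) ^ m * ?a)))"
  proof (intro ennreal_leI add_left_mono mult_left_mono)
    have "(1 / sqrt (jump (Suc m))) ^ DIM('a) \<le> ((1/2) ^ m * (1 / sqrt (jump m))) ^ DIM('a)"
      by (intro power_mono inverse_sqrt_jump_Suc) auto
    also have "\<dots> = ((1/2) ^ m) ^ DIM('a) * ?a" by (simp only: power_mult_distrib)
    also have "\<dots> \<le> ((1/2) ^ m) ^ 1 * ?a"
      by (intro mult_right_mono power_decreasing) (auto intro: power_le_one simp: Suc_leI)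
    finally show "(1 / sqrt (jump (Suc m))) ^ DIM('a) \<le> (1/2) ^ m * ?a" by simp
  qed auto
  also have "H + ?v * (2 * 2 ^ Suc m * ((1/2) ^ m * ?a)) = ?v * ?a * (C * 2 ^ Suc m + 4)"
    by (simp add: H_def algebra_simps power_one_over)
  finally show ?thesis by (simp add: C_def)
qed

text \<open>If \<open>n\<close> is of order \<open>A\<^sub>m\<close>, then the Gaussian with variance \<open>n\<close> has density of order
  \<open>a\<^sub>m^(-d)\<close> at distance \<open>a\<^sub>m\<close>, and by \<open>renewal_window\<close> such \<open>n\<close> carry a mass of order \<open>2^m\<close>.\<close>

lemma green_lower:
  fixes x :: "'a::euclidean_space"
  assumes m: "m \<ge> 1" and small: "2 ^ (m + 2) * exp (- ((2 ^ (2 * m + 1) - 1) / 16)) \<le> (1/4::real)"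
    and x: "norm x = sqrt (jump m)"
  shows "green x \<ge> ennreal (unit_ball_vol DIM('a) * (1 / sqrt (jump m)) ^ DIM('a) *
    ((1 / sqrt (96 * pi)) ^ DIM('a) * exp (- 2) / 16 * 2 ^ m))"
proof -
  let ?v = "unit_ball_vol DIM('a)" and ?a = "(1 / sqrt (jump m)) ^ DIM('a)"
  let ?J = "{n. jump m \<le> n \<and> n < jump (Suc m) \<and> n < 48 * jump m}"
  define c where "c = ?v * ?a * ((1 / sqrt (96 * pi)) ^ DIM('a) * exp (- 2))"
  have c0: "c \<ge> 0" by (simp add: c_def)
  have fin: "finite ?J" by (rule finite_subset[of _ "{..<jump (Suc m)}"]) auto
  have h: "ennreal c \<le> heat n x" if "n \<in> ?J" for n
  proof -
    have n: "n > 0" "jump m \<le> n" "n \<le> 48 * jump m" using that jump_pos(1)[of m] by (auto intro: less_le_trans)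
    have "c = ?v * ((1 / sqrt (jump m)) * (1 / sqrt (96 * pi))) ^ DIM('a) * exp (- 2)"
      by (simp only: c_def power_mult_distrib mult_ac)
    also have "\<dots> \<le> ?v * (1 / sqrt (2 * pi * n)) ^ DIM('a) * exp (- (2 * (norm x)\<^sup>2 / n))"
    proof (intro mult_mono mult_left_mono power_mono)
      have "2 * pi * real n \<le> real (jump m) * (96 * pi)" using n(3) by (simp flip: of_nat_mult)
      then have "sqrt (2 * pi * n) \<le> sqrt (jump m) * sqrt (96 * pi)"
        by (simp only: real_sqrt_mult[symmetric] real_sqrt_le_iff)
      then show "1 / sqrt (jump m) * (1 / sqrt (96 * pi)) \<le> 1 / sqrt (2 * pi * n)"
        using n(1) by (simp add: divide_simps)
      show "exp (- 2) \<le> exp (- (2 * (norm x)\<^sup>2 / n))"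
        using n x by (simp add: field_simps)
    qed auto
    finally have "ennreal c \<le> ennreal (?v * (1 / sqrt (2 * pi * n)) ^ DIM('a) * exp (- (2 * (norm x)\<^sup>2 / n)))"
      by (rule ennreal_leI)
    also have "\<dots> \<le> heat n x"
      using n(1) x jump_pos(2)[of m] by (intro heat_ge) auto
    finally show ?thesis .
  qed
  have "ennreal (c * (2 ^ m / 16)) \<le> ennreal (c * sum renewal ?J)"
    using c0 by (intro ennreal_leI mult_left_mono renewal_window m small) auto
  also have "\<dots> = (\<Sum>n\<in>?J. ennreal (renewal n) * ennreal c)"
    using c0 by (simp add: ennreal_mult[symmetric] sum_ennreal sum_distrib_left mult_ac)
  also have "\<dots> \<le> (\<Sum>n\<in>?J. ennreal (renewal n) * heat n x)"
    using h by (intro sum_mono mult_left_mono) auto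
  also have "\<dots> \<le> green x"
    unfolding green_def using fin by (intro sum_le_suminf) auto
  finally show ?thesis by (simp add: c_def mult_ac)
qed

section \<open>The Green function on a time grid\<close>

lemma ennreal_suminf_swap: "(\<Sum>i. \<Sum>j. f i j) = (\<Sum>j. \<Sum>i. f i j :: ennreal)"
proof -
  have "(\<Sum>i. \<Sum>j. f i j) = (\<integral>\<^sup>+i. (\<Sum>j. f i j) \<partial>count_space UNIV)"
    by (simp add: nn_integral_count_space_nat)
  also have "\<dots> = (\<Sum>j. \<integral>\<^sup>+i. f i j \<partial>count_space UNIV)"
    by (rule nn_integral_suminf) simp
  finally show ?thesis by (simp add: nn_integral_count_space_nat)
qed

text \<open>The integral of \<open>x^N exp (- x) / N!\<close> over the half-line is \<open>1\<close>. In the Riemann sum with mesh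
  \<open>\<epsilon>\<close> the power is monotone and the exponential varies by a factor of at most \<open>exp \<epsilon>\<close> on each
  cell, so the sum is \<open>1\<close> up to such a factor, uniformly in \<open>N\<close>.\<close>

lemma poisson_riemann_sum:
  fixes \<epsilon> :: real and N :: nat
  assumes eps: "\<epsilon> > 0"
  defines "R \<equiv> (\<Sum>l. ennreal (\<epsilon> * ((real l * \<epsilon>) ^ N / fact N * exp (- (real l * \<epsilon>)))))"
  shows "R \<le> ennreal (exp \<epsilon>)" and "1 \<le> ennreal (exp \<epsilon>) * R"
proof -
  define g where "g x = x ^ N / fact N * exp (- x)" for x :: real
  define B where "B l = {real l * \<epsilon>..<real (Suc l) * \<epsilon>}" for l
  have R: "R = (\<Sum>l. ennreal (\<epsilon> * g (real l * \<epsilon>)))"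
    by (simp add: R_def g_def)
  have g0: "g x \<ge> 0" if "x \<ge> 0" for x using that by (simp add: g_def)
  have g_le: "g x \<le> exp (y - x) * g y" if "0 \<le> x" "x \<le> y" for x y
  proof -
    have "g x \<le> y ^ N / fact N * exp (- x)"
      using that by (auto simp: g_def intro!: mult_right_mono divide_right_mono power_mono)
    also have "exp (- x) = exp (y - x) * exp (- y)" by (simp add: exp_add[symmetric])
    finally have "g x \<le> y ^ N / fact N * (exp (y - x) * exp (- y))" .
    also have "\<dots> = exp (y - x) * g y" by (simp add: g_def)
    finally show ?thesis .
  qed
  have disj: "disjoint_family B"
    unfolding disjoint_family_on_def
  proof (intro ballI impI)
    fix i j :: nat assume "i \<noteq> j"
    then have "Suc i \<le> j \<or> Suc j \<le> i" by linarith
    then have "real (Suc i) \<le> real j \<or> real (Suc j) \<le> real i" by (simp only: of_nat_le_iff)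
    then have "real (Suc i) * \<epsilon> \<le> real j * \<epsilon> \<or> real (Suc j) * \<epsilon> \<le> real i * \<epsilon>"
      using eps by (simp only: mult_le_cancel_right_pos)
    then show "B i \<inter> B j = {}" by (auto simp: B_def)
  qed
  have Un: "(\<Union>l. B l) = {0..}"
  proof (intro equalityI subsetI)
    fix x :: real assume "x \<in> {0..}"
    define l where "l = nat \<lfloor>x / \<epsilon>\<rfloor>"
    have "real l \<le> x / \<epsilon>" "x / \<epsilon> < real (Suc l)"
      using \<open>x \<in> {0..}\<close> eps real_of_int_floor_add_one_gt[of "x / \<epsilon>"]
      unfolding l_def by (auto simp: of_nat_nat add.commute)
    then have "x \<in> B l" using eps by (simp add: B_def pos_le_divide_eq pos_divide_less_eq)
    then show "x \<in> (\<Union>l. B l)" by blast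
  next
    fix x assume "x \<in> (\<Union>l. B l)"
    then obtain l where "real l * \<epsilon> \<le> x" by (auto simp: B_def)
    moreover have "0 \<le> real l * \<epsilon>" using eps by simp
    ultimately show "x \<in> {0..}" by simp
  qed
  have "1 = ennreal (1 / fact N) * ennreal (real_of_nat (fact N))"
    by (simp add: ennreal_mult[symmetric])
  also have "\<dots> = (\<integral>\<^sup>+x. ennreal (1 / fact N) * (ennreal (x ^ N * exp (- x)) * indicator {0..} x) \<partial>lborel)"
    by (subst nn_integral_cmult) (auto simp: nn_intergal_power_times_exp_Ici)
  also have "\<dots> = (\<integral>\<^sup>+x\<in>(\<Union>l. B l). ennreal (g x) \<partial>lborel)"
    unfolding Un by (intro nn_integral_cong) (auto simp: g_def indicator_def ennreal_mult'[symmetric])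
  also have "\<dots> = (\<Sum>l. \<integral>\<^sup>+x\<in>B l. ennreal (g x) \<partial>lborel)"
    by (intro nn_integral_disjoint_family disj) (auto simp: B_def g_def)
  finally have one: "(\<Sum>l. \<integral>\<^sup>+x\<in>B l. ennreal (g x) \<partial>lborel) = 1" by simp
  have cst: "(\<integral>\<^sup>+x\<in>B l. ennreal c \<partial>lborel) = ennreal (\<epsilon> * c)" if "c \<ge> 0" for l c
    using eps that by (subst nn_integral_cmult_indicator)
      (auto simp: B_def algebra_simps ennreal_mult[symmetric])
  have "R \<le> (\<Sum>l. ennreal (exp \<epsilon>) * (\<integral>\<^sup>+x\<in>B l. ennreal (g x) \<partial>lborel))"
    unfolding R
  proof (intro suminf_le allI)
    fix l
    have "ennreal (\<epsilon> * g (real l * \<epsilon>)) = (\<integral>\<^sup>+x\<in>B l. ennreal (g (real l * \<epsilon>)) \<partial>lborel)"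
      using eps by (subst cst) (auto intro!: g0)
    also have "\<dots> \<le> (\<integral>\<^sup>+x. ennreal (exp \<epsilon>) * (ennreal (g x) * indicator (B l) x) \<partial>lborel)"
    proof (rule nn_integral_mono)
      fix x
      show "ennreal (g (real l * \<epsilon>)) * indicator (B l) x \<le> ennreal (exp \<epsilon>) * (ennreal (g x) * indicator (B l) x)"
      proof (cases "x \<in> B l")
        case True
        then have x: "real l * \<epsilon> \<le> x" "x - real l * \<epsilon> \<le> \<epsilon>" by (auto simp: B_def algebra_simps)
        have l0: "0 \<le> real l * \<epsilon>" using eps by simp
        have "g (real l * \<epsilon>) \<le> exp (x - real l * \<epsilon>) * g x" by (rule g_le[OF l0 x(1)])
        also have "\<dots> \<le> exp \<epsilon> * g x"
          using x l0 g0[OF order_trans[OF l0 x(1)]] by (intro mult_right_mono) auto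
        finally show ?thesis using True by (simp add: ennreal_mult'[symmetric] ennreal_leI)
      qed simp
    qed
    also have "\<dots> = ennreal (exp \<epsilon>) * (\<integral>\<^sup>+x\<in>B l. ennreal (g x) \<partial>lborel)"
      by (intro nn_integral_cmult) (auto simp: B_def g_def)
    finally show "ennreal (\<epsilon> * g (real l * \<epsilon>)) \<le> \<dots>" .
  qed auto
  also have "\<dots> = ennreal (exp \<epsilon>)" by (simp add: one)
  finally show "R \<le> ennreal (exp \<epsilon>)" .
  have "1 = (\<Sum>l. \<integral>\<^sup>+x\<in>B l. ennreal (g x) \<partial>lborel)" by (simp add: one)
  also have "\<dots> \<le> (\<Sum>l. ennreal (exp \<epsilon>) * ennreal (\<epsilon> * g (real (Suc l) * \<epsilon>)))"
  proof (intro suminf_le allI)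
    fix l
    have s0: "0 \<le> real (Suc l) * \<epsilon>" using eps by simp
    have "(\<integral>\<^sup>+x\<in>B l. ennreal (g x) \<partial>lborel) \<le> (\<integral>\<^sup>+x\<in>B l. ennreal (exp \<epsilon> * g (real (Suc l) * \<epsilon>)) \<partial>lborel)"
    proof (rule nn_integral_mono)
      fix x
      show "ennreal (g x) * indicator (B l) x \<le> ennreal (exp \<epsilon> * g (real (Suc l) * \<epsilon>)) * indicator (B l) x"
      proof (cases "x \<in> B l")
        case True
        then have x: "real l * \<epsilon> \<le> x" "x \<le> real (Suc l) * \<epsilon>" "real (Suc l) * \<epsilon> - x \<le> \<epsilon>"
          by (auto simp: B_def algebra_simps)
        have "0 \<le> real l * \<epsilon>" using eps by simp
        then have "0 \<le> x" using x(1) by (rule order_trans)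
        then have "g x \<le> exp (real (Suc l) * \<epsilon> - x) * g (real (Suc l) * \<epsilon>)" using x by (intro g_le) auto
        also have "\<dots> \<le> exp \<epsilon> * g (real (Suc l) * \<epsilon>)"
          using x(3) by (intro mult_right_mono g0 s0) (simp only: exp_le_cancel_iff)
        finally show ?thesis using True by (simp add: ennreal_leI)
      qed simp
    qed
    also have "\<dots> = ennreal (\<epsilon> * (exp \<epsilon> * g (real (Suc l) * \<epsilon>)))"
      using g0[OF s0] by (intro cst) auto
    also have "\<dots> = ennreal (exp \<epsilon>) * ennreal (\<epsilon> * g (real (Suc l) * \<epsilon>))"
      by (simp only: ennreal_mult'[symmetric] exp_ge_zero mult.left_commute)
    finally show "(\<integral>\<^sup>+x\<in>B l. ennreal (g x) \<partial>lborel) \<le> \<dots>" .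
  qed auto
  also have "\<dots> = ennreal (exp \<epsilon>) * (\<Sum>l. ennreal (\<epsilon> * g (real (Suc l) * \<epsilon>)))"
    by (rule ennreal_suminf_cmult)
  also have "\<dots> \<le> ennreal (exp \<epsilon>) * R"
  proof (rule mult_left_mono)
    have "R = (\<Sum>l. ennreal (\<epsilon> * g (real (l + 1) * \<epsilon>))) + (\<Sum>l<1. ennreal (\<epsilon> * g (real l * \<epsilon>)))"
      unfolding R by (rule suminf_offset) simp
    then have "R = (\<Sum>l. ennreal (\<epsilon> * g (real (Suc l) * \<epsilon>))) + ennreal (\<epsilon> * g 0)"
      by (simp only: Suc_eq_plus1) simp
    then show "(\<Sum>l. ennreal (\<epsilon> * g (real (Suc l) * \<epsilon>))) \<le> R" by (rule ssubst) (rule add_increasing2, simp_all)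
  qed simp
  finally show "1 \<le> ennreal (exp \<epsilon>) * R" .
qed

text \<open>The law of \<open>S\<^sub>t\<close>. The case \<open>t = 0\<close> is the degenerate Poisson distribution with parameter \<open>0\<close>,
  for which no step of the walk is made.\<close>

definition compound_poisson :: "real \<Rightarrow> nat pmf" where
  "compound_poisson t = (if t = 0 then return_pmf 0 else bind_pmf (poisson_pmf (2 * t)) walk)"

lemma nn_integral_compound_poisson:
  assumes "t \<ge> 0"
  shows "(\<integral>\<^sup>+n. f n \<partial>compound_poisson t) =
    (\<Sum>N. ennreal ((2 * t) ^ N / fact N * exp (- (2 * t))) * (\<integral>\<^sup>+n. f n \<partial>walk N))"
proof (cases "t = 0")
  case True
  have "(\<Sum>N. ennreal ((2 * t) ^ N / fact N * exp (- (2 * t))) * (\<integral>\<^sup>+n. f n \<partial>walk N)) =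
     (\<Sum>N\<in>{0}. ennreal ((2 * t) ^ N / fact N * exp (- (2 * t))) * (\<integral>\<^sup>+n. f n \<partial>walk N))"
    using True by (intro suminf_finite) auto
  then show ?thesis using True by (simp add: compound_poisson_def)
next
  case False
  have "(\<integral>\<^sup>+n. f n \<partial>compound_poisson t) = (\<integral>\<^sup>+N. (\<integral>\<^sup>+n. f n \<partial>walk N) \<partial>poisson_pmf (2 * t))"
    using False by (simp add: compound_poisson_def)
  also have "\<dots> = (\<Sum>N. ennreal (pmf (poisson_pmf (2 * t)) N) * (\<integral>\<^sup>+n. f n \<partial>walk N))"
    by (simp only: nn_integral_measure_pmf[of "poisson_pmf (2 * t)"] nn_integral_count_space_nat)
  finally show ?thesis using False assms by simp
qed

text \<open>The Green function of the unit ball for the process observed at the times \<open>0, \<delta>, 2 \<delta>, \<dots>\<close>,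
  where every visit counts \<open>\<delta>\<close>.\<close>

definition dgreen :: "real \<Rightarrow> 'a::euclidean_space \<Rightarrow> ennreal" where
  "dgreen \<delta> x = (\<Sum>l. ennreal \<delta> * (\<integral>\<^sup>+n. heat n x \<partial>compound_poisson (real l * \<delta>)))"

lemma green_eq_walks: "green x = (\<Sum>N. ennreal (1/2) * (\<integral>\<^sup>+n. heat n x \<partial>walk N))"
proof -
  have "ennreal (renewal n) = (\<Sum>N. ennreal (1/2) * ennreal (pmf (walk N) n))" for n
  proof -
    have "(\<Sum>N. ennreal (1/2) * ennreal (pmf (walk N) n)) = (\<Sum>N\<le>n. ennreal (1/2) * ennreal (pmf (walk N) n))"
      using set_walk by (intro suminf_finite) (auto simp: pmf_eq_0_set_pmf)
    also have "\<dots> = ennreal (renewal n)"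
      by (simp add: ennreal_mult[symmetric] renewal_def sum_divide_distrib del: ennreal_half)
    finally show ?thesis by simp
  qed
  then have "green x = (\<Sum>n. \<Sum>N. ennreal (1/2) * ennreal (pmf (walk N) n) * heat n x)"
    by (simp add: green_def ennreal_suminf_multc)
  also have "\<dots> = (\<Sum>N. \<Sum>n. ennreal (1/2) * ennreal (pmf (walk N) n) * heat n x)"
    by (rule ennreal_suminf_swap)
  also have "\<dots> = (\<Sum>N. ennreal (1/2) * (\<integral>\<^sup>+n. heat n x \<partial>walk N))"
    by (simp add: nn_integral_measure_pmf nn_integral_count_space_nat mult.assoc ennreal_suminf_cmult del: ennreal_half)
  finally show ?thesis .
qed

lemma dgreen_eq_walks:
  assumes "\<delta> > 0"
  shows "dgreen \<delta> x = (\<Sum>N. (\<Sum>l. ennreal (2 * \<delta> * ((real l * (2 * \<delta>)) ^ N / fact N *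
      exp (- (real l * (2 * \<delta>)))))) * (ennreal (1/2) * (\<integral>\<^sup>+n. heat n x \<partial>walk N)))"
proof -
  have "dgreen \<delta> x = (\<Sum>l. \<Sum>N. ennreal \<delta> * (ennreal ((2 * (real l * \<delta>)) ^ N / fact N *
      exp (- (2 * (real l * \<delta>)))) * (\<integral>\<^sup>+n. heat n x \<partial>walk N)))"
    using assms by (simp add: dgreen_def nn_integral_compound_poisson ennreal_suminf_cmult)
  also have "\<dots> = (\<Sum>l. \<Sum>N. ennreal (2 * \<delta> * ((real l * (2 * \<delta>)) ^ N / fact N *
      exp (- (real l * (2 * \<delta>))))) * (ennreal (1/2) * (\<integral>\<^sup>+n. heat n x \<partial>walk N)))"
  proof -
    have "ennreal \<delta> * (ennreal ((2 * (real l * \<delta>)) ^ N / fact N * exp (- (2 * (real l * \<delta>)))) * w) =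
      ennreal (2 * \<delta> * ((real l * (2 * \<delta>)) ^ N / fact N * exp (- (real l * (2 * \<delta>))))) * (ennreal (1/2) * w)"
      for l N w
    proof -
      define c where "c = real l * (2 * \<delta>)"
      define p where "p = c ^ N / fact N * exp (- c)"
      have c: "2 * (real l * \<delta>) = c" by (simp add: c_def)
      have "p \<ge> 0" using assms by (simp add: p_def c_def)
      then have "ennreal \<delta> * ennreal p = ennreal (2 * \<delta> * p) * ennreal (1/2)"
        using assms by (subst (1 2) ennreal_mult[symmetric]) auto
      then show ?thesis
        unfolding c c_def[symmetric] p_def[symmetric] by (simp only: mult.assoc[symmetric])
    qed
    then show ?thesis by (simp only:)
  qed
  also have "\<dots> = (\<Sum>N. \<Sum>l. ennreal (2 * \<delta> * ((real l * (2 * \<delta>)) ^ N / fact N *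
      exp (- (real l * (2 * \<delta>))))) * (ennreal (1/2) * (\<integral>\<^sup>+n. heat n x \<partial>walk N)))"
    by (rule ennreal_suminf_swap)
  finally show ?thesis by (simp add: ennreal_suminf_multc del: ennreal_half)
qed

text \<open>Both Green functions are averages of the same walk probabilities: the weight of the \<open>N\<close>-th step
  is half the integral, respectively half the Riemann sum, of a Poisson probability.\<close>

lemma dgreen_green:
  assumes "\<delta> > 0"
  shows "dgreen \<delta> x \<le> ennreal (exp (2 * \<delta>)) * green x"
    and "green x \<le> ennreal (exp (2 * \<delta>)) * dgreen \<delta> x"
proof -
  have e: "2 * \<delta> > 0" using assms by simp
  show "dgreen \<delta> x \<le> ennreal (exp (2 * \<delta>)) * green x"
    unfolding dgreen_eq_walks[OF assms] green_eq_walks ennreal_suminf_cmult[symmetric]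
    by (intro suminf_le mult_right_mono poisson_riemann_sum(1)[OF e]) auto
  show "green x \<le> ennreal (exp (2 * \<delta>)) * dgreen \<delta> x"
    unfolding dgreen_eq_walks[OF assms] green_eq_walks ennreal_suminf_cmult[symmetric]
  proof (intro suminf_le allI)
    fix N
    let ?w = "ennreal (1/2) * (\<integral>\<^sup>+n. heat n x \<partial>walk N)"
    have "1 * ?w \<le> (ennreal (exp (2 * \<delta>)) * (\<Sum>l. ennreal (2 * \<delta> * ((real l * (2 * \<delta>)) ^ N / fact N *
      exp (- (real l * (2 * \<delta>))))))) * ?w"
      by (intro mult_right_mono poisson_riemann_sum(2)[OF e]) auto
    then show "?w \<le> ennreal (exp (2 * \<delta>)) * ((\<Sum>l. ennreal (2 * \<delta> * ((real l * (2 * \<delta>)) ^ N / fact N *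
      exp (- (real l * (2 * \<delta>)))))) * ?w)" by (simp add: mult.assoc)
  qed auto
qed

section \<open>The law of the subordinator\<close>

text \<open>The generating function of one step of the walk.\<close>

definition step_gf :: "real \<Rightarrow> real" where
  "step_gf z = (\<Sum>m. (1/2) ^ Suc m * z ^ jump m)"

lemma summable_step_gf:
  assumes "0 \<le> z" "z \<le> 1"
  shows "summable (\<lambda>m. (1/2::real) ^ Suc m * z ^ jump m)"
proof (rule summable_comparison_test')
  show "summable (\<lambda>m. (1/2::real) ^ Suc m)" by (simp add: summable_geometric)
  show "norm ((1/2::real) ^ Suc m * z ^ jump m) \<le> (1/2) ^ Suc m" for m
    using assms by (simp add: power_le_one)
qed

lemma step_gf_nonneg: "0 \<le> z \<Longrightarrow> z \<le> 1 \<Longrightarrow> 0 \<le> step_gf z"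
  unfolding step_gf_def by (intro suminf_nonneg summable_step_gf) auto

lemma nn_integral_walk_power:
  assumes "0 \<le> z" "z \<le> 1"
  shows "(\<integral>\<^sup>+n. ennreal (z ^ n) \<partial>walk N) = ennreal (step_gf z ^ N)"
proof (induction N)
  case (Suc N)
  have "(\<integral>\<^sup>+n. ennreal (z ^ n) \<partial>walk (Suc N)) = (\<integral>\<^sup>+a. ennreal (z ^ a) * ennreal (step_gf z ^ N) \<partial>step_pmf)"
    using assms by (simp add: power_add ennreal_mult nn_integral_cmult Suc)
  also have "\<dots> = (\<integral>\<^sup>+a. ennreal (z ^ a) \<partial>step_pmf) * ennreal (step_gf z ^ N)"
    by (rule nn_integral_multc) simp
  also have "(\<integral>\<^sup>+a. ennreal (z ^ a) \<partial>step_pmf) = (\<integral>\<^sup>+m. ennreal (z ^ jump m) \<partial>geometric_pmf (1/2))"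
    by (simp add: step_pmf_def)
  also have "\<dots> = (\<Sum>m. ennreal ((1/2) ^ Suc m * z ^ jump m))"
    using assms by (simp add: nn_integral_measure_pmf nn_integral_count_space_nat ennreal_mult[symmetric] mult_ac)
  also have "\<dots> = ennreal (step_gf z)"
    unfolding step_gf_def using assms by (intro suminf_ennreal2 summable_step_gf) auto
  finally show ?case using step_gf_nonneg[OF assms] by (simp add: ennreal_mult)
qed simp

lemma expectation_compound_poisson_power:
  assumes "0 \<le> z" "z \<le> 1" "t \<ge> 0"
  shows "measure_pmf.expectation (compound_poisson t) (\<lambda>n. z ^ n) = exp (- t * (2 * (1 - step_gf z)))"
proof -
  let ?g = "step_gf z"
  have g0: "0 \<le> ?g" by (rule step_gf_nonneg[OF assms(1,2)])
  have "(\<integral>\<^sup>+n. ennreal (z ^ n) \<partial>compound_poisson t) =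
      (\<Sum>N. ennreal (exp (- (2 * t)) * ((2 * t * ?g) ^ N / fact N)))"
    using assms g0 by (simp add: nn_integral_compound_poisson nn_integral_walk_power ennreal_mult[symmetric] power_mult_distrib mult_ac)
  also have "\<dots> = ennreal (\<Sum>N. exp (- (2 * t)) * ((2 * t * ?g) ^ N / fact N))"
    using assms g0 summable_exp[of "2 * t * ?g"]
    by (intro suminf_ennreal2 summable_mult) (auto simp: field_simps)
  also have "(\<Sum>N. exp (- (2 * t)) * ((2 * t * ?g) ^ N / fact N)) = exp (- (2 * t)) * exp (2 * t * ?g)"
    using summable_exp[of "2 * t * ?g"]
    by (subst suminf_mult) (auto simp: exp_def field_simps scaleR_conv_of_real)
  also have "\<dots> = exp (- t * (2 * (1 - ?g)))" by (simp add: exp_add[symmetric] algebra_simps)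
  finally show ?thesis using assms
    by (intro integral_eq_nn_integral[THEN trans]) (auto)
qed

lemma lacunary_measure_distr:
  "lacunary_measure = distr (density (count_space UNIV) (\<lambda>m. ennreal (jump_rate m))) borel jump_size"
proof (rule measure_eqI)
  fix B assume "B \<in> sets lacunary_measure"
  then show "emeasure lacunary_measure B =
      emeasure (distr (density (count_space UNIV) (\<lambda>m. ennreal (jump_rate m))) borel jump_size) B"
    by (simp add: emeasure_lacunary_measure emeasure_distr emeasure_density nn_integral_count_space_nat
        indicator_def vimage_def)
qed simp

lemma laplace_exponent_lacunary:
  assumes "q \<ge> 0"
  shows "laplace_exponent 0 lacunary_measure q = 2 * (1 - step_gf (exp (- q)))"
proof -
  let ?z = "exp (- q)"
  have z: "0 \<le> ?z" "?z \<le> 1" using assms by auto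
  have js: "exp (- q * jump_size m) = ?z ^ jump m" "0 < jump_size m" for m
    by (auto simp: jump_size_def jump_def exp_of_nat_mult[symmetric] mult.commute)
  note sg = summable_step_gf[OF z]
  have sh: "(\<lambda>m. (1/2::real) ^ m) sums 2" using geometric_sums[of "1/2::real"] by simp
  have s2: "(\<lambda>m. (1/2) ^ m * ?z ^ jump m) sums (2 * step_gf ?z)"
    using sums_mult[OF summable_sums[OF sg], of 2] by (simp add: step_gf_def mult.assoc[symmetric])
  have sums: "(\<lambda>m. jump_rate m * (1 - exp (- q * jump_size m))) sums (2 - 2 * step_gf ?z)"
    using sums_diff[OF sh s2] unfolding js(1) by (simp add: jump_rate_def power_one_over algebra_simps)
  have "jump_rate m * (1 - exp (- q * jump_size m)) \<ge> 0" for m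
    using assms js(2)[of m] by (auto simp: jump_rate_def)
  with sums have sm: "summable (\<lambda>m. norm (jump_rate m * (1 - exp (- q * jump_size m))))"
    by (simp add: sums_iff del: abs_mult)
  have eq: "(\<Sum>m. jump_rate m * (1 - exp (- q * jump_size m))) = 2 - 2 * step_gf ?z"
    using sums by (rule sums_unique[symmetric])
  have "(LINT x:{0<..}|lacunary_measure. (1 - exp (- q * x))) =
      (\<integral>m. indicator {0<..} (jump_size m) *\<^sub>R (1 - exp (- q * jump_size m))
        \<partial>density (count_space UNIV) (\<lambda>m. ennreal (jump_rate m)))"
    unfolding set_lebesgue_integral_def lacunary_measure_distr by (subst integral_distr) auto
  also have "\<dots> = (\<integral>m. jump_rate m * (1 - exp (- q * jump_size m)) \<partial>count_space UNIV)"
    using js(2) by (subst integral_density) (auto simp: jump_rate_def)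
  also have "\<dots> = (\<Sum>m. jump_rate m * (1 - exp (- q * jump_size m)))"
    using sm by (intro integral_count_space_nat) (simp add: integrable_count_space_nat_iff)
  finally show ?thesis unfolding laplace_exponent_def eq by simp
qed

text \<open>The values of the Laplace transform at integers are the moments of \<open>exp (- S)\<close>, a random variable
  with values in \<open>{0..1}\<close>; by the theorem of Weierstrass they determine the expectations of all
  continuous functions of it.\<close>

lemma (in prob_space) laplace_determines_expectation:
  fixes S :: "'a \<Rightarrow> real" and q :: "nat pmf" and g :: "real \<Rightarrow> real"
  assumes [measurable]: "S \<in> borel_measurable M" and S0: "AE \<omega> in M. S \<omega> \<ge> 0"
    and lap: "\<And>k::nat. expectation (\<lambda>\<omega>. exp (- real k * S \<omega>)) = measure_pmf.expectation q (\<lambda>n. exp (- real k) ^ n)"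
    and g: "continuous_on UNIV g"
  shows "expectation (\<lambda>\<omega>. g (exp (- S \<omega>))) = measure_pmf.expectation q (\<lambda>n. g (exp (- real n)))"
proof -
  have [measurable]: "g \<in> borel_measurable borel" by (rule borel_measurable_continuous_onI[OF g])
  have bdd: "bounded (g ` {0..1})"
    by (intro compact_imp_bounded compact_continuous_image continuous_on_subset[OF g]) auto
  then have "\<exists>K. \<forall>u\<in>{0..1}. \<bar>g u\<bar> \<le> K" by (auto simp: bounded_iff)
  then obtain K where K: "\<And>u. u \<in> {0..1} \<Longrightarrow> \<bar>g u\<bar> \<le> K" by blast
  have int_bd: "integrable M (\<lambda>\<omega>. h (exp (- S \<omega>)))"
    if [measurable]: "h \<in> borel_measurable borel" and "\<And>u. u \<in> {0..1} \<Longrightarrow> \<bar>h u\<bar> \<le> C" for h :: "real \<Rightarrow> real" and C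
    using S0 that(2) by (intro integrable_const_bound[where B=C]) (auto elim!: eventually_mono)
  have int_bdq: "integrable q (\<lambda>n. h (exp (- real n)))"
    if "\<And>u. u \<in> {0..1} \<Longrightarrow> \<bar>h u\<bar> \<le> C" for h :: "real \<Rightarrow> real" and C
    using that by (intro measure_pmf.integrable_const_bound[where B=C]) auto
  have "\<bar>expectation (\<lambda>\<omega>. g (exp (- S \<omega>))) - measure_pmf.expectation q (\<lambda>n. g (exp (- real n)))\<bar> \<le> e"
    if "e > 0" for e
  proof -
    have "e / 2 > 0" using that by simp
    then obtain p where p: "real_polynomial_function p" "\<And>u. u \<in> {0..1} \<Longrightarrow> \<bar>g u - p u\<bar> < e / 2"
      using Stone_Weierstrass_real_polynomial_function[of "{0..1}" g "e / 2"] continuous_on_subset[OF g] by auto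
    obtain a n where an: "p = (\<lambda>x. \<Sum>i\<le>n. a i * x ^ i)"
      using p(1) by (auto simp: real_polynomial_function_iff_sum)
    have pw: "exp (- S \<omega>) ^ i = exp (- real i * S \<omega>)" for i \<omega>
      by (simp add: exp_of_nat_mult[symmetric])
    have lapq: "expectation (\<lambda>\<omega>. exp (- real i * S \<omega>)) = measure_pmf.expectation q (\<lambda>n. exp (- real n) ^ i)" for i
      unfolding lap
      by (intro Bochner_Integration.integral_cong refl) (simp add: exp_of_nat_mult[symmetric] mult.commute)
    have [measurable]: "p \<in> borel_measurable borel" unfolding an by measurable
    have "bounded (p ` {0..1})"
      unfolding an by (intro compact_imp_bounded compact_continuous_image continuous_intros) auto
    then have "\<exists>C. \<forall>u\<in>{0..1}. \<bar>p u\<bar> \<le> C" by (auto simp: bounded_iff)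
    then obtain C where C: "\<And>u. u \<in> {0..1} \<Longrightarrow> \<bar>p u\<bar> \<le> C" by blast
    have i1: "integrable M (\<lambda>\<omega>. exp (- real i * S \<omega>))" for i
      unfolding pw[symmetric] by (rule int_bd[of "\<lambda>u. u ^ i" 1]) (auto simp: power_le_one abs_if)
    have i2: "integrable q (\<lambda>n. exp (- real n) ^ i)" for i
      by (rule int_bdq[of "\<lambda>u. u ^ i" 1]) (auto simp: power_le_one abs_if)
    have ig: "integrable M (\<lambda>\<omega>. g (exp (- S \<omega>)))" by (rule int_bd[OF _ K]) measurable
    have ip: "integrable M (\<lambda>\<omega>. p (exp (- S \<omega>)))" by (rule int_bd[OF _ C]) measurable
    have igq: "integrable q (\<lambda>n. g (exp (- real n)))" by (rule int_bdq[OF K])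
    have ipq: "integrable q (\<lambda>n. p (exp (- real n)))" by (rule int_bdq[OF C])
    have eq: "expectation (\<lambda>\<omega>. p (exp (- S \<omega>))) = measure_pmf.expectation q (\<lambda>n. p (exp (- real n)))"
    proof -
      have "expectation (\<lambda>\<omega>. p (exp (- S \<omega>))) = (\<Sum>i\<le>n. a i * expectation (\<lambda>\<omega>. exp (- real i * S \<omega>)))"
        unfolding an pw using i1 by (subst Bochner_Integration.integral_sum) auto
      also have "\<dots> = (\<Sum>i\<le>n. a i * measure_pmf.expectation q (\<lambda>n. exp (- real n) ^ i))"
        unfolding lapq ..
      also have "\<dots> = measure_pmf.expectation q (\<lambda>n. p (exp (- real n)))"
        unfolding an using i2 by (subst Bochner_Integration.integral_sum) auto
      finally show ?thesis .
    qed
    have "\<bar>expectation (\<lambda>\<omega>. g (exp (- S \<omega>))) - expectation (\<lambda>\<omega>. p (exp (- S \<omega>)))\<bar> \<le> e / 2"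
    proof -
      have "\<bar>expectation (\<lambda>\<omega>. g (exp (- S \<omega>))) - expectation (\<lambda>\<omega>. p (exp (- S \<omega>)))\<bar> =
          \<bar>expectation (\<lambda>\<omega>. g (exp (- S \<omega>)) - p (exp (- S \<omega>)))\<bar>"
        by (simp only: Bochner_Integration.integral_diff[OF ig ip])
      also have "\<dots> \<le> expectation (\<lambda>\<omega>. \<bar>g (exp (- S \<omega>)) - p (exp (- S \<omega>))\<bar>)"
        by (rule integral_abs_bound)
      also have "\<dots> \<le> expectation (\<lambda>\<omega>. e / 2)"
      proof (intro integral_mono_AE integrable_abs Bochner_Integration.integrable_diff ig ip)
        show "AE \<omega> in M. \<bar>g (exp (- S \<omega>)) - p (exp (- S \<omega>))\<bar> \<le> e / 2"
          using S0
        proof eventually_elim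
          case (elim \<omega>)
          then have "exp (- S \<omega>) \<in> {0..1}" by simp
          then show ?case using p(2) by (simp add: less_imp_le)
        qed
      qed simp
      finally show ?thesis by (simp add: prob_space)
    qed
    moreover have "\<bar>measure_pmf.expectation q (\<lambda>n. g (exp (- real n))) - measure_pmf.expectation q (\<lambda>n. p (exp (- real n)))\<bar> \<le> e / 2"
    proof -
      have "\<bar>measure_pmf.expectation q (\<lambda>n. g (exp (- real n))) - measure_pmf.expectation q (\<lambda>n. p (exp (- real n)))\<bar> =
          \<bar>measure_pmf.expectation q (\<lambda>n. g (exp (- real n)) - p (exp (- real n)))\<bar>"
        by (simp only: Bochner_Integration.integral_diff[OF igq ipq])
      also have "\<dots> \<le> measure_pmf.expectation q (\<lambda>n. \<bar>g (exp (- real n)) - p (exp (- real n))\<bar>)"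
        by (rule integral_abs_bound)
      also have "\<dots> \<le> measure_pmf.expectation q (\<lambda>n. e / 2)"
        by (intro integral_mono integrable_abs Bochner_Integration.integrable_diff igq ipq less_imp_le[OF p(2)])
           auto
      finally show ?thesis by simp
    qed
    ultimately show ?thesis using eq by linarith
  qed
  then have "\<bar>expectation (\<lambda>\<omega>. g (exp (- S \<omega>))) - measure_pmf.expectation q (\<lambda>n. g (exp (- real n)))\<bar> \<le> 0"
    by (rule field_le_epsilon) simp
  then show ?thesis by simp
qed

text \<open>Point probabilities are limits of expectations of shrinking tent functions. Since those at the
  natural numbers already add up to \<open>1\<close>, the random variable is almost surely an integer.\<close>

lemma (in prob_space) laplace_determines_pmf:
  fixes S :: "'a \<Rightarrow> real" and q :: "nat pmf"
  assumes [measurable]: "S \<in> borel_measurable M" and S0: "AE \<omega> in M. S \<omega> \<ge> 0"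
    and lap: "\<And>k::nat. expectation (\<lambda>\<omega>. exp (- real k * S \<omega>)) = measure_pmf.expectation q (\<lambda>n. exp (- real k) ^ n)"
  shows "AE \<omega> in M. S \<omega> \<in> \<nat>"
    and "distr M (count_space UNIV) (\<lambda>\<omega>. nat \<lfloor>S \<omega>\<rfloor>) = measure_pmf q"
proof -
  have P: "prob {\<omega>\<in>space M. S \<omega> = real n} = pmf q n" for n
  proof -
    define g where "g k u = max 0 (1 - real k * \<bar>u - exp (- real n)\<bar>)" for k u
    have lim: "(\<lambda>k. g k u) \<longlonglongrightarrow> indicator {exp (- real n)} u" for u
    proof (cases "u = exp (- real n)")
      case False
      then have "\<bar>u - exp (- real n)\<bar> > 0" by simp
      then have "eventually (\<lambda>k. real k \<ge> 1 / \<bar>u - exp (- real n)\<bar>) sequentially"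
        using eventually_ge_at_top filterlim_at_top filterlim_real_sequentially by blast
      then have "eventually (\<lambda>k. g k u = 0) sequentially"
        using False by (auto elim!: eventually_mono simp: g_def field_simps)
      then show ?thesis using False by (simp add: tendsto_eventually)
    qed (simp add: g_def)
    have g_bd: "\<bar>g k u\<bar> \<le> 1" for k u by (auto simp: g_def)
    have [measurable]: "g k \<in> borel_measurable borel" for k unfolding g_def by measurable
    have l1: "(\<lambda>k. expectation (\<lambda>\<omega>. g k (exp (- S \<omega>)))) \<longlonglongrightarrow> expectation (\<lambda>\<omega>. indicat_real {exp (- real n)} (exp (- S \<omega>)))"
      by (intro integral_dominated_convergence[where w="\<lambda>_. 1"]) (auto intro: lim g_bd)
    have l2: "(\<lambda>k. measure_pmf.expectation q (\<lambda>j. g k (exp (- real j)))) \<longlonglongrightarrow>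
        measure_pmf.expectation q (\<lambda>j. indicat_real {exp (- real n)} (exp (- real j)))"
      by (intro integral_dominated_convergence[where w="\<lambda>_. 1"]) (auto intro: lim g_bd)
    have eqk: "expectation (\<lambda>\<omega>. g k (exp (- S \<omega>))) = measure_pmf.expectation q (\<lambda>j. g k (exp (- real j)))" for k
      by (rule laplace_determines_expectation[OF assms]) (auto simp: g_def intro!: continuous_intros)
    have "expectation (\<lambda>\<omega>. indicat_real {exp (- real n)} (exp (- S \<omega>))) =
        measure_pmf.expectation q (\<lambda>j. indicat_real {exp (- real n)} (exp (- real j)))"
      using l1 l2 unfolding eqk by (rule LIMSEQ_unique)
    also have "(\<lambda>j. indicat_real {exp (- real n)} (exp (- real j))) = (indicator {n} :: nat \<Rightarrow> real)"
      by (auto simp: indicator_def fun_eq_iff)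
    also have "measure_pmf.expectation q (indicator {n}) = pmf q n"
      by (simp add: pmf.rep_eq)
    also have "expectation (\<lambda>\<omega>. indicat_real {exp (- real n)} (exp (- S \<omega>))) =
        expectation (indicator {\<omega>\<in>space M. S \<omega> = real n})"
      by (intro Bochner_Integration.integral_cong) (auto simp: indicator_def)
    finally show ?thesis by (simp add: Int_def conj_commute)
  qed
  have "emeasure M (\<Union>n. {\<omega>\<in>space M. S \<omega> = real n}) = (\<Sum>n. emeasure M {\<omega>\<in>space M. S \<omega> = real n})"
    by (intro suminf_emeasure[symmetric]) (auto simp: disjoint_family_on_def)
  also have "\<dots> = (\<integral>\<^sup>+n. ennreal (pmf q n) \<partial>count_space UNIV)"
    by (simp add: emeasure_eq_measure P nn_integral_count_space_nat)
  also have "\<dots> = 1" by (simp add: nn_integral_pmf measure_pmf.emeasure_space_1[simplified])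
  finally have "AE \<omega> in M. \<omega> \<in> (\<Union>n. {\<omega>\<in>space M. S \<omega> = real n})"
    by (intro AE_prob_1) (simp add: measure_def)
  then show nat: "AE \<omega> in M. S \<omega> \<in> \<nat>"
    by eventually_elim auto
  show "distr M (count_space UNIV) (\<lambda>\<omega>. nat \<lfloor>S \<omega>\<rfloor>) = measure_pmf q"
  proof (rule measure_eqI_countable[of _ UNIV])
    fix n :: nat
    have "emeasure (distr M (count_space UNIV) (\<lambda>\<omega>. nat \<lfloor>S \<omega>\<rfloor>)) {n} =
        emeasure M {\<omega>\<in>space M. nat \<lfloor>S \<omega>\<rfloor> = n}"
      by (subst emeasure_distr) (auto intro!: arg_cong[where f="emeasure M"])
    also have "\<dots> = emeasure M {\<omega>\<in>space M. S \<omega> = real n}"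
      using nat by (intro emeasure_eq_AE) (auto elim!: eventually_mono Nats_cases)
    also have "\<dots> = ennreal (pmf q n)" by (simp add: emeasure_eq_measure P)
    finally show "emeasure (distr M (count_space UNIV) (\<lambda>\<omega>. nat \<lfloor>S \<omega>\<rfloor>)) {n} = emeasure (measure_pmf q) {n}"
      by (simp add: emeasure_pmf_single)
  qed auto
qed

section \<open>Independence as separate sampling\<close>

text \<open>The joint law of independent variables is a product, so one of the two may be replaced by a copy
  depending on a second sample point. Independence is stated through events because the two variables
  may have different types.\<close>

lemma (in prob_space) indep_nn_integral:
  assumes [measurable]: "A \<in> M \<rightarrow>\<^sub>M N1" "B \<in> M \<rightarrow>\<^sub>M N2"
    and ind: "\<And>X Y. X \<in> sets N1 \<Longrightarrow> Y \<in> sets N2 \<Longrightarrow>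
      prob ((\<lambda>\<omega>. (A \<omega>, B \<omega>)) -` (X \<times> Y) \<inter> space M) = prob (A -` X \<inter> space M) * prob (B -` Y \<inter> space M)"
    and \<Phi>: "(\<lambda>(a, b). \<Phi> a b) \<in> borel_measurable (N1 \<Otimes>\<^sub>M N2)"
  shows "(\<integral>\<^sup>+\<omega>. \<Phi> (A \<omega>) (B \<omega>) \<partial>M) = (\<integral>\<^sup>+\<omega>. \<integral>\<^sup>+\<omega>'. \<Phi> (A \<omega>) (B \<omega>') \<partial>M \<partial>M)"
    and "(\<integral>\<^sup>+\<omega>. \<Phi> (A \<omega>) (B \<omega>) \<partial>M) = (\<integral>\<^sup>+\<omega>'. \<integral>\<^sup>+\<omega>. \<Phi> (A \<omega>) (B \<omega>') \<partial>M \<partial>M)"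
proof -
  interpret A: prob_space "distr M N1 A" by (rule prob_space_distr) simp
  interpret B: prob_space "distr M N2 B" by (rule prob_space_distr) simp
  interpret AB: pair_sigma_finite "distr M N1 A" "distr M N2 B" ..
  note [measurable] = \<Phi>
  have [measurable]: "case_prod \<Phi> \<in> borel_measurable (distr M N1 A \<Otimes>\<^sub>M distr M N2 B)"
    using \<Phi> by simp
  have law: "distr M N1 A \<Otimes>\<^sub>M distr M N2 B = distr M (N1 \<Otimes>\<^sub>M N2) (\<lambda>\<omega>. (A \<omega>, B \<omega>))"
  proof (rule pair_measure_eqI)
    fix X Y assume "X \<in> sets (distr M N1 A)" "Y \<in> sets (distr M N2 B)"
    then have XY[measurable]: "X \<in> sets N1" "Y \<in> sets N2" by auto
    have "emeasure (distr M N1 A) X * emeasure (distr M N2 B) Y =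
        ennreal (prob (A -` X \<inter> space M) * prob (B -` Y \<inter> space M))"
      by (simp add: emeasure_distr emeasure_eq_measure ennreal_mult)
    also have "\<dots> = emeasure M ((\<lambda>\<omega>. (A \<omega>, B \<omega>)) -` (X \<times> Y) \<inter> space M)"
      by (simp only: ind[OF XY] emeasure_eq_measure)
    also have "\<dots> = emeasure (distr M (N1 \<Otimes>\<^sub>M N2) (\<lambda>\<omega>. (A \<omega>, B \<omega>))) (X \<times> Y)"
      by (rule emeasure_distr[symmetric]) auto
    finally show "emeasure (distr M N1 A) X * emeasure (distr M N2 B) Y = \<dots>" .
  qed (auto intro: A.sigma_finite_measure_axioms B.sigma_finite_measure_axioms)
  have "(\<integral>\<^sup>+\<omega>. \<Phi> (A \<omega>) (B \<omega>) \<partial>M) = (\<integral>\<^sup>+z. case_prod \<Phi> z \<partial>distr M (N1 \<Otimes>\<^sub>M N2) (\<lambda>\<omega>. (A \<omega>, B \<omega>)))"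
    by (subst nn_integral_distr) auto
  also have "distr M (N1 \<Otimes>\<^sub>M N2) (\<lambda>\<omega>. (A \<omega>, B \<omega>)) = distr M N1 A \<Otimes>\<^sub>M distr M N2 B"
    by (rule law[symmetric])
  finally have joint: "(\<integral>\<^sup>+\<omega>. \<Phi> (A \<omega>) (B \<omega>) \<partial>M) =
      (\<integral>\<^sup>+z. case_prod \<Phi> z \<partial>(distr M N1 A \<Otimes>\<^sub>M distr M N2 B))" .
  also have "\<dots> = (\<integral>\<^sup>+a. \<integral>\<^sup>+b. \<Phi> a b \<partial>distr M N2 B \<partial>distr M N1 A)"
    by (subst B.nn_integral_fst[symmetric]) auto
  also have "\<dots> = (\<integral>\<^sup>+\<omega>. \<integral>\<^sup>+b. \<Phi> (A \<omega>) b \<partial>distr M N2 B \<partial>M)"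
    by (subst nn_integral_distr) auto
  also have "\<dots> = (\<integral>\<^sup>+\<omega>. \<integral>\<^sup>+\<omega>'. \<Phi> (A \<omega>) (B \<omega>') \<partial>M \<partial>M)"
  proof (rule nn_integral_cong)
    fix \<omega> assume "\<omega> \<in> space M"
    then have "A \<omega> \<in> space N1" by (rule measurable_space[rotated]) simp
    then show "(\<integral>\<^sup>+b. \<Phi> (A \<omega>) b \<partial>distr M N2 B) = (\<integral>\<^sup>+\<omega>'. \<Phi> (A \<omega>) (B \<omega>') \<partial>M)"
      by (subst nn_integral_distr) auto
  qed
  finally show "(\<integral>\<^sup>+\<omega>. \<Phi> (A \<omega>) (B \<omega>) \<partial>M) = (\<integral>\<^sup>+\<omega>. \<integral>\<^sup>+\<omega>'. \<Phi> (A \<omega>) (B \<omega>') \<partial>M \<partial>M)" .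
  have "(\<integral>\<^sup>+\<omega>. \<Phi> (A \<omega>) (B \<omega>) \<partial>M) = (\<integral>\<^sup>+b. \<integral>\<^sup>+a. \<Phi> a b \<partial>distr M N1 A \<partial>distr M N2 B)"
    unfolding joint by (subst AB.nn_integral_snd[symmetric]) auto
  also have "\<dots> = (\<integral>\<^sup>+\<omega>'. \<integral>\<^sup>+a. \<Phi> a (B \<omega>') \<partial>distr M N1 A \<partial>M)"
    by (subst nn_integral_distr) auto
  also have "\<dots> = (\<integral>\<^sup>+\<omega>'. \<integral>\<^sup>+\<omega>. \<Phi> (A \<omega>) (B \<omega>') \<partial>M \<partial>M)"
  proof (rule nn_integral_cong)
    fix \<omega>' assume "\<omega>' \<in> space M"
    then have "B \<omega>' \<in> space N2" by (rule measurable_space[rotated]) simp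
    then show "(\<integral>\<^sup>+a. \<Phi> a (B \<omega>') \<partial>distr M N1 A) = (\<integral>\<^sup>+\<omega>. \<Phi> (A \<omega>) (B \<omega>') \<partial>M)"
      by (subst nn_integral_distr) auto
  qed
  finally show "(\<integral>\<^sup>+\<omega>. \<Phi> (A \<omega>) (B \<omega>) \<partial>M) = (\<integral>\<^sup>+\<omega>'. \<integral>\<^sup>+\<omega>. \<Phi> (A \<omega>) (B \<omega>') \<partial>M \<partial>M)" .
qed

text \<open>Independence of increments, regrouped: the positions up to the present are partial sums of
  increments, the last increment is the future.\<close>

lemma (in prob_space) indep_past_increment:
  fixes V :: "real \<Rightarrow> 'a \<Rightarrow> 'b::euclidean_space"
  assumes inc: "independent_increments M V"
    and \<tau>: "mono \<tau>" "0 \<le> \<tau> (0::nat)" and s: "0 \<le> s"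
  shows "indep_var (PiM {..i} (\<lambda>_. borel)) (\<lambda>\<omega>. \<lambda>k\<in>{..i}. V (\<tau> k) \<omega> - V 0 \<omega>)
    (PiM {Suc i} (\<lambda>_. borel)) (\<lambda>\<omega>. \<lambda>k\<in>{Suc i}. V (\<tau> i + s) \<omega> - V (\<tau> i) \<omega>)"
proof -
  \<comment> \<open>the grid \<open>0, \<tau> 0, \<dots>, \<tau> i, \<tau> i + s\<close>\<close>
  define t where "t k = (if k = 0 then 0 else if k \<le> Suc i then \<tau> (k - 1) else \<tau> i + s)" for k
  have \<tau>0: "0 \<le> \<tau> k" for k using \<tau> monoD[OF \<tau>(1), of 0 k] by simp
  have t: "mono t"
  proof (rule monoI)
    fix j k :: nat assume "j \<le> k"
    consider "j = 0" | "j \<noteq> 0" "k \<le> Suc i" | "j \<noteq> 0" "j \<le> Suc i" "\<not> k \<le> Suc i" | "\<not> j \<le> Suc i"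
      by linarith
    then show "t j \<le> t k"
    proof cases
      case 1
      have "0 \<le> t k" using \<tau>0[of "k - 1"] \<tau>0[of i] s by (simp only: t_def split: if_split) auto
      with 1 show ?thesis by (simp add: t_def)
    next
      case 2
      have "\<tau> (j - 1) \<le> \<tau> (k - 1)" using \<open>j \<le> k\<close> by (intro monoD[OF \<tau>(1)]) auto
      moreover have "t j = \<tau> (j - 1)" "t k = \<tau> (k - 1)" using 2 \<open>j \<le> k\<close> by (simp_all add: t_def)
      ultimately show ?thesis by (simp only:)
    next
      case 3
      have "\<tau> (j - 1) \<le> \<tau> i" using 3 by (intro monoD[OF \<tau>(1)]) auto
      moreover have "t j = \<tau> (j - 1)" "t k = \<tau> i + s" using 3 by (simp_all add: t_def)
      ultimately show ?thesis using s by linarith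
    next
      case 4
      then show ?thesis using \<open>j \<le> k\<close> by (simp add: t_def)
    qed
  qed
  have t0: "0 \<le> t 0" by (simp add: t_def)
  let ?D = "\<lambda>k \<omega>. V (t (Suc k)) \<omega> - V (t k) \<omega>"
  have "indep_vars (\<lambda>_. borel) ?D {..<i + 2}"
    using inc t t0 unfolding independent_increments_def by blast
  then have "indep_var (PiM {..i} (\<lambda>_. borel)) (\<lambda>\<omega>. \<lambda>k\<in>{..i}. ?D k \<omega>)
      (PiM {Suc i} (\<lambda>_. borel)) (\<lambda>\<omega>. \<lambda>k\<in>{Suc i}. ?D k \<omega>)"
    by (rule indep_var_restrict) auto
  then have "indep_var (PiM {..i} (\<lambda>_. borel)) ((\<lambda>d. \<lambda>k\<in>{..i}. \<Sum>j\<le>k. d j) \<circ> (\<lambda>\<omega>. \<lambda>k\<in>{..i}. ?D k \<omega>))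
      (PiM {Suc i} (\<lambda>_. borel)) ((\<lambda>d. d) \<circ> (\<lambda>\<omega>. \<lambda>k\<in>{Suc i}. ?D k \<omega>))"
  proof (rule indep_var_compose)
    show "(\<lambda>d. \<lambda>k\<in>{..i}. \<Sum>j\<le>k. d j) \<in> Pi\<^sub>M {..i} (\<lambda>_. borel) \<rightarrow>\<^sub>M Pi\<^sub>M {..i} (\<lambda>_. borel :: 'b measure)"
      by (intro measurable_restrict borel_measurable_sum measurable_component_singleton) auto
  qed simp
  also have "(\<lambda>d. \<lambda>k\<in>{..i}. \<Sum>j\<le>k. d j) \<circ> (\<lambda>\<omega>. \<lambda>k\<in>{..i}. ?D k \<omega>) = (\<lambda>\<omega>. \<lambda>k\<in>{..i}. V (\<tau> k) \<omega> - V 0 \<omega>)"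
  proof (intro ext)
    fix \<omega> k
    have partial_sum: "(\<Sum>j\<le>k. (\<lambda>k\<in>{..i}. ?D k \<omega>) j) = V (\<tau> k) \<omega> - V 0 \<omega>" if "k \<le> i"
    proof -
      have "(\<Sum>j\<le>k. (\<lambda>k\<in>{..i}. ?D k \<omega>) j) = (\<Sum>j<Suc k. ?D j \<omega>)"
        using that by (intro sum.cong) auto
      also have "\<dots> = V (t (Suc k)) \<omega> - V (t 0) \<omega>" by (rule sum_lessThan_telescope)
      also have "t (Suc k) = \<tau> k" using that by (simp add: t_def)
      also have "t 0 = 0" by (simp add: t_def)
      finally show ?thesis .
    qed
    show "((\<lambda>d. \<lambda>k\<in>{..i}. \<Sum>j\<le>k. d j) \<circ> (\<lambda>\<omega>. \<lambda>k\<in>{..i}. ?D k \<omega>)) \<omega> k =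
        (\<lambda>k\<in>{..i}. V (\<tau> k) \<omega> - V 0 \<omega>) k"
    proof (cases "k \<le> i")
      case True
      show ?thesis using partial_sum[OF True] True by (simp only: comp_apply restrict_apply' atMost_iff)
    qed simp
  qed
  also have "(\<lambda>d. d) \<circ> (\<lambda>\<omega>. \<lambda>k\<in>{Suc i}. ?D k \<omega>) = (\<lambda>\<omega>. \<lambda>k\<in>{Suc i}. V (\<tau> i + s) \<omega> - V (\<tau> i) \<omega>)"
  proof -
    have "t (Suc (Suc i)) = \<tau> i + s" "t (Suc i) = \<tau> i" by (simp_all add: t_def)
    then show ?thesis by (intro ext) (simp add: restrict_def del: split_paired_All)
  qed
  finally show ?thesis .
qed

lemma (in prob_space) past_increment_nn_integral:
  fixes V :: "real \<Rightarrow> 'a \<Rightarrow> 'b::euclidean_space"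
  assumes inc: "independent_increments M V" and V0: "AE \<omega> in M. V 0 \<omega> = 0"
    and \<tau>: "mono \<tau>" "0 \<le> \<tau> (0::nat)" and s: "0 \<le> s"
    and G: "(\<lambda>(p, d). G p d) \<in> borel_measurable (PiM {..i} (\<lambda>_. borel) \<Otimes>\<^sub>M borel)"
  shows "(\<integral>\<^sup>+\<omega>. G (\<lambda>k\<in>{..i}. V (\<tau> k) \<omega>) (V (\<tau> i + s) \<omega> - V (\<tau> i) \<omega>) \<partial>M) =
    (\<integral>\<^sup>+\<omega>. \<integral>\<^sup>+\<omega>'. G (\<lambda>k\<in>{..i}. V (\<tau> k) \<omega>) (V (\<tau> i + s) \<omega>' - V (\<tau> i) \<omega>') \<partial>M \<partial>M)"
proof -
  have eq: "AE \<omega> in M. (\<lambda>k\<in>{..i}. V (\<tau> k) \<omega>) = (\<lambda>k\<in>{..i}. V (\<tau> k) \<omega> - V 0 \<omega>)"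
    using V0 by eventually_elim simp
  have "(\<integral>\<^sup>+\<omega>. G (\<lambda>k\<in>{..i}. V (\<tau> k) \<omega>) (V (\<tau> i + s) \<omega> - V (\<tau> i) \<omega>) \<partial>M) =
      (\<integral>\<^sup>+\<omega>. G (\<lambda>k\<in>{..i}. V (\<tau> k) \<omega> - V 0 \<omega>) (V (\<tau> i + s) \<omega> - V (\<tau> i) \<omega>) \<partial>M)"
    using eq by (intro nn_integral_cong_AE, eventually_elim) (simp only:)
  also have "\<dots> = (\<integral>\<^sup>+\<omega>. \<integral>\<^sup>+\<omega>'. G (\<lambda>k\<in>{..i}. V (\<tau> k) \<omega> - V 0 \<omega>) (V (\<tau> i + s) \<omega>' - V (\<tau> i) \<omega>') \<partial>M \<partial>M)"
  proof -
    note ind = indep_past_increment[OF inc \<tau> s, of i]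
    have G': "(\<lambda>(p, d). G p (d (Suc i))) \<in> borel_measurable (PiM {..i} (\<lambda>_. borel) \<Otimes>\<^sub>M PiM {Suc i} (\<lambda>_. borel))"
    proof -
      have "(\<lambda>z. (fst z, snd z (Suc i))) \<in> (PiM {..i} (\<lambda>_. borel :: 'b measure) \<Otimes>\<^sub>M PiM {Suc i} (\<lambda>_. borel :: 'b measure))
          \<rightarrow>\<^sub>M (PiM {..i} (\<lambda>_. borel) \<Otimes>\<^sub>M borel)"
        by (intro measurable_Pair measurable_fst measurable_compose[OF measurable_snd measurable_component_singleton]) simp
      from measurable_compose[OF this G] show ?thesis by (simp add: case_prod_beta')
    qed
    show ?thesis
      using indep_nn_integral(1)[OF indep_var_rv1[OF ind] indep_var_rv2[OF ind] indep_varD[OF ind] G']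
      by (simp only: restrict_apply' singletonI)
  qed
  also have "\<dots> = (\<integral>\<^sup>+\<omega>. \<integral>\<^sup>+\<omega>'. G (\<lambda>k\<in>{..i}. V (\<tau> k) \<omega>) (V (\<tau> i + s) \<omega>' - V (\<tau> i) \<omega>') \<partial>M \<partial>M)"
    using eq by (intro nn_integral_cong_AE, eventually_elim) (simp only:)
  finally show ?thesis .
qed

section \<open>The process on a time grid\<close>

locale lacunary_sbm = prob_space M for M :: "'w measure" +
  fixes S :: "real \<Rightarrow> 'w \<Rightarrow> real" and W :: "real \<Rightarrow> 'w \<Rightarrow> 'a::euclidean_space"
  assumes subord: "subordinator M 0 lacunary_measure S"
    and brownian: "standard_brownian_motion M W"
    and indep: "independent_processes M W S"
begin

lemma S_measurable: "t \<ge> 0 \<Longrightarrow> S t \<in> borel_measurable M"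
  and S_path: "AE \<omega> in M. S 0 \<omega> = 0 \<and> mono_on {0..} (\<lambda>t. S t \<omega>) \<and> (\<forall>t\<ge>0. continuous (at_right t) (\<lambda>u. S u \<omega>))"
  and S_indep: "independent_increments M S"
  using subord by (auto simp: subordinator_def)

lemma W_measurable: "t \<ge> 0 \<Longrightarrow> W t \<in> borel_measurable M"
  and W_indep: "independent_increments M W"
  using brownian by (auto simp: standard_brownian_motion_def)

lemma W_0: "AE \<omega> in M. W 0 \<omega> = 0"
  using brownian by (auto simp: standard_brownian_motion_def elim!: eventually_mono)

lemma S_0: "AE \<omega> in M. S 0 \<omega> = 0"
  using S_path by eventually_elim simp

lemma S_nat: "t \<ge> 0 \<Longrightarrow> AE \<omega> in M. S t \<omega> \<in> \<nat>"
  and distr_S: "t \<ge> 0 \<Longrightarrow> distr M (count_space UNIV) (\<lambda>\<omega>. nat \<lfloor>S t \<omega>\<rfloor>) = measure_pmf (compound_poisson t)"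
proof -
  assume t: "t \<ge> 0"
  have S0: "AE \<omega> in M. S t \<omega> \<ge> 0"
    using S_path
  proof eventually_elim
    case (elim \<omega>)
    then have "S 0 \<omega> \<le> S t \<omega>" using t by (intro mono_onD[of "{0..}" "\<lambda>t. S t \<omega>"]) auto
    with elim show ?case by simp
  qed
  have lap: "expectation (\<lambda>\<omega>. exp (- real k * S t \<omega>)) = measure_pmf.expectation (compound_poisson t) (\<lambda>n. exp (- real k) ^ n)" for k :: nat
  proof -
    have "expectation (\<lambda>\<omega>. exp (- real k * S t \<omega>)) = exp (- t * laplace_exponent 0 lacunary_measure (real k))"
      using subord t unfolding subordinator_def by auto
    then show ?thesis using t by (simp add: laplace_exponent_lacunary expectation_compound_poisson_power)
  qed
  show "AE \<omega> in M. S t \<omega> \<in> \<nat>"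
    by (rule laplace_determines_pmf(1)[OF S_measurable[OF t] S0 lap])
  show "distr M (count_space UNIV) (\<lambda>\<omega>. nat \<lfloor>S t \<omega>\<rfloor>) = measure_pmf (compound_poisson t)"
    by (rule laplace_determines_pmf(2)[OF S_measurable[OF t] S0 lap])
qed

lemma distr_S_increment:
  assumes "s \<ge> 0" "t \<ge> 0"
  shows "distr M (count_space UNIV) (\<lambda>\<omega>. nat \<lfloor>S (s + t) \<omega> - S s \<omega>\<rfloor>) = measure_pmf (compound_poisson t)"
proof -
  have [measurable]: "S t \<in> borel_measurable M" "S s \<in> borel_measurable M" "S (s + t) \<in> borel_measurable M"
    using assms by (auto intro: S_measurable)
  have "distr M (count_space UNIV) (\<lambda>\<omega>. nat \<lfloor>S (s + t) \<omega> - S s \<omega>\<rfloor>) =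
      distr (distr M borel (\<lambda>\<omega>. S (s + t) \<omega> - S s \<omega>)) (count_space UNIV) (\<lambda>v. nat \<lfloor>v\<rfloor>)"
    by (subst distr_distr) (auto simp: comp_def)
  also have "distr M borel (\<lambda>\<omega>. S (s + t) \<omega> - S s \<omega>) = distr M borel (S t)"
    using subord assms by (auto simp: subordinator_def stationary_increments_def)
  also have "distr (distr M borel (S t)) (count_space UNIV) (\<lambda>v. nat \<lfloor>v\<rfloor>) = measure_pmf (compound_poisson t)"
    using distr_S[OF assms(2)] by (subst distr_distr) (auto simp: comp_def)
  finally show ?thesis .
qed

text \<open>A future increment of the Brownian motion, averaged, turns the indicator of the unit ball into
  \<open>heat\<close>.\<close>

lemma nn_integral_W_increment:
  "(\<integral>\<^sup>+\<omega>. indicator (ball 0 1) (y + (W (real a + real n) \<omega> - W (real a) \<omega>)) \<partial>M) = heat n y"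
proof -
  have [measurable]: "W (real a + real n) \<in> borel_measurable M" "W (real a) \<in> borel_measurable M"
    by (auto intro: W_measurable)
  have "distr M borel (\<lambda>\<omega>. W (real a + real n) \<omega> - W (real a) \<omega>) = gauss n"
  proof (cases "n = 0")
    case True
    have "distr M borel (\<lambda>\<omega>. 0 :: 'a) = return borel 0"
      by (rule measure_eqI) (auto simp: emeasure_distr emeasure_space_1 indicator_def)
    then show ?thesis using True by (simp add: gauss_def)
  next
    case False
    have "\<forall>s\<ge>0. \<forall>t>s. distributed M lborel (\<lambda>\<omega>. W t \<omega> - W s \<omega>)
       (\<lambda>y. ennreal (\<Prod>b\<in>Basis. normal_density 0 (sqrt (t - s)) (y \<bullet> b)))"
      using brownian unfolding standard_brownian_motion_def by blast
    then have "distributed M lborel (\<lambda>\<omega>. W (real a + real n) \<omega> - W (real a) \<omega>)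
       (\<lambda>y. ennreal (\<Prod>b\<in>Basis. normal_density 0 (sqrt (real a + real n - real a)) (y \<bullet> b)))"
      using False by (elim allE[of _ "real a"] allE[of _ "real a + real n"] impE) auto
    from distributed_distr_eq_density[OF this] False
    have "distr M lborel (\<lambda>\<omega>. W (real a + real n) \<omega> - W (real a) \<omega>) = gauss n"
      by (simp add: gauss_def)
    moreover have "distr M lborel (\<lambda>\<omega>. W (real a + real n) \<omega> - W (real a) \<omega>) =
        distr M borel (\<lambda>\<omega>. W (real a + real n) \<omega> - W (real a) \<omega>)"
      by (rule distr_cong) auto
    ultimately show ?thesis by simp
  qed
  then have law: "gauss n = distr M borel (\<lambda>\<omega>. W (real a + real n) \<omega> - W (real a) \<omega>)" ..
  have [measurable]: "(\<lambda>z. indicator (ball 0 1) (y + z) :: ennreal) \<in> borel_measurable borel"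
    by (rule measurable_compose[of "\<lambda>z. y + z" borel borel]) (simp_all add: borel_measurable_indicator)
  have "(\<integral>\<^sup>+\<omega>. indicator (ball 0 1) (y + (W (real a + real n) \<omega> - W (real a) \<omega>)) \<partial>M) =
      (\<integral>\<^sup>+z. indicator (ball 0 1) (y + z) \<partial>gauss n)"
    unfolding law by (rule nn_integral_distr[symmetric]) auto
  also have "\<dots> = (\<integral>\<^sup>+z. indicator (ball (- y) 1) z \<partial>gauss n)"
  proof (rule nn_integral_cong)
    fix z
    have "0 - (y + z) = - y - z" by simp
    then have "dist 0 (y + z) = dist (- y) z" by (simp only: dist_norm)
    then show "indicator (ball 0 1) (y + z) = (indicator (ball (- y) 1) z :: ennreal)"
      by (simp only: indicator_def mem_ball)
  qed
  also have "\<dots> = heat n y" by (simp add: heat_def)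
  finally show ?thesis .
qed

end

text \<open>Writes the value at the first exit as a sum over the possible exit times, in which at most one term
  is non-zero.\<close>

lemma suminf_first_failure:
  fixes f :: "nat \<Rightarrow> ennreal"
  shows "(\<Sum>i. if (\<forall>k<i. P k) \<and> \<not> P i then f i else 0) =
    (if \<exists>k. \<not> P k then f (LEAST k. \<not> P k) else 0)"
proof (cases "\<exists>k. \<not> P k")
  case True
  define i where "i = (LEAST k. \<not> P k)"
  have i: "\<not> P i" "\<forall>k<i. P k"
    using LeastI_ex[OF True] not_less_Least[of _ "\<lambda>k. \<not> P k"] unfolding i_def by blast+
  have "(\<Sum>j. if (\<forall>k<j. P k) \<and> \<not> P j then f j else 0) =
      (\<Sum>j\<in>{i}. if (\<forall>k<j. P k) \<and> \<not> P j then f j else 0)"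
  proof (rule suminf_finite)
    fix j assume "j \<notin> {i}"
    then have "j < i \<or> i < j" by auto
    then show "(if (\<forall>k<j. P k) \<and> \<not> P j then f j else 0) = 0" using i by auto
  qed simp
  then show ?thesis using True i by (simp add: i_def[symmetric])
qed simp

context lacunary_sbm
begin

text \<open>The subordinator observed at the grid times, as a natural number. The integer part makes it
  measurable and \<open>nat\<close>-valued everywhere; almost surely it changes nothing.\<close>

definition clock :: "real \<Rightarrow> nat \<Rightarrow> 'w \<Rightarrow> nat" where
  "clock \<delta> k \<omega> = nat \<lfloor>S (real k * \<delta>) \<omega>\<rfloor>"

text \<open>The process started at \<open>x\<close>, observed at the times \<open>k \<delta>\<close>.\<close>

definition skel :: "real \<Rightarrow> 'a \<Rightarrow> nat \<Rightarrow> 'w \<Rightarrow> 'a" where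
  "skel \<delta> x k \<omega> = x + W (real (clock \<delta> k \<omega>)) \<omega>"

lemma measurable_W_nat [measurable]: "W (real n) \<in> borel_measurable M"
  by (rule W_measurable) simp

lemma measurable_clock: "\<delta> \<ge> 0 \<Longrightarrow> clock \<delta> k \<in> M \<rightarrow>\<^sub>M count_space UNIV"
proof -
  assume "\<delta> \<ge> 0"
  then have [measurable]: "S (real k * \<delta>) \<in> borel_measurable M" by (intro S_measurable) simp
  show ?thesis unfolding clock_def[abs_def] by measurable
qed

lemma measurable_skel: "\<delta> \<ge> 0 \<Longrightarrow> skel \<delta> x k \<in> borel_measurable M"
  unfolding skel_def[abs_def]
  by (rule measurable_compose_countable[OF _ measurable_clock]) simp

lemma measurable_heat [measurable]: "heat n \<in> borel_measurable (borel :: 'a measure)"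
proof -
  have "heat n = (\<lambda>y. \<integral>\<^sup>+\<omega>. indicator (ball 0 1) (y + (W (real 0 + real n) \<omega> - W (real 0) \<omega>)) \<partial>M)"
    by (rule ext) (rule nn_integral_W_increment[symmetric])
  also have "\<dots> \<in> borel_measurable borel"
  proof (rule borel_measurable_nn_integral)
    have [measurable]: "W (real 0 + real n) \<in> borel_measurable M" by (rule W_measurable) simp
    have "(\<lambda>z. fst z + (W (real 0 + real n) (snd z) - W (real 0) (snd z))) \<in> borel \<Otimes>\<^sub>M M \<rightarrow>\<^sub>M (borel :: 'a measure)"
      by measurable
    from measurable_compose[OF this, of "indicator (ball 0 1) :: 'a \<Rightarrow> ennreal" borel]
    show "(\<lambda>(y, \<omega>). indicator (ball 0 1) (y + (W (real 0 + real n) \<omega> - W (real 0) \<omega>)) :: ennreal)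
        \<in> borel_measurable (borel \<Otimes>\<^sub>M M)"
      by (simp add: case_prod_beta' borel_measurable_indicator)
  qed
  finally show ?thesis .
qed

lemma measurable_compound_poisson_heat: "(\<lambda>y::'a. \<integral>\<^sup>+n. heat n y \<partial>compound_poisson t) \<in> borel_measurable borel"
  unfolding nn_integral_measure_pmf nn_integral_count_space_nat by measurable

lemma measurable_dgreen: "(dgreen \<delta> :: 'a \<Rightarrow> ennreal) \<in> borel_measurable borel"
proof -
  note [measurable] = measurable_compound_poisson_heat
  show ?thesis unfolding dgreen_def[abs_def] by measurable
qed

lemma measurable_green: "(green :: 'a \<Rightarrow> ennreal) \<in> borel_measurable borel"
  unfolding green_def[abs_def] by measurable

lemma process_sigma_measurable:
  fixes V :: "real \<Rightarrow> 'w \<Rightarrow> 'b::euclidean_space"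
  assumes "t \<ge> 0"
  shows "V t \<in> borel_measurable (process_sigma M V)"
proof -
  have "(\<lambda>\<omega>. \<lambda>t\<in>{0..}. V t \<omega>) \<in> process_sigma M V \<rightarrow>\<^sub>M Pi\<^sub>M {0..} (\<lambda>_. borel)"
    unfolding process_sigma_def by (rule measurable_vimage_algebra1) (auto simp: space_PiM)
  then have "(\<lambda>\<omega>. (\<lambda>t\<in>{0..}. V t \<omega>) t) \<in> borel_measurable (process_sigma M V)"
    by (rule measurable_compose) (rule measurable_component_singleton, use assms in simp)
  then show ?thesis using assms by simp
qed

text \<open>Brownian motion and subordinator may be sampled separately. Only countably many coordinates of
  both matter, because the clock takes natural values.\<close>

lemma decouple:
  fixes \<Phi> :: "(nat \<Rightarrow> 'a) \<Rightarrow> (nat \<Rightarrow> nat) \<Rightarrow> ennreal"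
  assumes \<delta>: "\<delta> \<ge> 0"
    and \<Phi>: "(\<lambda>(w, s). \<Phi> w s) \<in> borel_measurable (PiM UNIV (\<lambda>_. borel) \<Otimes>\<^sub>M PiM UNIV (\<lambda>_. count_space UNIV))"
  shows "(\<integral>\<^sup>+\<omega>. \<Phi> (\<lambda>n. W (real n) \<omega>) (\<lambda>k. clock \<delta> k \<omega>) \<partial>M) =
      (\<integral>\<^sup>+\<omega>. \<integral>\<^sup>+\<omega>'. \<Phi> (\<lambda>n. W (real n) \<omega>) (\<lambda>k. clock \<delta> k \<omega>') \<partial>M \<partial>M)"
    and "(\<integral>\<^sup>+\<omega>. \<Phi> (\<lambda>n. W (real n) \<omega>) (\<lambda>k. clock \<delta> k \<omega>) \<partial>M) =
      (\<integral>\<^sup>+\<omega>'. \<integral>\<^sup>+\<omega>. \<Phi> (\<lambda>n. W (real n) \<omega>) (\<lambda>k. clock \<delta> k \<omega>') \<partial>M \<partial>M)"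
proof -
  let ?A = "\<lambda>\<omega> n. W (real n) \<omega>" and ?B = "\<lambda>\<omega> k. clock \<delta> k \<omega>"
  have A: "?A \<in> M \<rightarrow>\<^sub>M PiM UNIV (\<lambda>_. borel)"
    by (rule measurable_PiM_single') (auto simp: measurable_W_nat)
  have B: "?B \<in> M \<rightarrow>\<^sub>M PiM UNIV (\<lambda>_. count_space UNIV)"
    by (rule measurable_PiM_single') (auto simp: measurable_clock[OF \<delta>])
  have A': "?A \<in> process_sigma M W \<rightarrow>\<^sub>M PiM UNIV (\<lambda>_. borel)"
    by (rule measurable_PiM_single') (auto intro: process_sigma_measurable)
  have B': "?B \<in> process_sigma M S \<rightarrow>\<^sub>M PiM UNIV (\<lambda>_. count_space UNIV)"
  proof (rule measurable_PiM_single')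
    fix k
    have [measurable]: "S (real k * \<delta>) \<in> borel_measurable (process_sigma M S)"
      using \<delta> by (intro process_sigma_measurable) simp
    show "(\<lambda>\<omega>. clock \<delta> k \<omega>) \<in> process_sigma M S \<rightarrow>\<^sub>M count_space UNIV"
      unfolding clock_def by measurable
  qed simp
  have sp: "space (process_sigma M V) = space M" for V :: "real \<Rightarrow> 'w \<Rightarrow> 'b::euclidean_space"
    by (simp add: process_sigma_def)
  have ind: "prob ((\<lambda>\<omega>. (?A \<omega>, ?B \<omega>)) -` (X \<times> Y) \<inter> space M) =
      prob (?A -` X \<inter> space M) * prob (?B -` Y \<inter> space M)"
    if "X \<in> sets (PiM UNIV (\<lambda>_. borel))" "Y \<in> sets (PiM UNIV (\<lambda>_. count_space UNIV))" for X Y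
  proof -
    have "?A -` X \<inter> space M \<in> sets (process_sigma M W)"
      using measurable_sets[OF A' that(1)] by (simp add: sp)
    moreover have "?B -` Y \<inter> space M \<in> sets (process_sigma M S)"
      using measurable_sets[OF B' that(2)] by (simp add: sp)
    ultimately have "prob ((?A -` X \<inter> space M) \<inter> (?B -` Y \<inter> space M)) =
        prob (?A -` X \<inter> space M) * prob (?B -` Y \<inter> space M)"
      using indep unfolding independent_processes_def by (intro indep_setD)
    moreover have "(\<lambda>\<omega>. (?A \<omega>, ?B \<omega>)) -` (X \<times> Y) \<inter> space M = (?A -` X \<inter> space M) \<inter> (?B -` Y \<inter> space M)"
      by blast
    ultimately show ?thesis by (simp only:)
  qed
  show "(\<integral>\<^sup>+\<omega>. \<Phi> (?A \<omega>) (?B \<omega>) \<partial>M) = (\<integral>\<^sup>+\<omega>. \<integral>\<^sup>+\<omega>'. \<Phi> (?A \<omega>) (?B \<omega>') \<partial>M \<partial>M)"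
    by (rule indep_nn_integral(1)[OF A B ind \<Phi>])
  show "(\<integral>\<^sup>+\<omega>. \<Phi> (?A \<omega>) (?B \<omega>) \<partial>M) = (\<integral>\<^sup>+\<omega>'. \<integral>\<^sup>+\<omega>. \<Phi> (?A \<omega>) (?B \<omega>') \<partial>M \<partial>M)"
    by (rule indep_nn_integral(2)[OF A B ind \<Phi>])
qed

text \<open>The Markov property of the Brownian motion along a fixed clock path.\<close>

lemma average_W_increment:
  fixes J :: "(nat \<Rightarrow> 'a) \<Rightarrow> ennreal"
  assumes J: "J \<in> borel_measurable (PiM {..i} (\<lambda>_. borel))" and s: "mono s"
  shows "(\<integral>\<^sup>+\<omega>. J (\<lambda>k\<in>{..i}. x + W (real (s k)) \<omega>) * indicator (ball 0 1) (x + W (real (s (i + l))) \<omega>) \<partial>M) =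
    (\<integral>\<^sup>+\<omega>. J (\<lambda>k\<in>{..i}. x + W (real (s k)) \<omega>) * heat (s (i + l) - s i) (x + W (real (s i)) \<omega>) \<partial>M)"
proof -
  let ?n = "s (i + l) - s i"
  have sil: "real (s i) + real ?n = real (s (i + l))"
    using monoD[OF s, of i "i + l"] by simp
  define G where "G p d = J (\<lambda>k\<in>{..i}. x + p k) * indicator (ball 0 1) (x + p i + d)" for p d
  have Jx: "(\<lambda>p. J (\<lambda>k\<in>{..i}. x + p k)) \<in> borel_measurable (PiM {..i} (\<lambda>_. borel))"
    by (rule measurable_compose[OF _ J]) (intro measurable_restrict borel_measurable_add measurable_const measurable_component_singleton, simp_all)
  have G: "(\<lambda>(p, d). G p d) \<in> borel_measurable (PiM {..i} (\<lambda>_. borel) \<Otimes>\<^sub>M borel)"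
  proof -
    have "(\<lambda>z. x + fst z i + snd z) \<in> (PiM {..i} (\<lambda>_. borel :: 'a measure) \<Otimes>\<^sub>M borel) \<rightarrow>\<^sub>M borel"
      by (intro borel_measurable_add measurable_const measurable_snd
          measurable_compose[OF measurable_fst measurable_component_singleton]) simp_all
    then have "(\<lambda>z. indicator (ball 0 1) (x + fst z i + snd z) :: ennreal) \<in> borel_measurable (PiM {..i} (\<lambda>_. borel) \<Otimes>\<^sub>M borel)"
      by (rule measurable_compose) (simp add: borel_measurable_indicator)
    moreover have "(\<lambda>z. J (\<lambda>k\<in>{..i}. x + fst z k)) \<in> borel_measurable (PiM {..i} (\<lambda>_. borel :: 'a measure) \<Otimes>\<^sub>M (borel :: 'a measure))"
      by (rule measurable_compose[OF measurable_fst Jx])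
    ultimately show ?thesis unfolding G_def case_prod_beta' by (intro borel_measurable_times_ennreal)
  qed
  have restr: "(\<lambda>k\<in>{..i}. x + (\<lambda>k\<in>{..i}. W (real (s k)) \<omega>) k) = (\<lambda>k\<in>{..i}. x + W (real (s k)) \<omega>)" for \<omega>
    by (rule restrict_ext) (simp only: restrict_apply')
  have "(\<integral>\<^sup>+\<omega>. G (\<lambda>k\<in>{..i}. W (real (s k)) \<omega>) (W (real (s i) + real ?n) \<omega> - W (real (s i)) \<omega>) \<partial>M) =
    (\<integral>\<^sup>+\<omega>. \<integral>\<^sup>+\<omega>'. G (\<lambda>k\<in>{..i}. W (real (s k)) \<omega>) (W (real (s i) + real ?n) \<omega>' - W (real (s i)) \<omega>') \<partial>M \<partial>M)"
    using s by (intro past_increment_nn_integral[OF W_indep W_0 _ _ _ G]) (auto simp: mono_def)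
  also have "(\<lambda>\<omega>. G (\<lambda>k\<in>{..i}. W (real (s k)) \<omega>) (W (real (s i) + real ?n) \<omega> - W (real (s i)) \<omega>)) =
      (\<lambda>\<omega>. J (\<lambda>k\<in>{..i}. x + W (real (s k)) \<omega>) * indicator (ball 0 1) (x + W (real (s (i + l))) \<omega>))"
    unfolding G_def restr sil by simp
  also have "(\<lambda>\<omega>. \<integral>\<^sup>+\<omega>'. G (\<lambda>k\<in>{..i}. W (real (s k)) \<omega>) (W (real (s i) + real ?n) \<omega>' - W (real (s i)) \<omega>') \<partial>M) =
      (\<lambda>\<omega>. J (\<lambda>k\<in>{..i}. x + W (real (s k)) \<omega>) * heat ?n (x + W (real (s i)) \<omega>))"
  proof
    fix \<omega>
    have [measurable]: "W (real (s i) + real ?n) \<in> borel_measurable M" by (rule W_measurable) simp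
    have "(\<lambda>\<omega>'. x + W (real (s i)) \<omega> + (W (real (s i) + real ?n) \<omega>' - W (real (s i)) \<omega>')) \<in> borel_measurable M"
      by measurable
    then have m: "(\<lambda>\<omega>'. indicator (ball 0 1) (x + W (real (s i)) \<omega> + (W (real (s i) + real ?n) \<omega>' - W (real (s i)) \<omega>')) :: ennreal)
        \<in> borel_measurable M"
      by (rule measurable_compose) (simp add: borel_measurable_indicator)
    have "(\<integral>\<^sup>+\<omega>'. J (\<lambda>k\<in>{..i}. x + W (real (s k)) \<omega>) * indicator (ball 0 1)
          (x + W (real (s i)) \<omega> + (W (real (s i) + real ?n) \<omega>' - W (real (s i)) \<omega>')) \<partial>M) =
        J (\<lambda>k\<in>{..i}. x + W (real (s k)) \<omega>) * heat ?n (x + W (real (s i)) \<omega>)"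
      unfolding nn_integral_cmult[OF m] nn_integral_W_increment ..
    then show "(\<integral>\<^sup>+\<omega>'. G (\<lambda>k\<in>{..i}. W (real (s k)) \<omega>) (W (real (s i) + real ?n) \<omega>' - W (real (s i)) \<omega>') \<partial>M) =
        J (\<lambda>k\<in>{..i}. x + W (real (s k)) \<omega>) * heat ?n (x + W (real (s i)) \<omega>)"
      unfolding G_def restr by (simp only: restrict_apply' atMost_iff order_refl)
  qed
  finally show ?thesis .
qed

text \<open>The Markov property of the clock along a fixed Brownian path.\<close>

lemma average_S_increment:
  fixes J :: "(nat \<Rightarrow> 'a) \<Rightarrow> ennreal" and w :: "nat \<Rightarrow> 'a"
  assumes J: "J \<in> borel_measurable (PiM {..i} (\<lambda>_. borel))" and \<delta>: "\<delta> \<ge> 0"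
  shows "(\<integral>\<^sup>+\<omega>. J (\<lambda>k\<in>{..i}. x + w (clock \<delta> k \<omega>)) * heat (clock \<delta> (i + l) \<omega> - clock \<delta> i \<omega>) (x + w (clock \<delta> i \<omega>)) \<partial>M) =
    (\<integral>\<^sup>+\<omega>. J (\<lambda>k\<in>{..i}. x + w (clock \<delta> k \<omega>)) * (\<integral>\<^sup>+n. heat n (x + w (clock \<delta> i \<omega>)) \<partial>compound_poisson (real l * \<delta>)) \<partial>M)"
proof -
  define v where "v r = x + w (nat \<lfloor>r\<rfloor>)" for r :: real
  have v: "v \<in> borel_measurable borel"
  proof -
    have "(\<lambda>r::real. nat \<lfloor>r\<rfloor>) \<in> borel \<rightarrow>\<^sub>M count_space UNIV" by measurable
    from measurable_compose[OF this, of "\<lambda>n. x + w n" borel] show ?thesis by (simp add: v_def[abs_def])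
  qed
  have vc: "x + w (clock \<delta> k \<omega>) = v (S (real k * \<delta>) \<omega>)" for k \<omega>
    by (simp add: v_def clock_def)
  define G where "G p d = J (\<lambda>k\<in>{..i}. v (p k)) * heat (nat \<lfloor>d\<rfloor>) (v (p i))" for p and d :: real
  have G: "(\<lambda>(p, d). G p d) \<in> borel_measurable (PiM {..i} (\<lambda>_. borel) \<Otimes>\<^sub>M borel)"
  proof -
    let ?N = "PiM {..i} (\<lambda>_. borel :: real measure) \<Otimes>\<^sub>M (borel :: real measure)"
    have vi: "(\<lambda>z. v (fst z k)) \<in> ?N \<rightarrow>\<^sub>M borel" if "k \<in> {..i}" for k
      using that by (intro measurable_compose[OF _ v] measurable_compose[OF measurable_fst measurable_component_singleton])
    have "(\<lambda>z. \<lambda>k\<in>{..i}. v (fst z k)) \<in> ?N \<rightarrow>\<^sub>M PiM {..i} (\<lambda>_. borel)"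
      by (intro measurable_restrict vi)
    from measurable_compose[OF this J] have "(\<lambda>z. J (\<lambda>k\<in>{..i}. v (fst z k))) \<in> borel_measurable ?N" .
    moreover have "(\<lambda>z. heat (nat \<lfloor>snd z\<rfloor>) (v (fst z i))) \<in> borel_measurable ?N"
    proof (rule measurable_compose_countable[where f="\<lambda>n z. heat n (v (fst z i))"])
      show "(\<lambda>z. heat n (v (fst z i))) \<in> borel_measurable ?N" for n
        by (rule measurable_compose[OF vi measurable_heat]) simp
      show "(\<lambda>z. nat \<lfloor>snd z\<rfloor>) \<in> ?N \<rightarrow>\<^sub>M count_space UNIV" by measurable
    qed
    ultimately show ?thesis unfolding G_def case_prod_beta' by (intro borel_measurable_times_ennreal)
  qed
  have restr: "(\<lambda>k\<in>{..i}. v ((\<lambda>k\<in>{..i}. S (real k * \<delta>) \<omega>) k)) = (\<lambda>k\<in>{..i}. v (S (real k * \<delta>) \<omega>))" for \<omega>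
    by (rule restrict_ext) (simp only: restrict_apply')
  have il: "real i * \<delta> + real l * \<delta> = real (i + l) * \<delta>" by (simp add: distrib_right)
  have "(\<integral>\<^sup>+\<omega>. G (\<lambda>k\<in>{..i}. S (real k * \<delta>) \<omega>) (S (real i * \<delta> + real l * \<delta>) \<omega> - S (real i * \<delta>) \<omega>) \<partial>M) =
    (\<integral>\<^sup>+\<omega>. \<integral>\<^sup>+\<omega>'. G (\<lambda>k\<in>{..i}. S (real k * \<delta>) \<omega>) (S (real i * \<delta> + real l * \<delta>) \<omega>' - S (real i * \<delta>) \<omega>') \<partial>M \<partial>M)"
    using \<delta> by (intro past_increment_nn_integral[OF S_indep S_0 _ _ _ G]) (auto simp: mono_def mult_right_mono)
  also have "(\<lambda>\<omega>. \<integral>\<^sup>+\<omega>'. G (\<lambda>k\<in>{..i}. S (real k * \<delta>) \<omega>) (S (real i * \<delta> + real l * \<delta>) \<omega>' - S (real i * \<delta>) \<omega>') \<partial>M) =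
      (\<lambda>\<omega>. J (\<lambda>k\<in>{..i}. v (S (real k * \<delta>) \<omega>)) * (\<integral>\<^sup>+n. heat n (v (S (real i * \<delta>) \<omega>)) \<partial>compound_poisson (real l * \<delta>)))"
  proof
    fix \<omega>
    let ?D = "\<lambda>\<omega>'. nat \<lfloor>S (real i * \<delta> + real l * \<delta>) \<omega>' - S (real i * \<delta>) \<omega>'\<rfloor>"
    have [measurable]: "S (real i * \<delta> + real l * \<delta>) \<in> borel_measurable M" "S (real i * \<delta>) \<in> borel_measurable M"
      using \<delta> by (auto intro!: S_measurable)
    have D: "?D \<in> M \<rightarrow>\<^sub>M count_space UNIV" by measurable
    have law: "distr M (count_space UNIV) ?D = measure_pmf (compound_poisson (real l * \<delta>))"
      using \<delta> by (intro distr_S_increment) auto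
    have "(\<integral>\<^sup>+\<omega>'. J (\<lambda>k\<in>{..i}. v (S (real k * \<delta>) \<omega>)) * heat (?D \<omega>') (v (S (real i * \<delta>) \<omega>)) \<partial>M) =
        J (\<lambda>k\<in>{..i}. v (S (real k * \<delta>) \<omega>)) * (\<integral>\<^sup>+\<omega>'. heat (?D \<omega>') (v (S (real i * \<delta>) \<omega>)) \<partial>M)"
      by (rule nn_integral_cmult) (rule measurable_compose[OF D], simp)
    also have "(\<integral>\<^sup>+\<omega>'. heat (?D \<omega>') (v (S (real i * \<delta>) \<omega>)) \<partial>M) =
        (\<integral>\<^sup>+n. heat n (v (S (real i * \<delta>) \<omega>)) \<partial>compound_poisson (real l * \<delta>))"
      unfolding law[symmetric] by (rule nn_integral_distr[OF D, symmetric]) simp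
    finally show "(\<integral>\<^sup>+\<omega>'. G (\<lambda>k\<in>{..i}. S (real k * \<delta>) \<omega>) (S (real i * \<delta> + real l * \<delta>) \<omega>' - S (real i * \<delta>) \<omega>') \<partial>M) =
      J (\<lambda>k\<in>{..i}. v (S (real k * \<delta>) \<omega>)) * (\<integral>\<^sup>+n. heat n (v (S (real i * \<delta>) \<omega>)) \<partial>compound_poisson (real l * \<delta>))"
      unfolding G_def restr by (simp only: restrict_apply' atMost_iff order_refl)
  qed
  also have "(\<integral>\<^sup>+\<omega>. G (\<lambda>k\<in>{..i}. S (real k * \<delta>) \<omega>) (S (real i * \<delta> + real l * \<delta>) \<omega> - S (real i * \<delta>) \<omega>) \<partial>M) =
      (\<integral>\<^sup>+\<omega>. J (\<lambda>k\<in>{..i}. v (S (real k * \<delta>) \<omega>)) * heat (clock \<delta> (i + l) \<omega> - clock \<delta> i \<omega>) (v (S (real i * \<delta>) \<omega>)) \<partial>M)"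
  proof (rule nn_integral_cong_AE)
    have "AE \<omega> in M. S (real i * \<delta>) \<omega> \<in> \<nat>" "AE \<omega> in M. S (real (i + l) * \<delta>) \<omega> \<in> \<nat>"
      using \<delta> by (auto intro!: S_nat)
    then show "AE \<omega> in M. G (\<lambda>k\<in>{..i}. S (real k * \<delta>) \<omega>) (S (real i * \<delta> + real l * \<delta>) \<omega> - S (real i * \<delta>) \<omega>) =
       J (\<lambda>k\<in>{..i}. v (S (real k * \<delta>) \<omega>)) * heat (clock \<delta> (i + l) \<omega> - clock \<delta> i \<omega>) (v (S (real i * \<delta>) \<omega>))"
    proof eventually_elim
      case (elim \<omega>)
      from elim obtain a b where ab: "S (real i * \<delta>) \<omega> = real a" "S (real (i + l) * \<delta>) \<omega> = real b"
        by (elim Nats_cases)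
      have "nat \<lfloor>real b - real a\<rfloor> = b - a"
      proof -
        have "real b - real a = of_int (int b - int a)" by simp
        then have "\<lfloor>real b - real a\<rfloor> = int b - int a" by (simp only: floor_of_int)
        then show ?thesis by simp
      qed
      then have "nat \<lfloor>S (real i * \<delta> + real l * \<delta>) \<omega> - S (real i * \<delta>) \<omega>\<rfloor> = clock \<delta> (i + l) \<omega> - clock \<delta> i \<omega>"
        unfolding il clock_def ab by simp
      then show ?case
        unfolding G_def restr by (simp only: restrict_apply' atMost_iff order_refl)
    qed
  qed
  finally show ?thesis unfolding vc .
qed

text \<open>The Markov property of the observed process. With the two sources of randomness decoupled, first
  the Brownian increment is averaged for a frozen clock, then the clock increment for a frozen Brownian
  path.\<close>

lemma skel_markov:
  fixes J :: "(nat \<Rightarrow> 'a) \<Rightarrow> ennreal"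
  assumes J: "J \<in> borel_measurable (PiM {..i} (\<lambda>_. borel))" and \<delta>: "\<delta> \<ge> 0"
  shows "(\<integral>\<^sup>+\<omega>. J (\<lambda>k\<in>{..i}. skel \<delta> x k \<omega>) * indicator (ball 0 1) (skel \<delta> x (i + l) \<omega>) \<partial>M) =
    (\<integral>\<^sup>+\<omega>. J (\<lambda>k\<in>{..i}. skel \<delta> x k \<omega>) * (\<integral>\<^sup>+n. heat n (skel \<delta> x i \<omega>) \<partial>compound_poisson (real l * \<delta>)) \<partial>M)"
proof -
  let ?N = "PiM UNIV (\<lambda>_. borel :: 'a measure) \<Otimes>\<^sub>M PiM UNIV (\<lambda>_::nat. count_space (UNIV :: nat set))"
  let ?A = "\<lambda>\<omega> n. W (real n) \<omega>" and ?B = "\<lambda>\<omega> k. clock \<delta> k \<omega>"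
  define P where "P y = (\<integral>\<^sup>+n. heat n y \<partial>compound_poisson (real l * \<delta>))" for y :: 'a
  define H where "H w s = J (\<lambda>k\<in>{..i}. x + w (s k))" for w :: "nat \<Rightarrow> 'a" and s :: "nat \<Rightarrow> nat"
  define \<Phi>1 where "\<Phi>1 w s = H w s * indicator (ball 0 1) (x + w (s (i + l)))" for w and s :: "nat \<Rightarrow> nat"
  define \<Phi>2 where "\<Phi>2 w s = H w s * heat (s (i + l) - s i) (x + w (s i))" for w s
  define \<Phi>3 where "\<Phi>3 w s = H w s * P (x + w (s i))" for w s
  have s: "(\<lambda>z. snd z k) \<in> ?N \<rightarrow>\<^sub>M count_space UNIV" for k
    by (rule measurable_compose[OF measurable_snd measurable_component_singleton]) simp
  have ws: "(\<lambda>z. x + fst z (snd z k)) \<in> ?N \<rightarrow>\<^sub>M borel" for k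
  proof (rule measurable_compose_countable[OF _ s])
    show "(\<lambda>z. x + fst z n) \<in> ?N \<rightarrow>\<^sub>M borel" for n
      by (intro borel_measurable_add measurable_const measurable_compose[OF measurable_fst measurable_component_singleton]) simp_all
  qed
  have H: "(\<lambda>z. H (fst z) (snd z)) \<in> borel_measurable ?N"
    unfolding H_def by (rule measurable_compose[OF _ J]) (intro measurable_restrict ws)
  have \<Phi>1: "(\<lambda>(w, s). \<Phi>1 w s) \<in> borel_measurable ?N"
    unfolding \<Phi>1_def case_prod_beta' using measurable_compose[OF ws, of "indicator (ball 0 1) :: 'a \<Rightarrow> ennreal" borel]
    by (intro borel_measurable_times_ennreal H) (simp add: borel_measurable_indicator)
  have \<Phi>2: "(\<lambda>(w, s). \<Phi>2 w s) \<in> borel_measurable ?N"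
    unfolding \<Phi>2_def case_prod_beta'
  proof (intro borel_measurable_times_ennreal H, rule measurable_compose_countable[where g="\<lambda>z. snd z (i + l) - snd z i"])
    show "(\<lambda>z. heat n (x + fst z (snd z i))) \<in> borel_measurable ?N" for n
      by (rule measurable_compose[OF ws measurable_heat])
    note [measurable] = s
    show "(\<lambda>z. snd z (i + l) - snd z i) \<in> ?N \<rightarrow>\<^sub>M count_space UNIV" by measurable
  qed
  have \<Phi>3: "(\<lambda>(w, s). \<Phi>3 w s) \<in> borel_measurable ?N"
    unfolding \<Phi>3_def case_prod_beta' P_def
    by (intro borel_measurable_times_ennreal H measurable_compose[OF ws measurable_compound_poisson_heat])
  have "(\<integral>\<^sup>+\<omega>. \<Phi>1 (?A \<omega>) (?B \<omega>) \<partial>M) = (\<integral>\<^sup>+\<omega>'. \<integral>\<^sup>+\<omega>. \<Phi>1 (?A \<omega>) (?B \<omega>') \<partial>M \<partial>M)"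
    by (rule decouple(2)[OF \<delta> \<Phi>1])
  also have "\<dots> = (\<integral>\<^sup>+\<omega>'. \<integral>\<^sup>+\<omega>. \<Phi>2 (?A \<omega>) (?B \<omega>') \<partial>M \<partial>M)"
  proof (rule nn_integral_cong_AE)
    show "AE \<omega>' in M. (\<integral>\<^sup>+\<omega>. \<Phi>1 (?A \<omega>) (?B \<omega>') \<partial>M) = (\<integral>\<^sup>+\<omega>. \<Phi>2 (?A \<omega>) (?B \<omega>') \<partial>M)"
      using S_path
    proof eventually_elim
      case (elim \<omega>')
      have "mono (?B \<omega>')"
      proof (rule monoI)
        fix j k :: nat assume "j \<le> k"
        then have "real j * \<delta> \<le> real k * \<delta>" using \<delta> by (intro mult_right_mono) auto
        then have "S (real j * \<delta>) \<omega>' \<le> S (real k * \<delta>) \<omega>'"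
          using elim \<delta> by (intro mono_onD[of "{0..}" "\<lambda>t. S t \<omega>'"]) auto
        then show "clock \<delta> j \<omega>' \<le> clock \<delta> k \<omega>'" unfolding clock_def by (intro nat_mono floor_mono)
      qed
      then show ?case unfolding \<Phi>1_def \<Phi>2_def H_def by (rule average_W_increment[OF J])
    qed
  qed
  also have "\<dots> = (\<integral>\<^sup>+\<omega>. \<Phi>2 (?A \<omega>) (?B \<omega>) \<partial>M)"
    by (rule decouple(2)[OF \<delta> \<Phi>2, symmetric])
  also have "\<dots> = (\<integral>\<^sup>+\<omega>. \<integral>\<^sup>+\<omega>'. \<Phi>2 (?A \<omega>) (?B \<omega>') \<partial>M \<partial>M)"
    by (rule decouple(1)[OF \<delta> \<Phi>2])
  also have "\<dots> = (\<integral>\<^sup>+\<omega>. \<integral>\<^sup>+\<omega>'. \<Phi>3 (?A \<omega>) (?B \<omega>') \<partial>M \<partial>M)"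
    unfolding \<Phi>2_def \<Phi>3_def H_def P_def by (intro nn_integral_cong average_S_increment[OF J \<delta>])
  also have "\<dots> = (\<integral>\<^sup>+\<omega>. \<Phi>3 (?A \<omega>) (?B \<omega>) \<partial>M)"
    by (rule decouple(1)[OF \<delta> \<Phi>3, symmetric])
  finally show ?thesis unfolding \<Phi>1_def \<Phi>3_def H_def P_def skel_def .
qed

lemma skel_0: "AE \<omega> in M. skel \<delta> x 0 \<omega> = x"
  using S_0 W_0 by eventually_elim (simp add: skel_def clock_def)

lemma dgreen_eq_skel:
  assumes \<delta>: "\<delta> \<ge> 0"
  shows "dgreen \<delta> x = (\<integral>\<^sup>+\<omega>. (\<Sum>l. ennreal \<delta> * indicator (ball 0 1) (skel \<delta> x l \<omega>)) \<partial>M)"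
proof -
  have ind: "(\<lambda>\<omega>. indicator (ball 0 1) (skel \<delta> x l \<omega>) :: ennreal) \<in> borel_measurable M" for l
    by (rule measurable_compose[OF measurable_skel[OF \<delta>]]) (simp add: borel_measurable_indicator)
  have "(\<integral>\<^sup>+\<omega>. indicator (ball 0 1) (skel \<delta> x l \<omega>) \<partial>M) = (\<integral>\<^sup>+n. heat n x \<partial>compound_poisson (real l * \<delta>))" for l
  proof -
    have "(\<integral>\<^sup>+\<omega>. indicator (ball 0 1) (skel \<delta> x l \<omega>) \<partial>M) =
        (\<integral>\<^sup>+\<omega>. (\<integral>\<^sup>+n. heat n (skel \<delta> x 0 \<omega>) \<partial>compound_poisson (real l * \<delta>)) \<partial>M)"
      using skel_markov[of "\<lambda>_. 1" 0 \<delta> x l] \<delta> by simp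
    also have "\<dots> = (\<integral>\<^sup>+\<omega>. (\<integral>\<^sup>+n. heat n x \<partial>compound_poisson (real l * \<delta>)) \<partial>M)"
      using skel_0[of \<delta> x] by (intro nn_integral_cong_AE, eventually_elim) (simp only:)
    finally show ?thesis by (simp add: emeasure_space_1)
  qed
  then have "dgreen \<delta> x = (\<Sum>l. \<integral>\<^sup>+\<omega>. ennreal \<delta> * indicator (ball 0 1) (skel \<delta> x l \<omega>) \<partial>M)"
    by (simp only: dgreen_def nn_integral_cmult[OF ind])
  also have "\<dots> = (\<integral>\<^sup>+\<omega>. (\<Sum>l. ennreal \<delta> * indicator (ball 0 1) (skel \<delta> x l \<omega>)) \<partial>M)"
    by (rule nn_integral_suminf[symmetric]) (intro borel_measurable_times_ennreal ind measurable_const, simp)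
  finally show ?thesis .
qed

text \<open>The function \<open>h\<close> at the place of the first exit from \<open>E\<close>, with the same convention
  \<open>0\<close> on the event of no exit as in \<^const>\<open>at_exit\<close>.\<close>

definition skel_exit :: "real \<Rightarrow> 'a \<Rightarrow> 'a set \<Rightarrow> ('a \<Rightarrow> ennreal) \<Rightarrow> 'w \<Rightarrow> ennreal" where
  "skel_exit \<delta> x E h \<omega> =
    (if \<exists>k. skel \<delta> x k \<omega> \<notin> E then h (skel \<delta> x (LEAST k. skel \<delta> x k \<omega> \<notin> E) \<omega>) else 0)"

definition exit_event :: "'a set \<Rightarrow> nat \<Rightarrow> (nat \<Rightarrow> 'a) \<Rightarrow> ennreal" where
  "exit_event E i p = (if (\<forall>k<i. p k \<in> E) \<and> p i \<notin> E then 1 else 0)"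

lemma skel_exit_suminf:
  "skel_exit \<delta> x E h \<omega> = (\<Sum>i. exit_event E i (\<lambda>k\<in>{..i}. skel \<delta> x k \<omega>) * h (skel \<delta> x i \<omega>))"
proof -
  have "exit_event E i (\<lambda>k\<in>{..i}. skel \<delta> x k \<omega>) * h (skel \<delta> x i \<omega>) =
      (if (\<forall>k<i. skel \<delta> x k \<omega> \<in> E) \<and> skel \<delta> x i \<omega> \<notin> E then h (skel \<delta> x i \<omega>) else 0)" for i
    by (auto simp: exit_event_def)
  then show ?thesis
    unfolding skel_exit_def
    using suminf_first_failure[of "\<lambda>k. skel \<delta> x k \<omega> \<in> E" "\<lambda>i. h (skel \<delta> x i \<omega>)"] by simp
qed

lemma measurable_exit_event:
  assumes "open E"
  shows "exit_event E i \<in> borel_measurable (PiM {..i} (\<lambda>_. borel))"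
proof -
  have [measurable]: "E \<in> sets borel" using assms by simp
  have [measurable]: "(\<lambda>p. p k) \<in> PiM {..i} (\<lambda>_. borel :: 'a measure) \<rightarrow>\<^sub>M borel" if "k \<le> i" for k
    using that by (intro measurable_component_singleton) simp
  have "Measurable.pred (PiM {..i} (\<lambda>_. borel :: 'a measure)) (\<lambda>p. \<forall>k\<in>{..<i}. p k \<in> E)"
    by (intro pred_intros_finite pred_sets2[OF \<open>E \<in> sets borel\<close>] measurable_component_singleton) auto
  moreover have "Measurable.pred (PiM {..i} (\<lambda>_. borel :: 'a measure)) (\<lambda>p. p i \<in> E)"
    by (intro pred_sets2[OF \<open>E \<in> sets borel\<close>] measurable_component_singleton) auto
  ultimately have [measurable]: "Measurable.pred (PiM {..i} (\<lambda>_. borel :: 'a measure)) (\<lambda>p. (\<forall>k<i. p k \<in> E) \<and> p i \<notin> E)"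
    by (simp add: Ball_def lessThan_iff)
  show ?thesis unfolding exit_event_def[abs_def] by measurable
qed

lemma measurable_exit_event_skel:
  assumes "open E" "\<delta> \<ge> 0"
  shows "(\<lambda>\<omega>. exit_event E i (\<lambda>k\<in>{..i}. skel \<delta> x k \<omega>)) \<in> borel_measurable M"
  by (rule measurable_compose[OF _ measurable_exit_event[OF assms(1)]])
     (intro measurable_restrict measurable_skel[OF assms(2)])

lemma measurable_skel_exit:
  assumes "open E" "\<delta> \<ge> 0" "h \<in> borel_measurable borel"
  shows "skel_exit \<delta> x E h \<in> borel_measurable M"
  unfolding skel_exit_suminf[abs_def]
  by (intro borel_measurable_suminf_order borel_measurable_times_ennreal measurable_exit_event_skel assms
      measurable_compose[OF measurable_skel[OF assms(2)] assms(3)])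

text \<open>Before the exit from \<open>E\<close> there are no visits to the unit ball, so all visits take place after the
  exit. Summing over the exit times and applying the Markov property at each of them gives the mean
  value property without any integrability or stopping theorem.\<close>

lemma dgreen_exit:
  assumes E: "open E" "E \<inter> ball 0 1 = {}" and \<delta>: "\<delta> \<ge> 0"
  shows "dgreen \<delta> x = (\<integral>\<^sup>+\<omega>. skel_exit \<delta> x E (dgreen \<delta>) \<omega> \<partial>M)"
proof -
  let ?e = "\<lambda>i \<omega>. exit_event E i (\<lambda>k\<in>{..i}. skel \<delta> x k \<omega>)"
  let ?I = "\<lambda>l \<omega>. indicator (ball 0 1) (skel \<delta> x l \<omega>) :: ennreal"
  note me = measurable_exit_event_skel[OF E(1) \<delta>, of _ x]
  have mi: "?I l \<in> borel_measurable M" for l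
    by (rule measurable_compose[OF measurable_skel[OF \<delta>]]) (simp add: borel_measurable_indicator)
  have mp: "(\<lambda>\<omega>. \<integral>\<^sup>+n. heat n (skel \<delta> x i \<omega>) \<partial>compound_poisson (real l * \<delta>)) \<in> borel_measurable M" for i l
    by (rule measurable_compose[OF measurable_skel[OF \<delta>] measurable_compound_poisson_heat])
  have path: "(\<Sum>l. ennreal \<delta> * ?I l \<omega>) = (\<Sum>i. ?e i \<omega> * (\<Sum>l. ennreal \<delta> * ?I (i + l) \<omega>))" for \<omega>
  proof -
    have "?e i \<omega> * (\<Sum>l. ennreal \<delta> * ?I (i + l) \<omega>) =
        (if (\<forall>k<i. skel \<delta> x k \<omega> \<in> E) \<and> \<not> skel \<delta> x i \<omega> \<in> E then (\<Sum>l. ennreal \<delta> * ?I (i + l) \<omega>) else 0)" for i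
      by (auto simp: exit_event_def)
    then have "(\<Sum>i. ?e i \<omega> * (\<Sum>l. ennreal \<delta> * ?I (i + l) \<omega>)) =
        (if \<exists>k. skel \<delta> x k \<omega> \<notin> E then (\<Sum>l. ennreal \<delta> * ?I ((LEAST k. skel \<delta> x k \<omega> \<notin> E) + l) \<omega>) else 0)"
      by (simp only: suminf_first_failure)
    also have "\<dots> = (\<Sum>l. ennreal \<delta> * ?I l \<omega>)"
    proof (cases "\<exists>k. skel \<delta> x k \<omega> \<notin> E")
      case True
      define i where "i = (LEAST k. skel \<delta> x k \<omega> \<notin> E)"
      have "skel \<delta> x k \<omega> \<in> E" if "k < i" for k using that not_less_Least unfolding i_def by blast
      then have z: "?I k \<omega> = 0" if "k < i" for k
        using that E(2) by (simp add: indicator_def disjoint_iff)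
      have "(\<Sum>l. ennreal \<delta> * ?I l \<omega>) = (\<Sum>l. ennreal \<delta> * ?I (l + i) \<omega>) + (\<Sum>l<i. ennreal \<delta> * ?I l \<omega>)"
        by (rule suminf_offset) simp
      also have "(\<Sum>l<i. ennreal \<delta> * ?I l \<omega>) = 0" using z by simp
      finally show ?thesis using True by (simp add: i_def add.commute)
    next
      case False
      then have "?I k \<omega> = 0" for k using E(2) by (simp add: indicator_def disjoint_iff)
      then show ?thesis using False by simp
    qed
    finally show ?thesis ..
  qed
  have "dgreen \<delta> x = (\<integral>\<^sup>+\<omega>. (\<Sum>i. ?e i \<omega> * (\<Sum>l. ennreal \<delta> * ?I (i + l) \<omega>)) \<partial>M)"
    unfolding dgreen_eq_skel[OF \<delta>] path ..
  also have "\<dots> = (\<integral>\<^sup>+\<omega>. (\<Sum>i. \<Sum>l. ennreal \<delta> * (?e i \<omega> * ?I (i + l) \<omega>)) \<partial>M)"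
    by (simp only: ennreal_suminf_cmult[symmetric] mult.left_commute)
  also have "\<dots> = (\<Sum>i. \<Sum>l. \<integral>\<^sup>+\<omega>. ennreal \<delta> * (?e i \<omega> * ?I (i + l) \<omega>) \<partial>M)"
    by (simp only: nn_integral_suminf borel_measurable_suminf_order borel_measurable_times_ennreal measurable_const
        space_borel UNIV_I me mi)
  also have "\<dots> = (\<Sum>i. \<Sum>l. ennreal \<delta> * (\<integral>\<^sup>+\<omega>. ?e i \<omega> * ?I (i + l) \<omega> \<partial>M))"
    by (simp only: nn_integral_cmult borel_measurable_times_ennreal me mi)
  also have "\<dots> = (\<Sum>i. \<Sum>l. ennreal \<delta> * (\<integral>\<^sup>+\<omega>. ?e i \<omega> * (\<integral>\<^sup>+n. heat n (skel \<delta> x i \<omega>) \<partial>compound_poisson (real l * \<delta>)) \<partial>M))"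
    by (simp only: skel_markov[OF measurable_exit_event[OF E(1)] \<delta>])
  also have "\<dots> = (\<Sum>i. \<Sum>l. \<integral>\<^sup>+\<omega>. ennreal \<delta> * (?e i \<omega> * (\<integral>\<^sup>+n. heat n (skel \<delta> x i \<omega>) \<partial>compound_poisson (real l * \<delta>))) \<partial>M)"
    by (simp only: nn_integral_cmult borel_measurable_times_ennreal me mp)
  also have "\<dots> = (\<integral>\<^sup>+\<omega>. (\<Sum>i. \<Sum>l. ennreal \<delta> * (?e i \<omega> * (\<integral>\<^sup>+n. heat n (skel \<delta> x i \<omega>) \<partial>compound_poisson (real l * \<delta>)))) \<partial>M)"
    by (simp only: nn_integral_suminf borel_measurable_suminf_order borel_measurable_times_ennreal measurable_const
        space_borel UNIV_I me mp)
  also have "\<dots> = (\<integral>\<^sup>+\<omega>. skel_exit \<delta> x E (dgreen \<delta>) \<omega> \<partial>M)"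
    unfolding skel_exit_suminf dgreen_def
    by (simp only: ennreal_suminf_cmult[symmetric] mult.left_commute)
  finally show ?thesis .
qed

end

section \<open>Harmonicity of the Green function\<close>

lemma dyadic_between:
  fixes a b :: real
  assumes "0 \<le> a" "a < b"
  shows "\<exists>k n. a < real k * (1 / 2 ^ n) \<and> real k * (1 / 2 ^ n) < b"
proof -
  obtain n where n: "(1 / 2) ^ n < b - a"
    using real_arch_pow_inv[of "b - a" "1 / 2"] assms by auto
  define k where "k = Suc (nat \<lfloor>a * 2 ^ n\<rfloor>)"
  have "real k = of_int \<lfloor>a * 2 ^ n\<rfloor> + 1" using assms by (simp add: k_def)
  then have "a * 2 ^ n < real k" "real k \<le> a * 2 ^ n + 1" by linarith+
  then have "a < real k * (1 / 2 ^ n)" "real k * (1 / 2 ^ n) \<le> a + (1 / 2) ^ n"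
    by (simp_all add: field_simps power_one_over)
  with n show ?thesis by (intro exI[of _ k] exI[of _ n]) auto
qed

text \<open>By right-continuity the values at dyadic times shortly after \<open>t\<close> differ by less than \<open>1\<close>, so these
  integers coincide; monotonicity extends this to all times shortly after \<open>t\<close>.\<close>

lemma locally_constant_right:
  fixes s :: "real \<Rightarrow> real"
  assumes mono: "mono_on {0..} s" and cont: "continuous (at_right t) s"
    and nat: "\<And>k n. s (real k * (1 / 2 ^ n)) \<in> \<nat>" and t: "0 \<le> t"
  shows "\<exists>\<epsilon>>0. \<forall>u. t \<le> u \<and> u < t + \<epsilon> \<longrightarrow> s u = s t"
proof -
  have lim: "(s \<longlongrightarrow> s t) (at_right t)" using cont by (simp add: continuous_within)
  have "eventually (\<lambda>u. dist (s u) (s t) < 1/2) (at_right t)"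
    by (rule tendstoD[OF lim]) simp
  then obtain b where b: "t < b" "\<And>u. t < u \<Longrightarrow> u < b \<Longrightarrow> dist (s u) (s t) < 1/2"
    by (auto simp: eventually_at_right_field)
  obtain k0 n0 where d0: "t < real k0 * (1 / 2 ^ n0)" "real k0 * (1 / 2 ^ n0) < b"
    using dyadic_between[OF t b(1)] by blast
  define c where "c = s (real k0 * (1 / 2 ^ n0))"
  have dyadic: "s (real k * (1 / 2 ^ n)) = c" if "t < real k * (1 / 2 ^ n)" "real k * (1 / 2 ^ n) < b" for k n
  proof -
    have "\<bar>s (real k * (1 / 2 ^ n)) - c\<bar> < 1"
      using b(2)[OF that] b(2)[OF d0] unfolding c_def dist_real_def by linarith
    moreover obtain i j where "s (real k * (1 / 2 ^ n)) = real i" "c = real j"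
      using nat[of k n] nat[of k0 n0] unfolding c_def by (elim Nats_cases)
    ultimately show ?thesis by simp
  qed
  have const: "s u = c" if u: "t < u" "u < b" for u
  proof -
    obtain k1 n1 where 1: "t < real k1 * (1 / 2 ^ n1)" "real k1 * (1 / 2 ^ n1) < u"
      using dyadic_between[OF t u(1)] by blast
    obtain k2 n2 where 2: "u < real k2 * (1 / 2 ^ n2)" "real k2 * (1 / 2 ^ n2) < b"
      using dyadic_between[of u b] u t by auto
    have "s (real k1 * (1 / 2 ^ n1)) \<le> s u" "s u \<le> s (real k2 * (1 / 2 ^ n2))"
      using 1 2 u t by (auto intro!: mono_onD[OF mono])
    then show ?thesis using dyadic[of k1 n1] dyadic[of k2 n2] 1 2 u by simp
  qed
  have "eventually (\<lambda>u. s u = c) (at_right t)"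
    using b(1) const by (auto simp: eventually_at_right_field)
  then have "(s \<longlongrightarrow> c) (at_right t)" by (rule tendsto_eventually)
  with lim have "s t = c" by (intro tendsto_unique[OF _ lim]) simp_all
  then show ?thesis using b(1) const
    by (intro exI[of _ "b - t"]) (auto simp: less_le)
qed

text \<open>A path that is constant on a short interval to the right of every time stays for a while at the
  place where it leaves \<open>E\<close>, and a fine dyadic grid meets that interval. Without local constancy the
  path could return to \<open>E\<close> between two grid points.\<close>

lemma exit_time_skeleton:
  fixes X :: "real \<Rightarrow> 'w \<Rightarrow> 'b" and g :: "'b \<Rightarrow> ennreal"
  assumes loc: "\<And>t. 0 \<le> t \<Longrightarrow> \<exists>\<epsilon>>0. \<forall>u. t \<le> u \<and> u < t + \<epsilon> \<longrightarrow> X u \<omega> = X t \<omega>"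
  shows "eventually (\<lambda>n. (if \<exists>k. X (real k * (1 / 2 ^ n)) \<omega> \<notin> E
      then g (X (real (LEAST k. X (real k * (1 / 2 ^ n)) \<omega> \<notin> E) * (1 / 2 ^ n)) \<omega>) else 0) =
    (if exit_time X E \<omega> = \<infinity> then 0 else g (X (real_of_ereal (exit_time X E \<omega>)) \<omega>))) sequentially"
proof -
  define T where "T = {t. 0 \<le> t \<and> X t \<omega> \<notin> E}"
  have et: "exit_time X E \<omega> = Inf (ereal ` T)" by (simp add: exit_time_def T_def)
  show ?thesis
  proof (cases "T = {}")
    case True
    then have "X (real k * (1 / 2 ^ n)) \<omega> \<in> E" for k n by (auto simp: T_def)
    moreover have "exit_time X E \<omega> = \<infinity>" using True et by (simp add: top_ereal_def)
    ultimately show ?thesis by simp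
  next
    case False
    define \<tau> where "\<tau> = Inf T"
    have bdd: "bdd_below T" by (rule bdd_belowI[of _ 0]) (simp add: T_def)
    have \<tau>: "exit_time X E \<omega> = ereal \<tau>" unfolding et \<tau>_def using ereal_Inf'[OF bdd False] by simp
    have \<tau>0: "0 \<le> \<tau>" unfolding \<tau>_def by (rule cInf_greatest[OF False]) (simp add: T_def)
    obtain \<epsilon> where \<epsilon>: "\<epsilon> > 0" "\<And>u. \<tau> \<le> u \<Longrightarrow> u < \<tau> + \<epsilon> \<Longrightarrow> X u \<omega> = X \<tau> \<omega>"
      using loc[OF \<tau>0] by blast
    obtain t where t: "t \<in> T" "t < \<tau> + \<epsilon>"
      using cInf_lessD[OF False, of "\<tau> + \<epsilon>"] \<epsilon>(1) by (auto simp: \<tau>_def)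
    have "\<tau> \<le> t" unfolding \<tau>_def by (rule cInf_lower[OF t(1) bdd])
    then have X\<tau>: "X \<tau> \<omega> \<notin> E" using \<epsilon>(2)[of t] t by (auto simp: T_def)
    have before: "X u \<omega> \<in> E" if "0 \<le> u" "u < \<tau>" for u
    proof (rule ccontr)
      assume "X u \<omega> \<notin> E"
      then have "u \<in> T" using that by (simp add: T_def)
      then have "\<tau> \<le> u" unfolding \<tau>_def by (rule cInf_lower[OF _ bdd])
      with that show False by simp
    qed
    have "eventually (\<lambda>n. (1 / 2 :: real) ^ n < \<epsilon>) sequentially"
      by (rule order_tendstoD(2)[OF LIMSEQ_realpow_zero]) (use \<epsilon>(1) in auto)
    then show ?thesis
    proof eventually_elim
      case (elim n)
      define i where "i = nat \<lceil>\<tau> * 2 ^ n\<rceil>"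
      have i: "real i = of_int \<lceil>\<tau> * 2 ^ n\<rceil>" using \<tau>0 by (simp add: i_def)
      then have "\<tau> * 2 ^ n \<le> real i" "real i < \<tau> * 2 ^ n + 1" by linarith+
      then have "\<tau> \<le> real i * (1 / 2 ^ n)" "real i * (1 / 2 ^ n) < \<tau> + (1 / 2) ^ n"
        by (simp_all add: field_simps power_one_over)
      then have Xi: "X (real i * (1 / 2 ^ n)) \<omega> = X \<tau> \<omega>" using elim by (intro \<epsilon>(2)) auto
      have Xk: "X (real k * (1 / 2 ^ n)) \<omega> \<in> E" if "k < i" for k
      proof (rule before)
        have "real k < \<tau> * 2 ^ n" using that unfolding i_def by linarith
        then show "real k * (1 / 2 ^ n) < \<tau>" by (simp add: field_simps)
      qed simp
      have "(LEAST k. X (real k * (1 / 2 ^ n)) \<omega> \<notin> E) = i"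
        using Xi X\<tau> Xk by (intro Least_equality) (auto simp: not_less[symmetric])
      moreover have "\<exists>k. X (real k * (1 / 2 ^ n)) \<omega> \<notin> E"
        by (rule exI[of _ i]) (simp only: Xi X\<tau> not_False_eq_True)
      ultimately show ?case by (simp only: Xi \<tau> if_True) simp
    qed
  qed
qed

text \<open>Exit values are only known to be almost surely equal to limits of measurable functions, which is
  sufficient for measurability with respect to the completion.\<close>

lemma borel_measurable_completion_AE:
  assumes b: "b \<in> borel_measurable M" and ae: "AE \<omega> in M. a \<omega> = b \<omega>"
  shows "a \<in> borel_measurable (completion M)"
proof (rule measurableI)
  fix A :: "'b set" assume A: "A \<in> sets borel"
  have [measurable]: "b \<in> borel_measurable (completion M)" by (rule measurable_completion[OF b])
  have "Measurable.pred (completion M) (\<lambda>\<omega>. a \<omega> \<noteq> b \<omega>)"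
    using ae by (intro sets_completion_AE) simp
  moreover have "Measurable.pred (completion M) (\<lambda>\<omega>. a \<omega> \<noteq> b \<omega> \<and> a \<omega> \<in> A)"
    using ae by (intro sets_completion_AE) (auto elim!: eventually_mono)
  ultimately have "Measurable.pred (completion M) (\<lambda>\<omega>. (a \<omega> \<noteq> b \<omega> \<and> a \<omega> \<in> A) \<or> (\<not> (a \<omega> \<noteq> b \<omega>) \<and> b \<omega> \<in> A))"
    using A by measurable
  also have "(\<lambda>\<omega>. (a \<omega> \<noteq> b \<omega> \<and> a \<omega> \<in> A) \<or> (\<not> (a \<omega> \<noteq> b \<omega>) \<and> b \<omega> \<in> A)) = (\<lambda>\<omega>. a \<omega> \<in> A)"
    by auto
  finally show "a -` A \<inter> space (completion M) \<in> sets (completion M)"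
    by (simp add: pred_def vimage_def Int_def conj_commute)
qed simp

context lacunary_sbm
begin

lemma skel_exit_at_exit:
  assumes fin: "\<And>y::'a. green y < \<infinity>"
  shows "AE \<omega> in M. eventually (\<lambda>n. skel_exit (1 / 2 ^ n) x E green \<omega> =
    ennreal (at_exit (subordinated W S x) E (\<lambda>y. enn2real (green y)) \<omega>)) sequentially"
proof -
  have "AE \<omega> in M. \<forall>n k. S (real k * (1 / 2 ^ n)) \<omega> \<in> \<nat>"
    unfolding AE_all_countable by (intro allI S_nat) simp
  with S_path show ?thesis
  proof eventually_elim
    case (elim \<omega>)
    let ?X = "subordinated W S x"
    have loc: "\<exists>\<epsilon>>0. \<forall>u. t \<le> u \<and> u < t + \<epsilon> \<longrightarrow> ?X u \<omega> = ?X t \<omega>" if "0 \<le> t" for t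
    proof -
      have "\<exists>\<epsilon>>0. \<forall>u. t \<le> u \<and> u < t + \<epsilon> \<longrightarrow> S u \<omega> = S t \<omega>"
        using elim that by (intro locally_constant_right[of "\<lambda>t. S t \<omega>"]) auto
      then obtain \<epsilon> where \<epsilon>: "\<epsilon> > 0" "\<And>u. t \<le> u \<Longrightarrow> u < t + \<epsilon> \<Longrightarrow> S u \<omega> = S t \<omega>" by blast
      show ?thesis
      proof (intro exI[of _ \<epsilon>] conjI allI impI \<epsilon>(1))
        fix u assume "t \<le> u \<and> u < t + \<epsilon>"
        then have "S u \<omega> = S t \<omega>" by (intro \<epsilon>(2)) auto
        then show "?X u \<omega> = ?X t \<omega>" by (simp only: subordinated_def)
      qed
    qed
    have X: "skel (1 / 2 ^ n) x k \<omega> = ?X (real k * (1 / 2 ^ n)) \<omega>" for n k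
    proof -
      obtain j where "S (real k * (1 / 2 ^ n)) \<omega> = real j" using elim by (meson Nats_cases)
      then show ?thesis by (simp add: skel_def clock_def subordinated_def)
    qed
    have eq: "ennreal (at_exit ?X E (\<lambda>y. enn2real (green y)) \<omega>) =
        (if exit_time ?X E \<omega> = \<infinity> then 0 else green (?X (real_of_ereal (exit_time ?X E \<omega>)) \<omega>))"
      using fin by (simp add: at_exit_def)
    show ?case
      unfolding skel_exit_def X eq
      by (rule exit_time_skeleton[of ?X \<omega> E green]) (rule loc)
  qed
qed

lemma skel_exit_le:
  assumes "\<And>y. h y \<le> c * g y"
  shows "skel_exit \<delta> x E h \<omega> \<le> c * skel_exit \<delta> x E g \<omega>"
proof (cases "\<exists>k. skel \<delta> x k \<omega> \<notin> E")
  case True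
  show ?thesis unfolding skel_exit_def if_P[OF True] by (rule assms)
next
  case False
  show ?thesis unfolding skel_exit_def if_not_P[OF False] by (rule zero_le)
qed

lemma skel_exit_green:
  assumes E: "open E" "E \<inter> ball 0 1 = {}" and \<delta>: "\<delta> > 0"
  shows "green x \<le> ennreal (exp (4 * \<delta>)) * (\<integral>\<^sup>+\<omega>. skel_exit \<delta> x E green \<omega> \<partial>M)"
    and "(\<integral>\<^sup>+\<omega>. skel_exit \<delta> x E green \<omega> \<partial>M) \<le> ennreal (exp (4 * \<delta>)) * green x"
proof -
  let ?c = "ennreal (exp (2 * \<delta>))"
  have cc: "?c * (?c * z) = ennreal (exp (4 * \<delta>)) * z" for z
  proof -
    have "exp (2 * \<delta>) * exp (2 * \<delta>) = exp (4 * \<delta>)" by (simp only: exp_add[symmetric]) simp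
    moreover have "?c * ?c = ennreal (exp (2 * \<delta>) * exp (2 * \<delta>))" by (rule ennreal_mult[symmetric]) simp_all
    ultimately have "?c * ?c = ennreal (exp (4 * \<delta>))" by (simp only:)
    then show ?thesis by (simp only: mult.assoc[symmetric])
  qed
  have d0: "\<delta> \<ge> 0" using \<delta> by simp
  have mg: "skel_exit \<delta> x E green \<in> borel_measurable M"
    by (rule measurable_skel_exit[OF E(1) d0 measurable_green])
  have md: "skel_exit \<delta> x E (dgreen \<delta>) \<in> borel_measurable M"
    by (rule measurable_skel_exit[OF E(1) d0 measurable_dgreen])
  have "(\<integral>\<^sup>+\<omega>. skel_exit \<delta> x E (dgreen \<delta>) \<omega> \<partial>M) \<le> (\<integral>\<^sup>+\<omega>. ?c * skel_exit \<delta> x E green \<omega> \<partial>M)"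
    by (intro nn_integral_mono skel_exit_le dgreen_green(1)[OF \<delta>])
  also have "\<dots> = ?c * (\<integral>\<^sup>+\<omega>. skel_exit \<delta> x E green \<omega> \<partial>M)"
    by (rule nn_integral_cmult[OF mg])
  finally have le: "dgreen \<delta> x \<le> ?c * (\<integral>\<^sup>+\<omega>. skel_exit \<delta> x E green \<omega> \<partial>M)"
    by (simp only: dgreen_exit[OF E d0, of x, symmetric])
  have "green x \<le> ?c * dgreen \<delta> x" by (rule dgreen_green(2)[OF \<delta>])
  also have "\<dots> \<le> ?c * (?c * (\<integral>\<^sup>+\<omega>. skel_exit \<delta> x E green \<omega> \<partial>M))"
    by (rule mult_left_mono[OF le]) simp
  finally show "green x \<le> ennreal (exp (4 * \<delta>)) * (\<integral>\<^sup>+\<omega>. skel_exit \<delta> x E green \<omega> \<partial>M)"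
    by (simp only: cc)
  have "(\<integral>\<^sup>+\<omega>. skel_exit \<delta> x E green \<omega> \<partial>M) \<le> (\<integral>\<^sup>+\<omega>. ?c * skel_exit \<delta> x E (dgreen \<delta>) \<omega> \<partial>M)"
    by (intro nn_integral_mono skel_exit_le dgreen_green(2)[OF \<delta>])
  also have "\<dots> = ?c * dgreen \<delta> x"
    unfolding dgreen_exit[OF E d0, of x] by (rule nn_integral_cmult[OF md])
  also have "\<dots> \<le> ?c * (?c * green x)"
    by (intro mult_left_mono dgreen_green(1)[OF \<delta>]) simp
  finally show "(\<integral>\<^sup>+\<omega>. skel_exit \<delta> x E green \<omega> \<partial>M) \<le> ennreal (exp (4 * \<delta>)) * green x"
    by (simp only: cc)
qed

text \<open>The exit values of the skeletons are uniformly bounded and almost surely eventually equal to the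
  exit value of the process. By dominated convergence the almost exact mean value property of
  \<open>skel_exit_green\<close> becomes exact as the mesh tends to \<open>0\<close>.\<close>

lemma green_mean_value:
  fixes E :: "'a set" and x :: 'a
  assumes E: "open E" "E \<inter> ball 0 1 = {}"
  defines "a \<equiv> at_exit (subordinated W S x) E (\<lambda>y. enn2real (green y))"
  shows "integrable (completion M) a" and "enn2real (green x) = (\<integral>\<omega>. a \<omega> \<partial>completion M)"
proof -
  obtain K where K: "K \<ge> 0" "\<And>y::'a. green y \<le> ennreal K" by (rule green_bounded[where 'a='a]) blast
  have fin: "green y < \<infinity>" for y :: 'a using K(2)[of y] by (rule le_less_trans) simp
  define F where "F n \<omega> = skel_exit (1 / 2 ^ n) x E green \<omega>" for n \<omega>
  have mF [measurable]: "F n \<in> borel_measurable M" for n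
    unfolding F_def[abs_def] by (rule measurable_skel_exit[OF E(1) _ measurable_green]) simp
  have FK: "F n \<omega> \<le> ennreal K" for n \<omega> using K by (simp add: F_def skel_exit_def)
  \<comment> \<open>a Borel version of the exit value\<close>
  define L where "L \<omega> = liminf (\<lambda>n. F n \<omega>)" for \<omega>
  have mL [measurable]: "L \<in> borel_measurable M" unfolding L_def[abs_def] by measurable
  have ev: "AE \<omega> in M. eventually (\<lambda>n. F n \<omega> = ennreal (a \<omega>)) sequentially"
    unfolding F_def a_def by (rule skel_exit_at_exit[OF fin])
  then have Lim: "AE \<omega> in M. (\<lambda>n. F n \<omega>) \<longlonglongrightarrow> L \<omega>" and La: "AE \<omega> in M. L \<omega> = ennreal (a \<omega>)"
  proof -
    have "AE \<omega> in M. L \<omega> = ennreal (a \<omega>) \<and> (\<lambda>n. F n \<omega>) \<longlonglongrightarrow> L \<omega>"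
      using ev
    proof eventually_elim
      case (elim \<omega>)
      then have l: "(\<lambda>n. F n \<omega>) \<longlonglongrightarrow> ennreal (a \<omega>)" by (rule tendsto_eventually)
      then have "L \<omega> = ennreal (a \<omega>)" unfolding L_def by (intro lim_imp_Liminf) simp_all
      with l show ?case by simp
    qed
    then show "AE \<omega> in M. (\<lambda>n. F n \<omega>) \<longlonglongrightarrow> L \<omega>" "AE \<omega> in M. L \<omega> = ennreal (a \<omega>)"
      by (auto elim!: eventually_mono)
  qed
  have a0: "a \<omega> \<ge> 0" for \<omega> by (simp add: a_def at_exit_def)
  have ab: "AE \<omega> in M. a \<omega> = enn2real (L \<omega>)"
    using La by eventually_elim (simp add: a0)
  have aK: "a \<omega> \<le> K" for \<omega>
    using K by (simp add: a_def at_exit_def enn2real_leI)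
  have ma: "a \<in> borel_measurable (completion M)"
    by (rule borel_measurable_completion_AE[OF _ ab]) simp
  interpret C: prob_space "completion M" by (rule prob_space_completion)
  show int: "integrable (completion M) a"
    by (rule C.integrable_const_bound[where B=K]) (use a0 aK ma in auto)
  have "(\<lambda>n. \<integral>\<^sup>+\<omega>. F n \<omega> \<partial>M) \<longlonglongrightarrow> (\<integral>\<^sup>+\<omega>. L \<omega> \<partial>M)"
    by (rule nn_integral_dominated_convergence[where w="\<lambda>_. ennreal K"])
       (use FK Lim in \<open>auto simp: emeasure_space_1\<close>)
  also have "(\<integral>\<^sup>+\<omega>. L \<omega> \<partial>M) = (\<integral>\<^sup>+\<omega>. ennreal (a \<omega>) \<partial>M)"
    by (rule nn_integral_cong_AE[OF La])
  finally have lim: "(\<lambda>n. \<integral>\<^sup>+\<omega>. F n \<omega> \<partial>M) \<longlonglongrightarrow> (\<integral>\<^sup>+\<omega>. ennreal (a \<omega>) \<partial>M)" .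
  have one: "(\<lambda>n. ennreal (exp (4 * (1 / 2 ^ n)))) \<longlonglongrightarrow> ennreal 1"
    by (intro tendsto_ennrealI) real_asymp
  have "green x \<le> 1 * (\<integral>\<^sup>+\<omega>. ennreal (a \<omega>) \<partial>M)"
  proof (rule LIMSEQ_le_const)
    show "(\<lambda>n. ennreal (exp (4 * (1 / 2 ^ n))) * (\<integral>\<^sup>+\<omega>. F n \<omega> \<partial>M)) \<longlonglongrightarrow> 1 * (\<integral>\<^sup>+\<omega>. ennreal (a \<omega>) \<partial>M)"
      using one lim by (intro tendsto_mult_ennreal) auto
    show "\<exists>N. \<forall>n\<ge>N. green x \<le> ennreal (exp (4 * (1 / 2 ^ n))) * (\<integral>\<^sup>+\<omega>. F n \<omega> \<partial>M)"
      unfolding F_def by (intro exI allI impI skel_exit_green(1)[OF E]) simp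
  qed
  moreover have "(\<integral>\<^sup>+\<omega>. ennreal (a \<omega>) \<partial>M) \<le> 1 * green x"
  proof (rule LIMSEQ_le[OF lim])
    show "(\<lambda>n. ennreal (exp (4 * (1 / 2 ^ n))) * green x) \<longlonglongrightarrow> 1 * green x"
      using one fin[of x] by (intro tendsto_mult_ennreal) auto
    show "\<exists>N. \<forall>n\<ge>N. (\<integral>\<^sup>+\<omega>. F n \<omega> \<partial>M) \<le> ennreal (exp (4 * (1 / 2 ^ n))) * green x"
      unfolding F_def by (intro exI allI impI skel_exit_green(2)[OF E]) simp
  qed
  ultimately have "green x = (\<integral>\<^sup>+\<omega>. ennreal (a \<omega>) \<partial>M)" by simp
  also have "\<dots> = (\<integral>\<^sup>+\<omega>. ennreal (a \<omega>) \<partial>completion M)" by (simp add: nn_integral_completion)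
  also have "\<dots> = ennreal (\<integral>\<omega>. a \<omega> \<partial>completion M)"
    by (rule nn_integral_eq_integral[OF int]) (simp add: a0)
  finally show "enn2real (green x) = (\<integral>\<omega>. a \<omega> \<partial>completion M)"
    by (simp add: integral_nonneg_AE a0)
qed

lemma green_harmonic:
  assumes "D \<inter> ball 0 1 = {}"
  shows "harmonic_on M (subordinated W S) D (\<lambda>x. enn2real (green x))"
  unfolding harmonic_on_def
proof (intro conjI allI impI ballI)
  note [measurable] = measurable_green
  show "(\<lambda>x::'a. enn2real (green x)) \<in> borel_measurable borel" by measurable
  fix E :: "'a set" and x
  assume "open E \<and> compact (closure E) \<and> closure E \<subseteq> D"
  then have E: "open E" "E \<inter> ball 0 1 = {}" using assms closure_subset[of E] by blast+
  show "integrable (completion M) (at_exit (subordinated W S x) E (\<lambda>y. enn2real (green y)))"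
    "enn2real (green x) = (\<integral>\<omega>. at_exit (subordinated W S x) E (\<lambda>y. enn2real (green y)) \<omega> \<partial>completion M)"
    by (rule green_mean_value[OF E])+
qed

end

section \<open>Failure of the Harnack inequality\<close>

theorem mainTheorem5:
  fixes M :: "'w measure"
    and S :: "real \<Rightarrow> 'w \<Rightarrow> real"
    and W :: "real \<Rightarrow> 'w \<Rightarrow> 'a::euclidean_space"
  assumes "prob_space M"
    and "subordinator M 0 lacunary_measure S"
    and "standard_brownian_motion M W"
    and "independent_processes M W S"
  shows "\<not> LargeEHI M (subordinated W S)"
proof
  assume large_ehi: "LargeEHI M (subordinated W S)"
  define Q where "Q C1 C2 \<kappa> \<longleftrightarrow> (\<forall>x0. \<forall>r\<ge>C1. \<forall>h.
      (\<forall>x. 0 \<le> h x) \<and> harmonic_on M (subordinated W S) (ball x0 r) h \<longrightarrow>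
      (\<forall>x\<in>ball x0 (\<kappa> * r). \<forall>y\<in>ball x0 (\<kappa> * r). h x \<le> C2 * h y))" for C1 C2 \<kappa>
  have "\<exists>C1>0. \<exists>C2>0. \<exists>\<kappa>\<in>{0<..<1}. Q C1 C2 \<kappa>"
    using large_ehi unfolding LargeEHI_def Q_def .
  then obtain C1 C2 \<kappa> where C1: "C1 > 0" and C2: "C2 > 0" and \<kappa>: "\<kappa> \<in> {0<..<1}" and Q: "Q C1 C2 \<kappa>"
    by blast
  note EHI = Q[unfolded Q_def]
  have C: "C1 > 0" "C2 > 0" "0 < \<kappa>" "\<kappa> < 1" using C1 C2 \<kappa> by auto
  have ehi: "h x \<le> C2 * h y"
    if "C1 \<le> r" "\<And>x. 0 \<le> h x" "harmonic_on M (subordinated W S) (ball x0 r) h"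
      "x \<in> ball x0 (\<kappa> * r)" "y \<in> ball x0 (\<kappa> * r)" for x0 r h x y
    using EHI[rule_format, OF that(1) conjI[OF allI[OF that(2)] that(3)] that(4,5)] .
  interpret lacunary_sbm M S W
    using assms by (intro lacunary_sbm.intro) (auto simp: lacunary_sbm_axioms_def)
  obtain e :: 'a where e: "e \<in> Basis" using nonempty_Basis by blast
  \<comment> \<open>consecutive points \<open>y m i\<close> have distance \<open>\<kappa> / 4 * norm (y m i)\<close>, half of the radius \<open>\<kappa> * (norm (y m i) / 2)\<close>\<close>
  define \<rho> where "\<rho> = 1 + \<kappa> / 4"
  have \<rho>: "\<rho> > 1" using C by (simp add: \<rho>_def)
  define y :: "nat \<Rightarrow> nat \<Rightarrow> 'a" where "y m i = (\<rho> ^ i * sqrt (jump m)) *\<^sub>R e" for m i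
  define h where "h x = enn2real (green (x :: 'a))" for x
  define v where "v m = unit_ball_vol DIM('a) * (1 / sqrt (jump m)) ^ DIM('a)" for m
  have v0: "v m > 0" for m by (simp add: v_def)
  define c where "c = (1 / sqrt (96 * pi)) ^ DIM('a) * exp (- 2) / 16"
  define K where "K = fact DIM('a) * exp (4 :: real)"
  have c0: "c > 0" by (simp add: c_def)
  have K0: "K > 0" by (simp add: K_def)
  have norm_y: "norm (y m i) = \<rho> ^ i * sqrt (jump m)" for m i
    using e \<rho> by (simp add: y_def)
  have norm_y_ge: "sqrt (jump m) \<le> norm (y m i)" for m i
    using \<rho> one_le_power[of \<rho> i] by (simp add: norm_y mult_right_mono[of 1, simplified])
  have step: "h (y m i) \<le> C2 * h (y m (Suc i))" if m: "2 \<le> sqrt (jump m)" "2 * C1 \<le> sqrt (jump m)" for m i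
  proof (rule ehi)
    let ?r = "norm (y m i) / 2"
    show "C1 \<le> ?r" using m norm_y_ge[of m i] by simp
    show "0 \<le> h x" for x by (simp add: h_def)
    have "ball (y m i) ?r \<inter> ball 0 1 = {}"
    proof (rule disjoint_ballI)
      show "?r + 1 \<le> dist (y m i) 0" using m norm_y_ge[of m i] by simp
    qed
    then show "harmonic_on M (subordinated W S) (ball (y m i) ?r) h"
      unfolding h_def[abs_def] by (rule green_harmonic)
    have pos: "norm (y m i) > 0" using m(1) norm_y_ge[of m i] by linarith
    then show "y m i \<in> ball (y m i) (\<kappa> * ?r)" using C by simp
    have "y m i - y m (Suc i) = - (\<kappa> / 4) *\<^sub>R y m i"
      by (simp add: y_def \<rho>_def algebra_simps)
    then have "dist (y m i) (y m (Suc i)) = \<kappa> / 4 * norm (y m i)"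
      using C by (simp add: dist_norm)
    also have "\<dots> < \<kappa> * ?r" using C pos by simp
    finally show "y m (Suc i) \<in> ball (y m i) (\<kappa> * ?r)" by simp
  qed
  have chain: "h (y m 0) \<le> C2 ^ i * h (y m i)" if m: "2 \<le> sqrt (jump m)" "2 * C1 \<le> sqrt (jump m)" for m i
  proof (induction i)
    case (Suc i)
    also have "C2 ^ i * h (y m i) \<le> C2 ^ i * (C2 * h (y m (Suc i)))"
      using C by (intro mult_left_mono step m) auto
    finally show ?case by (simp add: mult_ac)
  qed simp
  \<comment> \<open>the Harnack chain, with the common factor \<open>v m * 2 ^ m\<close> of the bounds on \<open>green\<close> removed\<close>
  have bound: "c \<le> C2 ^ i * (2 * K * exp (- (\<rho> ^ i / 8)) + 4 / 2 ^ m)"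
    if m: "1 \<le> m" "2 \<le> sqrt (jump m)" "2 * C1 \<le> sqrt (jump m)"
      and small: "2 ^ (m + 2) * exp (- ((2 ^ (2 * m + 1) - 1) / 16)) \<le> (1/4::real)" for m i
  proof -
    have "ennreal (v m * (c * 2 ^ m)) \<le> green (y m 0)"
      unfolding v_def c_def using m norm_y[of m 0] by (intro green_lower small) auto
    moreover have "green (y m 0) < \<infinity>"
    proof -
      obtain B where "\<And>x::'a. green x \<le> ennreal B" by (rule green_bounded[where 'a='a]) blast
      then show ?thesis by (rule le_less_trans) simp
    qed
    ultimately have "ennreal (v m * (c * 2 ^ m)) \<le> ennreal (h (y m 0))"
      unfolding h_def by (simp add: ennreal_enn2real)
    then have "v m * (c * 2 ^ m) \<le> h (y m 0)"
      by (simp add: h_def ennreal_le_iff)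
    also have "\<dots> \<le> C2 ^ i * h (y m i)" by (rule chain[OF m(2,3)])
    also have "h (y m i) \<le> v m * (K * exp (- (\<rho> ^ i / 8)) * 2 ^ Suc m + 4)"
      unfolding h_def
    proof (rule enn2real_leI)
      show "green (y m i) \<le> ennreal (v m * (K * exp (- (\<rho> ^ i / 8)) * 2 ^ Suc m + 4))"
        unfolding v_def K_def using m \<rho> norm_y_ge[of m i] by (intro green_upper norm_y) auto
    qed (use v0[of m] K0 in auto)
    finally have "v m * (c * 2 ^ m) \<le> v m * (C2 ^ i * (K * exp (- (\<rho> ^ i / 8)) * 2 ^ Suc m + 4))"
      using C by (simp add: mult_left_mono mult.left_commute)
    then have "c * 2 ^ m \<le> C2 ^ i * (K * exp (- (\<rho> ^ i / 8)) * 2 ^ Suc m + 4)"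
      using v0[of m] by simp
    also have "\<dots> = (C2 ^ i * (2 * K * exp (- (\<rho> ^ i / 8)) + 4 / 2 ^ m)) * 2 ^ m"
      by (simp add: algebra_simps)
    finally show ?thesis by simp
  qed
  have large: "eventually (\<lambda>m. B \<le> sqrt (jump m)) sequentially" for B
  proof -
    have "filterlim (\<lambda>m. sqrt (real m)) at_top sequentially" by real_asymp
    then have "eventually (\<lambda>m. B \<le> sqrt (real m)) sequentially" by (simp add: filterlim_at_top)
    then show ?thesis
    proof eventually_elim
      case (elim m)
      also have "sqrt (real m) \<le> sqrt (jump m)" using jump_gt[of m] by simp
      finally show ?case .
    qed
  qed
  \<comment> \<open>the limit \<open>m \<rightarrow> \<infinity>\<close> for fixed \<open>i\<close>\<close>
  have "c \<le> C2 ^ i * (2 * K * exp (- (\<rho> ^ i / 8)) + 0)" for i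
  proof (rule tendsto_lowerbound)
    show "(\<lambda>m. C2 ^ i * (2 * K * exp (- (\<rho> ^ i / 8)) + 4 / 2 ^ m)) \<longlonglongrightarrow> C2 ^ i * (2 * K * exp (- (\<rho> ^ i / 8)) + 0)"
      by (intro tendsto_intros) real_asymp
    show "eventually (\<lambda>m. c \<le> C2 ^ i * (2 * K * exp (- (\<rho> ^ i / 8)) + 4 / 2 ^ m)) sequentially"
      using eventually_window_small eventually_ge_at_top[of 1] large[of 2] large[of "2 * C1"]
      by eventually_elim (rule bound)
  qed simp
  then have "c \<le> 2 * K * (C2 ^ i * exp (- (\<rho> ^ i / 8)))" for i by (simp add: mult_ac)
  \<comment> \<open>the chain loses a fixed factor per step, but the Green function decays doubly exponentially in the number of steps\<close>
  moreover have "(\<lambda>i. 2 * K * (C2 ^ i * exp (- (\<rho> ^ i / 8)))) \<longlonglongrightarrow> 2 * K * 0"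
  proof (intro tendsto_mult tendsto_const)
    show "(\<lambda>i. C2 ^ i * exp (- (\<rho> ^ i / 8))) \<longlonglongrightarrow> 0"
    proof -
      define b where "b = \<bar>ln C2\<bar> + 1"
      have "b > 0" by (simp add: b_def)
      with \<rho> have lim: "(\<lambda>i. exp (b * real i - \<rho> ^ i / 8)) \<longlonglongrightarrow> 0" by real_asymp
      have le: "norm (C2 ^ i * exp (- (\<rho> ^ i / 8))) \<le> exp (b * real i - \<rho> ^ i / 8)" for i
      proof -
        have "C2 ^ i = exp (real i * ln C2)" using C(2) by (simp add: exp_of_nat_mult)
        moreover have "real i * ln C2 \<le> b * real i"
          unfolding b_def by (subst mult.commute) (intro mult_right_mono, auto)
        ultimately have "C2 ^ i * exp (- (\<rho> ^ i / 8)) \<le> exp (b * real i) * exp (- (\<rho> ^ i / 8))"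
          by (intro mult_right_mono) simp_all
        also have "\<dots> = exp (b * real i - \<rho> ^ i / 8)" by (simp only: exp_add[symmetric]) simp
        moreover have "norm (C2 ^ i * exp (- (\<rho> ^ i / 8))) = C2 ^ i * exp (- (\<rho> ^ i / 8))"
          unfolding real_norm_def using C(2) by (intro abs_of_nonneg mult_nonneg_nonneg) simp_all
        ultimately show ?thesis by (simp only:)
      qed
      show ?thesis by (rule Lim_null_comparison[OF always_eventually lim]) (use le in blast)
    qed
  qed
  ultimately have "c \<le> 2 * K * 0"
    by (intro LIMSEQ_le_const) auto
  with c0 show False by simp
qed

end
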